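(* Let $K$ be an infinite field and let $G$ be the direct limit of a sequence of diagonal embeddings $\iota_i\colon\mathrm{SL}_{n_i}\hookrightarrow\mathrm{SL}_{n_{i+1}}$, $A\mapsto\mathrm{Diag}(A,\dots,A,A^{-T},\dots,A^{-T},I_{z_i})$ ($i\in\mathbb{N}$), with $l_i$ blocks $A$ and $r_i$ blocks $A^{-T}$, where $l_i\in\mathbb{N}$, $r_i,z_i\in\mathbb{Z}_{\geq0}$, $l_i\geq r_i$. Let $V$ be the inverse limit of the corresponding sequence of spaces $\mathfrak{gl}_{n_i}/\mathrm{span}(I_{n_i})$. Put $\alpha=\#\{i\mid l_i>1\}$, $\beta=\#\{i\mid r_i>0\}$, $\gamma=\#\{i\mid z_i>0\}$ in $\mathbb{Z}_{\geq0}\cup\{\infty\}$ and assume $\alpha+\beta+\gamma=\infty$. Then exactly one of the following cases occurs: (1) $\alpha+\beta<\infty$; (2) $\alpha+\beta=\gamma=\infty$; (3a) $\beta=\infty$, $\gamma<\infty$, and $\mathrm{char}(K)\neq2$ or $2\nmid n_i$ for all $i\gg0$; (3b) $\beta=\infty$, $\gamma<\infty$, $\mathrm{char}(K)=2$ and $2\mid n_i$ for all $i\gg0$; (4a) $\beta+\gamma<\infty$ and $\mathrm{char}(K)\nmid n_i$ for all $i\gg0$; (4b) $\beta+\gamma<\infty$ and $\mathrm{char}(K)\mid n_i$ for all $i\gg0$; and the following holds. The space $V$ is $G$-Noetherian (every descending sequence of $G$-stable closed subsets stabilizes). Any $G$-stable closed subset of $V$ is a finite union of irreducible $G$-stable closed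 subsets. The irreducible $G$-stable closed subsets of $V$ are $\{0\}$ and $V$, together with $$\{(P_i\bmod I_{n_i})_i\in V\mid\forall i\gg0\colon\mathrm{rk}(P_i,I_{n_i})\leq k\}$$ for $k\in\mathbb{N}$ in case (1), and together with $$\{(P_i\bmod I_{n_i})_i\in V\mid\forall i\gg0\colon\mathrm{tr}(P_i)=\mu\}$$ for $\mu\in K$ in cases (3b) and (4b).
   Context: $\mathbb{N}$ denotes the positive integers; $\mathfrak{gl}_n$ is the space of $n\times n$ matrices over $K$; $n_{i+1}=(l_i+r_i)n_i+z_i$. If $\mathrm{char}(K)=0$ then $\mathrm{char}(K)\nmid n_i$. The transition map $\mathfrak{gl}_{n_{i+1}}/\mathrm{span}(I_{n_{i+1}})\to\mathfrak{gl}_{n_i}/\mathrm{span}(I_{n_i})$ is defined as follows: partition an $n_{i+1}\times n_{i+1}$ matrix into blocks according to $n_{i+1}=n_i+\dots+n_i+z_i$ ($l_i+r_i$ copies of $n_i$), let $P_{11},\dots,P_{l_il_i}$ be the first $l_i$ diagonal blocks and $Q_{11},\dots,Q_{r_ir_i}$ the next $r_i$ diagonal blocks; the class of the matrix is sent to $\sum_{k=1}^{l_i}P_{kk}-\sum_{\ell=1}^{r_i}Q_{\ell\ell}^T\bmod I_{n_i}$. (This is the dual of the map of Lie algebras $\mathfrak{sl}_{n_i}\to\mathfrak{sl}_{n_{i+1}}$ under the trace form.) $\mathrm{SL}_{n_i}$ acts on $\mathfrak{gl}_{n_i}/\mathrm{span}(I_{n_i})$ by conjugation, inducing an action of $G$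 on $V$. $0\in V$ is the element represented by the sequence of zero matrices. A subset of $V$ is closed if it is the inverse limit of a sequence of Zariski-closed subsets of the $\mathfrak{gl}_{n_i}/\mathrm{span}(I_{n_i})$. A closed subset $X$ is irreducible if it is nonempty and whenever $X=Y\cup Z$ with $Y,Z\subseteq X$ closed (not necessarily $G$-stable), then $X=Y$ or $X=Z$. For $P,Q\in\mathfrak{gl}_n$, $\mathrm{rk}(P,Q)=\min\{\mathrm{rk}(\mu_1P+\mu_2Q)\mid(\mu_1:\mu_2)\in\mathbb{P}^1(K)\}$. In cases (3b) and (4b) the trace of $P_i\bmod I_{n_i}$ is well defined for $i\gg0$, since $\mathrm{char}(K)\mid n_i$. *)

theory Defs
  imports
    "Jordan_Normal_Form.DL_Rank"
    "HOL-Library.Extended_Nat"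
begin

subsection \<open>The direct limit group\<close>

definition SL :: "nat \<Rightarrow> 'a::field mat monoid" where
  "SL m = \<lparr>carrier = {A \<in> carrier_mat m m. det A = 1}, mult = (*), one = 1\<^sub>m m\<rparr>"

definition mat_inv :: "'a::field mat \<Rightarrow> 'a mat" where
  "mat_inv A = inv\<^bsub>SL (dim_row A)\<^esub> A"

definition diag_emb :: "nat \<Rightarrow> nat \<Rightarrow> nat \<Rightarrow> 'a::field mat \<Rightarrow> 'a mat" where
  "diag_emb l r z A =
     diag_block_mat (replicate l A @ replicate r (mat_inv A)\<^sup>T @ [1\<^sub>m z])"

definition emb :: "(nat \<Rightarrow> nat) \<Rightarrow> (nat \<Rightarrow> nat) \<Rightarrow> (nat \<Rightarrow> nat) \<Rightarrow> nat \<Rightarrow> nat \<Rightarrow>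
    'a::field mat \<Rightarrow> 'a mat" where
  "emb l r z i j = fold (\<lambda>k. diag_emb (l k) (r k) (z k)) [i..<j]"

definition dl_rel :: "(nat \<Rightarrow> nat) \<Rightarrow> (nat \<Rightarrow> nat) \<Rightarrow> (nat \<Rightarrow> nat) \<Rightarrow> (nat \<Rightarrow> nat) \<Rightarrow>
    ((nat \<times> 'a::field mat) \<times> (nat \<times> 'a mat)) set" where
  "dl_rel n l r z = {((i, A), (j, B)). A \<in> carrier (SL (n i)) \<and> B \<in> carrier (SL (n j)) \<and>
     (\<exists>k \<ge> max i j. emb l r z i k A = emb l r z j k B)}"

definition dl_group :: "(nat \<Rightarrow> nat) \<Rightarrow> (nat \<Rightarrow> nat) \<Rightarrow> (nat \<Rightarrow> nat) \<Rightarrow> (nat \<Rightarrow> nat) \<Rightarrow>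
    (nat \<times> 'a::field mat) set monoid" where
  "dl_group n l r z =
     \<lparr>carrier = (SIGMA i:UNIV. carrier (SL (n i))) // dl_rel n l r z,
      mult = (\<lambda>g h. \<Union>(i, A)\<in>g. \<Union>(j, B)\<in>h.
        dl_rel n l r z `` {(max i j, emb l r z i (max i j) A * emb l r z j (max i j) B)}),
      one = dl_rel n l r z `` {(0, 1\<^sub>m (n 0))}\<rparr>"


subsection \<open>The quotients of the matrix spaces by the scalar matrices, and their inverse limit\<close>

definition cls :: "nat \<Rightarrow> 'a::field mat \<Rightarrow> 'a mat set" where
  "cls m P = {P + c \<cdot>\<^sub>m 1\<^sub>m m | c. True}"

definition gl_mod :: "nat \<Rightarrow> 'a::field mat set set" where
  "gl_mod m = cls m ` carrier_mat m m"

definition block :: "nat \<Rightarrow> nat \<Rightarrow> 'a mat \<Rightarrow> 'a mat" where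
  "block m k M = mat m m (\<lambda>(a, b). M $$ (k * m + a, k * m + b))"

definition trans_mat :: "nat \<Rightarrow> nat \<Rightarrow> nat \<Rightarrow> 'a::field mat \<Rightarrow> 'a mat" where
  "trans_mat m l r M = mat m m (\<lambda>ab.
     (\<Sum>k<l. block m k M $$ ab) - (\<Sum>k<r. (block m (l + k) M)\<^sup>T $$ ab))"

text \<open>The union makes the value a full coset: if \<open>l = r\<close> in the field, then the image of a
  coset under \<^const>\<open>trans_mat\<close> is a single matrix.\<close>

definition transition :: "nat \<Rightarrow> nat \<Rightarrow> nat \<Rightarrow> 'a::field mat set \<Rightarrow> 'a mat set" where
  "transition m l r X = (\<Union>M\<in>X. cls m (trans_mat m l r M))"

definition inv_lim :: "(nat \<Rightarrow> nat) \<Rightarrow> (nat \<Rightarrow> nat) \<Rightarrow> (nat \<Rightarrow> nat) \<Rightarrow>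
    (nat \<Rightarrow> 'a::field mat set) set" where
  "inv_lim n l r = {v. \<forall>i. v i \<in> gl_mod (n i) \<and> transition (n i) (l i) (r i) (v (Suc i)) = v i}"

definition conj_act :: "'a::field mat \<Rightarrow> 'a mat set \<Rightarrow> 'a mat set" where
  "conj_act A X = (\<lambda>P. A * P * mat_inv A) ` X"

text \<open>The element represented by \<open>A\<close> at level \<open>i\<close> acts at every level \<open>j \<ge> i\<close> through its image
  there; the components below \<open>i\<close> are determined by membership in the inverse limit.
  Existence and uniqueness are shown in \<open>dl_act_unique\<close> below.\<close>

definition dl_act :: "(nat \<Rightarrow> nat) \<Rightarrow> (nat \<Rightarrow> nat) \<Rightarrow> (nat \<Rightarrow> nat) \<Rightarrow> (nat \<Rightarrow> nat) \<Rightarrow>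
    (nat \<times> 'a::field mat) set \<Rightarrow> (nat \<Rightarrow> 'a mat set) \<Rightarrow> (nat \<Rightarrow> 'a mat set)" where
  "dl_act n l r z g v = (THE w. w \<in> inv_lim n l r \<and>
     (\<forall>(i, A)\<in>g. \<forall>j\<ge>i. w j = conj_act (emb l r z i j A) (v j)))"


subsection \<open>The Zariski topology and its limit\<close>

definition linear_fun :: "nat \<Rightarrow> ('a::field mat set \<Rightarrow> 'a) \<Rightarrow> bool" where
  "linear_fun m \<phi> \<longleftrightarrow>
     (\<forall>P \<in> carrier_mat m m. \<forall>Q \<in> carrier_mat m m. \<phi> (cls m (P + Q)) = \<phi> (cls m P) + \<phi> (cls m Q)) \<and>
     (\<forall>c. \<forall>P \<in> carrier_mat m m. \<phi> (cls m (c \<cdot>\<^sub>m P)) = c * \<phi> (cls m P))"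

text \<open>Polynomial functions on the vector space \<^term>\<open>gl_mod m\<close>, without choosing coordinates:
  the algebra of functions generated by the constants and the linear functionals.\<close>

inductive_set poly_fun :: "nat \<Rightarrow> ('a::field mat set \<Rightarrow> 'a) set" for m :: nat where
  const: "(\<lambda>_. c) \<in> poly_fun m"
| linear: "linear_fun m \<phi> \<Longrightarrow> \<phi> \<in> poly_fun m"
| add: "f \<in> poly_fun m \<Longrightarrow> g \<in> poly_fun m \<Longrightarrow> (\<lambda>x. f x + g x) \<in> poly_fun m"
| mult: "f \<in> poly_fun m \<Longrightarrow> g \<in> poly_fun m \<Longrightarrow> (\<lambda>x. f x * g x) \<in> poly_fun m"

definition zariski_closed :: "nat \<Rightarrow> 'a::field mat set set \<Rightarrow> bool" where
  "zariski_closed m Y \<longleftrightarrow> (\<exists>F \<subseteq> poly_fun m. Y = {x \<in> gl_mod m. \<forall>f\<in>F. f x = 0})"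

definition closed_in_lim :: "(nat \<Rightarrow> nat) \<Rightarrow> (nat \<Rightarrow> nat) \<Rightarrow> (nat \<Rightarrow> nat) \<Rightarrow>
    (nat \<Rightarrow> 'a::field mat set) set \<Rightarrow> bool" where
  "closed_in_lim n l r X \<longleftrightarrow> (\<exists>Y. (\<forall>i. zariski_closed (n i) (Y i)) \<and>
     (\<forall>i. transition (n i) (l i) (r i) ` Y (Suc i) \<subseteq> Y i) \<and>
     X = {v \<in> inv_lim n l r. \<forall>i. v i \<in> Y i})"

definition irreducible_in_lim :: "(nat \<Rightarrow> nat) \<Rightarrow> (nat \<Rightarrow> nat) \<Rightarrow> (nat \<Rightarrow> nat) \<Rightarrow>
    (nat \<Rightarrow> 'a::field mat set) set \<Rightarrow> bool" where
  "irreducible_in_lim n l r X \<longleftrightarrow> X \<noteq> {} \<and>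
     (\<forall>Y Z. closed_in_lim n l r Y \<longrightarrow> closed_in_lim n l r Z \<longrightarrow> X = Y \<union> Z \<longrightarrow> X = Y \<or> X = Z)"

definition G_stable :: "(nat \<Rightarrow> nat) \<Rightarrow> (nat \<Rightarrow> nat) \<Rightarrow> (nat \<Rightarrow> nat) \<Rightarrow> (nat \<Rightarrow> nat) \<Rightarrow>
    (nat \<Rightarrow> 'a::field mat set) set \<Rightarrow> bool" where
  "G_stable n l r z X \<longleftrightarrow> (\<forall>g \<in> carrier (dl_group n l r z). \<forall>v\<in>X. dl_act n l r z g v \<in> X)"

definition stable_closed :: "(nat \<Rightarrow> nat) \<Rightarrow> (nat \<Rightarrow> nat) \<Rightarrow> (nat \<Rightarrow> nat) \<Rightarrow> (nat \<Rightarrow> nat) \<Rightarrow>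
    (nat \<Rightarrow> 'a::field mat set) set \<Rightarrow> bool" where
  "stable_closed n l r z X \<longleftrightarrow> closed_in_lim n l r X \<and> G_stable n l r z X"


subsection \<open>Rank and trace loci\<close>

text \<open>The rank of \<open>\<mu>1 P + \<mu>2 Q\<close> depends only on the point \<open>(\<mu>1 : \<mu>2)\<close> of the projective line,
  so the minimum is taken over all nonzero pairs.\<close>

definition pencil_rank :: "nat \<Rightarrow> 'a::field mat \<Rightarrow> 'a mat \<Rightarrow> nat" where
  "pencil_rank m P Q =
     Inf {vec_space.rank m (\<mu>1 \<cdot>\<^sub>m P + \<mu>2 \<cdot>\<^sub>m Q) | \<mu>1 \<mu>2. (\<mu>1, \<mu>2) \<noteq> (0, 0)}"

definition mat_trace :: "'a::field mat \<Rightarrow> 'a" where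
  "mat_trace P = (\<Sum>a<dim_row P. P $$ (a, a))"

definition zero_point :: "(nat \<Rightarrow> nat) \<Rightarrow> (nat \<Rightarrow> 'a::field mat set)" where
  "zero_point n = (\<lambda>i. cls (n i) (0\<^sub>m (n i) (n i)))"

definition eventual_locus :: "(nat \<Rightarrow> nat) \<Rightarrow> (nat \<Rightarrow> nat) \<Rightarrow> (nat \<Rightarrow> nat) \<Rightarrow>
    (nat \<Rightarrow> 'a::field mat \<Rightarrow> bool) \<Rightarrow> (nat \<Rightarrow> 'a mat set) set" where
  "eventual_locus n l r \<Phi> = {(\<lambda>i. cls (n i) (P i)) | P.
     (\<forall>i. P i \<in> carrier_mat (n i) (n i)) \<and> (\<lambda>i. cls (n i) (P i)) \<in> inv_lim n l r \<and>
     (\<forall>\<^sub>F i in sequentially. \<Phi> i (P i))}"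

definition rank_locus :: "(nat \<Rightarrow> nat) \<Rightarrow> (nat \<Rightarrow> nat) \<Rightarrow> (nat \<Rightarrow> nat) \<Rightarrow> nat \<Rightarrow>
    (nat \<Rightarrow> 'a::field mat set) set" where
  "rank_locus n l r k = eventual_locus n l r (\<lambda>i P. pencil_rank (n i) P (1\<^sub>m (n i)) \<le> k)"

definition trace_locus :: "(nat \<Rightarrow> nat) \<Rightarrow> (nat \<Rightarrow> nat) \<Rightarrow> (nat \<Rightarrow> nat) \<Rightarrow> 'a \<Rightarrow>
    (nat \<Rightarrow> 'a::field mat set) set" where
  "trace_locus n l r \<mu> = eventual_locus n l r (\<lambda>i P. mat_trace P = \<mu>)"


subsection \<open>The six cases\<close>

definition ecard :: "'a set \<Rightarrow> enat" where
  "ecard S = (if finite S then enat (card S) else \<infinity>)"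

datatype case_label = C1 | C2 | C3a | C3b | C4a | C4b

text \<open>Here \<open>p\<close> is the characteristic; for \<open>p = 0\<close> the condition \<open>p dvd n i\<close> fails as \<open>n i > 0\<close>.\<close>

fun in_case :: "nat \<Rightarrow> (nat \<Rightarrow> nat) \<Rightarrow> enat \<Rightarrow> enat \<Rightarrow> enat \<Rightarrow> case_label \<Rightarrow> bool" where
  "in_case p n \<alpha> \<beta> \<gamma> C1 \<longleftrightarrow> \<alpha> + \<beta> < \<infinity>"
| "in_case p n \<alpha> \<beta> \<gamma> C2 \<longleftrightarrow> \<alpha> + \<beta> = \<infinity> \<and> \<gamma> = \<infinity>"
| "in_case p n \<alpha> \<beta> \<gamma> C3a \<longleftrightarrow> \<beta> = \<infinity> \<and> \<gamma> < \<infinity> \<and>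
     (p \<noteq> 2 \<or> (\<forall>\<^sub>F i in sequentially. \<not> 2 dvd n i))"
| "in_case p n \<alpha> \<beta> \<gamma> C3b \<longleftrightarrow> \<beta> = \<infinity> \<and> \<gamma> < \<infinity> \<and>
     p = 2 \<and> (\<forall>\<^sub>F i in sequentially. 2 dvd n i)"
| "in_case p n \<alpha> \<beta> \<gamma> C4a \<longleftrightarrow> \<beta> + \<gamma> < \<infinity> \<and> (\<forall>\<^sub>F i in sequentially. \<not> p dvd n i)"
| "in_case p n \<alpha> \<beta> \<gamma> C4b \<longleftrightarrow> \<beta> + \<gamma> < \<infinity> \<and> (\<forall>\<^sub>F i in sequentially. p dvd n i)"


subsection \<open>The action on the inverse limit is well defined\<close>

lemma SL_simps [simp]:
  "carrier (SL m) = {A \<in> carrier_mat m m. det A = 1}" "mult (SL m) = (*)" "one (SL m) = 1\<^sub>m m"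
  by (auto simp: SL_def)

lemma group_SL: "group (SL m :: 'a::field mat monoid)"
proof (rule groupI, goal_cases)
  case (1 x y) then show ?case by (auto simp: det_mult)
next
  case (3 x y z) then show ?case by (auto intro: assoc_mult_mat)
next
  case (5 x)
  then have x: "x \<in> carrier_mat m m" "det x = 1" by auto
  from adj_mat[OF x(1)] x have a: "adj_mat x \<in> carrier_mat m m" "adj_mat x * x = 1\<^sub>m m" by auto
  have "det (adj_mat x) * det x = 1" using det_mult[OF a(1) x(1)] a(2) by simp
  with a x show ?case by (intro bexI[of _ "adj_mat x"]) auto
qed auto

lemma mat_inv:
  assumes "A \<in> carrier (SL m)"
  shows "mat_inv A \<in> carrier (SL m)" "A * mat_inv A = 1\<^sub>m m" "mat_inv A * A = 1\<^sub>m m"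
proof -
  interpret group "SL m :: 'a mat monoid" by (rule group_SL)
  have d: "dim_row A = m" using assms by auto
  show "mat_inv A \<in> carrier (SL m)" using inv_closed[OF assms] by (simp add: mat_inv_def d)
  show "A * mat_inv A = 1\<^sub>m m" using r_inv[OF assms] by (simp add: mat_inv_def d)
  show "mat_inv A * A = 1\<^sub>m m" using l_inv[OF assms] by (simp add: mat_inv_def d)
qed

lemma mat_inv_mult:
  assumes "A \<in> carrier (SL m)" "B \<in> carrier (SL m)"
  shows "mat_inv (A * B) = mat_inv B * mat_inv A"
proof -
  interpret group "SL m :: 'a mat monoid" by (rule group_SL)
  have d: "dim_row A = m" "dim_row B = m" using assms by auto
  show ?thesis using inv_mult_group[OF assms] by (simp add: mat_inv_def d)
qed

lemma mat_inv_unique: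
  assumes "A \<in> carrier (SL m)" "B \<in> carrier (SL m)" "A * B = 1\<^sub>m m"
  shows "mat_inv A = B"
proof -
  have c: "A \<in> carrier_mat m m" "B \<in> carrier_mat m m" "mat_inv A \<in> carrier_mat m m"
    using assms mat_inv(1)[OF assms(1)] by auto
  have "mat_inv A = mat_inv A * (A * B)" using c assms(3) by simp
  also have "\<dots> = mat_inv A * A * B" using c by (simp add: assoc_mult_mat)
  also have "\<dots> = B" using c mat_inv(3)[OF assms(1)] by simp
  finally show ?thesis .
qed

lemma mat_inv_transpose_SL: "A \<in> carrier (SL m) \<Longrightarrow> (mat_inv A)\<^sup>T \<in> carrier (SL m)"
  using mat_inv(1)[of A m] by (auto simp: det_transpose)

lemma mat_inv_transpose_mult:
  assumes "A \<in> carrier (SL m)" "B \<in> carrier (SL m)"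
  shows "(mat_inv (A * B))\<^sup>T = (mat_inv A)\<^sup>T * (mat_inv B)\<^sup>T"
  using mat_inv_mult[OF assms] mat_inv(1)[OF assms(1)] mat_inv(1)[OF assms(2)]
  by (auto simp: transpose_mult)

lemma diag_block_mult:
  assumes "\<And>x. x \<in> set xs \<Longrightarrow> f x \<in> carrier_mat (d x) (d x)" "\<And>x. x \<in> set xs \<Longrightarrow> g x \<in> carrier_mat (d x) (d x)"
  shows "diag_block_mat (map f xs) * diag_block_mat (map g xs) = (diag_block_mat (map (\<lambda>x. f x * g x) xs) :: 'a::comm_ring_1 mat)
    \<and> diag_block_mat (map f xs) \<in> carrier_mat (sum_list (map d xs)) (sum_list (map d xs))
    \<and> diag_block_mat (map g xs) \<in> carrier_mat (sum_list (map d xs)) (sum_list (map d xs))"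
  using assms
proof (induct xs)
  case (Cons x xs)
  let ?s = "sum_list (map d xs)"
  let ?F = "diag_block_mat (map f xs)" let ?G = "diag_block_mat (map g xs)"
  have IH: "?F * ?G = diag_block_mat (map (\<lambda>x. f x * g x) xs)" "?F \<in> carrier_mat ?s ?s" "?G \<in> carrier_mat ?s ?s"
    using Cons by auto
  have fx: "f x \<in> carrier_mat (d x) (d x)" "g x \<in> carrier_mat (d x) (d x)" using Cons by auto
  have dm: "dim_row (f x) = d x" "dim_col (f x) = d x" "dim_row (g x) = d x" "dim_col (g x) = d x" 
     "dim_row ?F = ?s" "dim_col ?F = ?s" "dim_row ?G = ?s" "dim_col ?G = ?s"
     "dim_row (f x * g x) = d x" "dim_col (f x * g x) = d x"  using fx IH by auto
  have dm': "dim_row (diag_block_mat (map (\<lambda>x. f x * g x) xs)) = ?s" "dim_col (diag_block_mat (map (\<lambda>x. f x * g x) xs)) = ?s"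
    by (simp_all only: IH(1)[symmetric] index_mult_mat dm)
  have P: "diag_block_mat (map (\<lambda>x. f x * g x) xs) \<in> carrier_mat ?s ?s" using dm' by auto
  show ?case
    by (simp only: list.map diag_block_mat.simps Let_def dm dm' sum_list.Cons,
        subst mult_four_block_mat[OF fx(1) _ _ IH(2) fx(2) _ _ IH(3)])
       (insert fx IH P, auto simp: left_add_zero_mat[OF P])
qed auto

lemma det_diag_block:
  assumes "\<And>x. x \<in> set xs \<Longrightarrow> dim_row x = dim_col x \<and> det x = 1"
  shows "det (diag_block_mat xs) = (1::'a::field) \<and> dim_row (diag_block_mat xs) = dim_col (diag_block_mat xs)"
  using assms
proof (induct xs)
  case (Cons x xs)
  let ?D = "diag_block_mat xs"
  have IH: "det ?D = 1" "dim_row ?D = dim_col ?D" using Cons by auto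
  have x: "dim_row x = dim_col x" "det x = 1" using Cons by auto
  have c: "x \<in> carrier_mat (dim_col x) (dim_col x)" "?D \<in> carrier_mat (dim_col ?D) (dim_col ?D)"
    using IH x by (simp_all only: carrier_mat_def mem_Collect_eq simp_thms)
  have "det (diag_block_mat (x # xs)) = det x * det ?D"
    unfolding diag_block_mat.simps Let_def x(1) IH(2)
    by (rule det_four_block_mat_lower_left_zero[OF c(1) _ _ c(2)]) simp_all
  with x IH show ?case by (simp add: Let_def)
qed auto

lemma diag_emb_SL:
  assumes "A \<in> carrier (SL m)"
  shows "diag_emb l r z A \<in> carrier (SL ((l + r) * m + z))"
proof -
  have m: "A \<in> carrier_mat m m" "(mat_inv A)\<^sup>T \<in> carrier_mat m m" "det A = 1" "det ((mat_inv A)\<^sup>T) = 1"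
    using assms mat_inv_transpose_SL[OF assms] by auto
  then have dd: "dim_row A = m" "dim_row ((mat_inv A)\<^sup>T) = m" by auto
  have "det (diag_emb l r z A) = 1 \<and> dim_row (diag_emb l r z A) = dim_col (diag_emb l r z A)"
    unfolding diag_emb_def
    by (rule det_diag_block) (use m mat_inv(1)[OF assms] in auto)
  moreover have "dim_row (diag_emb l r z A) = (l + r) * m + z"
    unfolding diag_emb_def dim_diag_block_mat 
    by (simp add: dd sum_list_replicate algebra_simps del: index_transpose_mat)
  ultimately show ?thesis by (auto intro: carrier_matI)
qed

lemma diag_emb_mult:
  assumes "A \<in> carrier (SL m)" "B \<in> carrier (SL m)"
  shows "diag_emb l r z (A * B) = diag_emb l r z A * diag_emb l r z B"
proof -
  let ?xs = "replicate l (A, B, m) @ replicate r ((mat_inv A)\<^sup>T, (mat_inv B)\<^sup>T, m) @ [(1\<^sub>m z, 1\<^sub>m z, z)]"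
  have m: "A \<in> carrier_mat m m" "(mat_inv A)\<^sup>T \<in> carrier_mat m m" "B \<in> carrier_mat m m" "(mat_inv B)\<^sup>T \<in> carrier_mat m m"
    using assms mat_inv_transpose_SL[OF assms(1)] mat_inv_transpose_SL[OF assms(2)] by auto
  have "diag_block_mat (map fst ?xs) * diag_block_mat (map (fst \<circ> snd) ?xs) 
      = diag_block_mat (map (\<lambda>x. fst x * (fst \<circ> snd) x) ?xs)"
    by (rule diag_block_mult[where d = "\<lambda>x. snd (snd x)", THEN conjunct1]) (use m in auto)
  then show ?thesis by (simp add: diag_emb_def mat_inv_transpose_mult[OF assms] map_replicate_const[symmetric] o_def)
qed

lemma diag_emb_one: "diag_emb l r z (1\<^sub>m m) = (1\<^sub>m ((l + r) * m + z) :: 'a::field mat)"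
proof -
  let ?E = "diag_emb l r z (1\<^sub>m m :: 'a mat)" let ?N = "(l + r) * m + z"
  have o: "(1\<^sub>m m :: 'a mat) \<in> carrier (SL m)" by simp
  have E: "?E \<in> carrier (SL ?N)" by (rule diag_emb_SL[OF o])
  have c: "?E \<in> carrier_mat ?N ?N" "mat_inv ?E \<in> carrier_mat ?N ?N"
    using E mat_inv(1)[OF E] by simp_all
  have "?E * ?E = ?E" using diag_emb_mult[OF o o, of l r z] by simp
  then have "1\<^sub>m ?N = mat_inv ?E * (?E * ?E)" using mat_inv(3)[OF E] by simp
  also have "\<dots> = mat_inv ?E * ?E * ?E" using c by (simp only: assoc_mult_mat)
  also have "\<dots> = ?E" using c mat_inv(3)[OF E] by simp
  finally show ?thesis by simp
qed

lemma div_block: "(k * m + a) div m = (k::nat)" "(k * m + a) mod m = a" if "a < m" for k m a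
  using that by auto

lemma diag_block_index:
  fixes N :: "'a::zero mat"
  assumes "\<And>x. x \<in> set xs \<Longrightarrow> x \<in> carrier_mat m m" "N \<in> carrier_mat z z"
    "i < length xs * m" "j < length xs * m + z" "m > 0"
  shows "diag_block_mat (xs @ [N]) $$ (i, j) =
     (if i div m = j div m then (xs ! (i div m)) $$ (i mod m, j mod m) else 0)
    \<and> diag_block_mat (xs @ [N]) $$ (j, i) =
     (if i div m = j div m then (xs ! (i div m)) $$ (j mod m, i mod m) else 0)"
  using assms(1,3,4)
proof (induct xs arbitrary: i j)
  case (Cons x xs)
  let ?D = "diag_block_mat (xs @ [N])" let ?s = "length xs * m + z"
  have x: "x \<in> carrier_mat m m" using Cons by auto
  have "map dim_row xs = map (\<lambda>_. m) xs" "map dim_col xs = map (\<lambda>_. m) xs"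
    using Cons(2) by auto
  then have d: "dim_row ?D = ?s" "dim_col ?D = ?s" using assms(2)
    by (simp_all add: dim_diag_block_mat map_replicate_const sum_list_replicate)
  have dv: "(i div m = 0) = (i < m)" for i using \<open>m > 0\<close> by (simp add: div_eq_0_iff)
  have ge: "i div m = Suc ((i - m) div m) \<and> i mod m = (i - m) mod m" if "\<not> i < m" for i
    using le_div_geq[of m i] le_mod_geq[of m i] that \<open>m > 0\<close> by simp
  have e: "diag_block_mat ((x # xs) @ [N]) $$ (i, j) = (if i < m then if j < m then x $$ (i, j) else 0
      else if j < m then 0 else ?D $$ (i - m, j - m))" if "i < m + ?s" "j < m + ?s" for i j
  proof -
    have "dim_row x = m" "dim_col x = m" using x by auto
    with that d show ?thesis by (simp add: Let_def)
  qed
  have ij: "i < m + ?s" "j < m + ?s" using Cons(3,4) by auto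
  note e = e[OF ij] e[OF ij(2,1)]
  consider "i < m" "j < m" | "i < m" "\<not> j < m" | "\<not> i < m" "j < m" | "\<not> i < m" "\<not> j < m" by blast
  then show ?case
  proof cases
    case 1 then show ?thesis unfolding e by simp
  next
    case 2
    have "i div m \<noteq> j div m" using dv[of i] dv[of j] 2 by auto
    with 2 show ?thesis unfolding e by simp
  next
    case 3
    have "i div m \<noteq> j div m" using dv[of i] dv[of j] 3 by auto
    with 3 show ?thesis unfolding e by simp
  next
    case 4
    have "i - m < length xs * m" "j - m < ?s" using 4 Cons(3,4) by auto
    note IH = Cons(1)[OF Cons(2) this]
    have g: "i div m = Suc ((i - m) div m)" "i mod m = (i - m) mod m"
      "j div m = Suc ((j - m) div m)" "j mod m = (j - m) mod m" using ge 4 by blast+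
    show ?thesis unfolding e unfolding g using 4 IH by simp
  qed
qed auto

lemma sum_block:
  fixes h :: "nat \<Rightarrow> 'a::comm_ring_1"
  assumes "0 < m" "k < (L::nat)" "\<And>s. s < L * m + z \<Longrightarrow> s div m \<noteq> k \<Longrightarrow> h s = 0"
  shows "(\<Sum>s<L * m + z. h s) = (\<Sum>s<m. h (k * m + s))"
proof -
  have km: "k * m + m \<le> L * m" using mult_le_mono1[of "Suc k" L m] assms(2) by simp
  have "(\<Sum>s<L * m + z. h s) = (\<Sum>s\<in>{k * m..<k * m + m}. h s)"
  proof (rule sum.mono_neutral_right)
    show "\<forall>i\<in>{..<L * m + z} - {k * m..<k * m + m}. h i = 0"
    proof
      fix i assume i: "i \<in> {..<L * m + z} - {k * m..<k * m + m}"
      have "i div m \<noteq> k"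
      proof
        assume "i div m = k"
        then have "i = k * m + i mod m" by (metis div_mult_mod_eq)
        moreover have "i mod m < m" using assms by simp
        ultimately show False using i by (auto) 
      qed
      with i assms(3) show "h i = 0" by auto
    qed
  qed (use km in auto)
  also have "\<dots> = (\<Sum>s<m. h (k * m + s))"
    using sum.shift_bounds_nat_ivl[of h 0 "k * m" m] by (simp add: add.commute lessThan_atLeast0)
  finally show ?thesis .
qed

lemma mult_index:
  assumes "A \<in> carrier_mat p q" "B \<in> carrier_mat q s" "i < p" "j < s"
  shows "(A * B) $$ (i, j) = (\<Sum>k<q. A $$ (i, k) * B $$ (k, j))"
  using assms by (auto simp: scalar_prod_def lessThan_atLeast0)

lemma block_conj:
  fixes A :: "'a::field mat"
  assumes A: "A \<in> carrier (SL m)" and B: "B \<in> carrier (SL m)" and m: "0 < m"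
    and M: "M \<in> carrier_mat ((l + r) * m + z) ((l + r) * m + z)" and k: "k < l + r"
  shows "block m k (diag_emb l r z A * M * diag_emb l r z B) =
    (if k < l then A else (mat_inv A)\<^sup>T) * block m k M * (if k < l then B else (mat_inv B)\<^sup>T)"
proof -
  let ?N = "(l + r) * m + z" let ?D = "diag_emb l r z A" let ?E = "diag_emb l r z B"
  let ?f = "\<lambda>A::'a mat. if k < l then A else (mat_inv A)\<^sup>T"
  have c: "?D \<in> carrier_mat ?N ?N" "?E \<in> carrier_mat ?N ?N"
    using diag_emb_SL[OF A] diag_emb_SL[OF B] by auto
  have f: "?f A \<in> carrier_mat m m" "?f B \<in> carrier_mat m m"
    using A B mat_inv_transpose_SL[OF A] mat_inv_transpose_SL[OF B] by auto
  have bl: "block m k X \<in> carrier_mat m m" for X :: "'a mat" by (simp add: block_def)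
  have bnd: "k * m + a < (l + r) * m" if "a < m" for a
    using mult_le_mono1[of "Suc k" "l + r" m] k that by simp
  have ix: "diag_emb l r z X $$ (k * m + a, j) = (if k = j div m then ?f X $$ (a, j mod m) else 0) \<and>
     diag_emb l r z X $$ (j, k * m + a) = (if k = j div m then ?f X $$ (j mod m, a) else 0)"
    if X: "X \<in> carrier (SL m)" and a: "a < m" and j: "j < ?N" for X :: "'a mat" and a j
  proof -
    have Xc: "x \<in> carrier_mat m m" if "x \<in> set (replicate l X @ replicate r ((mat_inv X)\<^sup>T))" for x
      using X mat_inv_transpose_SL[OF X] that by (auto simp del: index_transpose_mat split: if_splits)
    let ?xs = "replicate l X @ replicate r ((mat_inv X)\<^sup>T)"
    have len: "length ?xs = l + r" by simp
    have nth: "?xs ! k = ?f X" using k by (simp add: nth_append)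
    have e: "diag_emb l r z X = diag_block_mat (?xs @ [1\<^sub>m z])" by (simp add: diag_emb_def)
    show ?thesis unfolding e
      using diag_block_index[of ?xs m "1\<^sub>m z" z "k * m + a" j, OF Xc one_carrier_mat] bnd[OF a] j m
      unfolding len div_block[OF a] nth by blast
  qed
  show ?thesis
  proof (rule eq_matI)
    fix a b assume "a < dim_row (?f A * block m k M * ?f B)" "b < dim_col (?f A * block m k M * ?f B)"
    then have a: "a < m" and b: "b < m" using f by (auto split: if_splits)
    have DM: "?D * M \<in> carrier_mat ?N ?N" using c M by auto
    have ka: "k * m + a < ?N" "k * m + b < ?N" using bnd a b by (auto intro: trans_less_add1)
    have "(?D * M * ?E) $$ (k * m + a, k * m + b) = (\<Sum>t<?N. (?D * M) $$ (k * m + a, t) * ?E $$ (t, k * m + b))"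
      by (rule mult_index[OF DM c(2) ka])
    also have "\<dots> = (\<Sum>t<m. (?D * M) $$ (k * m + a, k * m + t) * ?E $$ (k * m + t, k * m + b))"
      by (rule sum_block[OF m k]) (simp add: ix[OF B b])
    also have "\<dots> = (\<Sum>t<m. (?f A * block m k M) $$ (a, t) * ?f B $$ (t, b))"
    proof (rule sum.cong[OF refl])
      fix t assume "t \<in> {..<m}"
      then have t: "t < m" by simp
      then have kt: "k * m + t < ?N" using bnd[OF t] by simp
      have "(?D * M) $$ (k * m + a, k * m + t) = (\<Sum>s<?N. ?D $$ (k * m + a, s) * M $$ (s, k * m + t))"
        by (rule mult_index[OF c(1) M ka(1) kt])
      also have "\<dots> = (\<Sum>s<m. ?D $$ (k * m + a, k * m + s) * M $$ (k * m + s, k * m + t))"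
        by (rule sum_block[OF m k]) (simp add: ix[OF A a])
      also have "\<dots> = (\<Sum>s<m. ?f A $$ (a, s) * block m k M $$ (s, t))"
        using bnd t by (intro sum.cong) (auto simp: ix[OF A a] block_def trans_less_add1)
      also have "\<dots> = (?f A * block m k M) $$ (a, t)" by (rule mult_index[OF f(1) bl a t, symmetric])
      finally show "(?D * M) $$ (k * m + a, k * m + t) * ?E $$ (k * m + t, k * m + b) =
         (?f A * block m k M) $$ (a, t) * ?f B $$ (t, b)" using kt t by (simp add: ix[OF B b])
    qed
    also have "\<dots> = (?f A * block m k M * ?f B) $$ (a, b)"
      by (rule mult_index[OF _ f(2) a b, symmetric]) (use f bl in auto)
    finally show "block m k (?D * M * ?E) $$ (a, b) = (?f A * block m k M * ?f B) $$ (a, b)"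
      using a b by (simp add: block_def)
  qed (insert f, simp_all add: block_def)
qed

lemma cls_memD: assumes "Q \<in> cls m P" "P \<in> carrier_mat m m"
  shows "cls m Q = cls m P" "Q \<in> carrier_mat m m"
proof -
  obtain c where Q: "Q = P + c \<cdot>\<^sub>m 1\<^sub>m m" using assms by (auto simp: cls_def)
  show "Q \<in> carrier_mat m m" using Q assms by simp
  have "P + d \<cdot>\<^sub>m 1\<^sub>m m = Q + (d - c) \<cdot>\<^sub>m 1\<^sub>m m" for d
    unfolding Q using assms(2) by (intro eq_matI) (auto simp: algebra_simps)
  moreover have "Q + d \<cdot>\<^sub>m 1\<^sub>m m = P + (d + c) \<cdot>\<^sub>m 1\<^sub>m m" for d
    unfolding Q using assms(2) by (intro eq_matI) (auto simp: algebra_simps)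
  ultimately show "cls m Q = cls m P" unfolding cls_def by blast
qed

lemma cls_self: "P \<in> carrier_mat m m \<Longrightarrow> P \<in> cls m P"
  unfolding cls_def by (auto intro!: exI[of _ 0] eq_matI)

lemma trans_mat_carrier [simp]: "trans_mat m l r M \<in> carrier_mat m m"
  by (simp add: trans_mat_def)

lemma trans_mat_shift:
  assumes M: "M \<in> carrier_mat ((l + r) * m + z) ((l + r) * m + z)"
  shows "trans_mat m l r (M + c \<cdot>\<^sub>m 1\<^sub>m ((l + r) * m + z)) =
    trans_mat m l r M + (c * (of_nat l - of_nat r)) \<cdot>\<^sub>m 1\<^sub>m m"
proof (rule eq_matI)
  let ?N = "(l + r) * m + z"
  fix a b assume "a < dim_row (trans_mat m l r M + (c * (of_nat l - of_nat r)) \<cdot>\<^sub>m 1\<^sub>m m)"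
    "b < dim_col (trans_mat m l r M + (c * (of_nat l - of_nat r)) \<cdot>\<^sub>m 1\<^sub>m m)"
  then have ab: "a < m" "b < m" by (auto simp: trans_mat_def)
  have bnd: "k * m + a < ?N" if "a < m" "k < l + r" for a k
    using mult_le_mono1[of "Suc k" "l + r" m] that by simp
  have e: "(M + c \<cdot>\<^sub>m 1\<^sub>m ?N) $$ (k * m + a, k * m + b) = M $$ (k * m + a, k * m + b) + (if a = b then c else 0)"
    if "k < l + r" "a < m" "b < m" for k a b
    using bnd[OF that(2,1)] bnd[OF that(3,1)] M by simp
  show "trans_mat m l r (M + c \<cdot>\<^sub>m 1\<^sub>m ?N) $$ (a, b) =
    (trans_mat m l r M + (c * (of_nat l - of_nat r)) \<cdot>\<^sub>m 1\<^sub>m m) $$ (a, b)"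
    using ab by (simp add: trans_mat_def block_def e sum.distrib) (auto simp: right_diff_distrib mult.commute)
qed (simp_all add: trans_mat_def)

lemma transition_cls:
  assumes M: "M \<in> carrier_mat ((l + r) * m + z) ((l + r) * m + z)"
  shows "transition m l r (cls ((l + r) * m + z) M) = cls m (trans_mat m l r M)"
proof -
  have "cls m (trans_mat m l r Q) = cls m (trans_mat m l r M)" if "Q \<in> cls ((l + r) * m + z) M" for Q
  proof -
    from that obtain c where Q: "Q = M + c \<cdot>\<^sub>m 1\<^sub>m ((l + r) * m + z)" by (auto simp: cls_def)
    show ?thesis unfolding Q trans_mat_shift[OF M]
      by (rule cls_memD(1)) (auto simp: cls_def)
  qed
  then show ?thesis using cls_self[OF M] unfolding transition_def by blast
qed

lemma triple_index:
  fixes A :: "'a::comm_ring_1 mat"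
  assumes "A \<in> carrier_mat m m" "X \<in> carrier_mat m m" "B \<in> carrier_mat m m" "a < m" "b < m"
  shows "(A * X * B) $$ (a, b) = (\<Sum>t<m. \<Sum>s<m. A $$ (a, s) * X $$ (s, t) * B $$ (t, b))"
proof -
  have AX: "A * X \<in> carrier_mat m m" using assms by simp
  show ?thesis unfolding mult_index[OF AX assms(3-5)]
    by (rule sum.cong) (auto simp: mult_index[OF assms(1,2,4)] sum_distrib_right)
qed

lemma trans_mat_conj:
  fixes A :: "'a::field mat"
  assumes A: "A \<in> carrier (SL m)" and m: "0 < m"
    and M: "M \<in> carrier_mat ((l + r) * m + z) ((l + r) * m + z)"
  shows "trans_mat m l r (diag_emb l r z A * M * mat_inv (diag_emb l r z A)) =
    A * trans_mat m l r M * mat_inv A"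
proof -
  let ?D = "diag_emb l r z A" let ?B = "mat_inv A"
  have B: "?B \<in> carrier (SL m)" by (rule mat_inv(1)[OF A])
  have BB: "mat_inv ?B = A" using mat_inv_unique[OF B A mat_inv(3)[OF A]] .
  have "?D * diag_emb l r z ?B = 1\<^sub>m ((l + r) * m + z)"
    using diag_emb_mult[OF A B, of l r z] mat_inv(2)[OF A] diag_emb_one by metis
  then have D: "mat_inv ?D = diag_emb l r z ?B"
    by (rule mat_inv_unique[OF diag_emb_SL[OF A] diag_emb_SL[OF B]])
  have c: "A \<in> carrier_mat m m" "?B \<in> carrier_mat m m" using A B by auto
  have bl: "block m k X \<in> carrier_mat m m" "(block m k X)\<^sup>T \<in> carrier_mat m m" for X :: "'a mat" and k
    by (simp_all add: block_def)
  have p: "block m k (?D * M * mat_inv ?D) = A * block m k M * ?B" if "k < l" for k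
    using block_conj[OF A B m M, of k] that by (simp add: D)
  have q: "(block m (l + k) (?D * M * mat_inv ?D))\<^sup>T = A * (block m (l + k) M)\<^sup>T * ?B" if "k < r" for k
  proof -
    have "block m (l + k) (?D * M * mat_inv ?D) = ?B\<^sup>T * block m (l + k) M * A\<^sup>T"
      using block_conj[OF A B m M, of "l + k"] that by (simp add: D BB)
    also have "\<dots>\<^sup>T = (A\<^sup>T)\<^sup>T * (?B\<^sup>T * block m (l + k) M)\<^sup>T"
      by (rule transpose_mult[of _ m m _ m]) (use c bl in auto)
    also have "(?B\<^sup>T * block m (l + k) M)\<^sup>T = (block m (l + k) M)\<^sup>T * (?B\<^sup>T)\<^sup>T"
      by (rule transpose_mult[of _ m m _ m]) (use c bl in auto)
    also have "(A\<^sup>T)\<^sup>T * ((block m (l + k) M)\<^sup>T * (?B\<^sup>T)\<^sup>T) = A * (block m (l + k) M)\<^sup>T * ?B"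
      using assoc_mult_mat[OF c(1) bl(2) c(2)] by simp
    finally show ?thesis .
  qed
  show ?thesis
  proof (rule eq_matI)
    fix a b assume "a < dim_row (A * trans_mat m l r M * mat_inv A)" "b < dim_col (A * trans_mat m l r M * mat_inv A)"
    then have ab: "a < m" "b < m" using c by auto
    have "trans_mat m l r (?D * M * mat_inv ?D) $$ (a, b) =
      (\<Sum>k<l. (A * block m k M * ?B) $$ (a, b)) - (\<Sum>k<r. (A * (block m (l + k) M)\<^sup>T * ?B) $$ (a, b))"
      unfolding trans_mat_def using ab by (simp add: p q)
    also have "\<dots> = (\<Sum>k<l. \<Sum>t<m. \<Sum>s<m. A $$ (a, s) * block m k M $$ (s, t) * ?B $$ (t, b))
        - (\<Sum>k<r. \<Sum>t<m. \<Sum>s<m. A $$ (a, s) * (block m (l + k) M)\<^sup>T $$ (s, t) * ?B $$ (t, b))"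
      by (simp only: triple_index[OF c(1) bl(1) c(2) ab] triple_index[OF c(1) bl(2) c(2) ab])
    also have "\<dots> = (\<Sum>t<m. \<Sum>s<m. A $$ (a, s) * ((\<Sum>k<l. block m k M $$ (s, t)) - (\<Sum>k<r. (block m (l + k) M)\<^sup>T $$ (s, t))) * ?B $$ (t, b))"
      unfolding sum.swap[where B = "{..<m}" and A = "{..<l}"] sum.swap[where B = "{..<m}" and A = "{..<r}"]
      unfolding sum_subtractf[symmetric] right_diff_distrib left_diff_distrib sum_distrib_left sum_distrib_right ..
    also have "\<dots> = (\<Sum>t<m. \<Sum>s<m. A $$ (a, s) * trans_mat m l r M $$ (s, t) * ?B $$ (t, b))"
      by (intro sum.cong refl) (simp add: trans_mat_def)
    also have "\<dots> = (A * trans_mat m l r M * ?B) $$ (a, b)"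
      by (rule triple_index[OF c(1) trans_mat_carrier c(2) ab, symmetric])
    finally show "trans_mat m l r (?D * M * mat_inv ?D) $$ (a, b) = (A * trans_mat m l r M * ?B) $$ (a, b)" .
  qed (use c in \<open>auto simp: trans_mat_def\<close>)
qed

lemma conj_act_cls:
  assumes A: "A \<in> carrier (SL m)" and P: "P \<in> carrier_mat m m"
  shows "conj_act A (cls m P) = cls m (A * P * mat_inv A)"
proof -
  have c: "A \<in> carrier_mat m m" "mat_inv A \<in> carrier_mat m m" using A mat_inv(1)[OF A] by auto
  have "A * (P + d \<cdot>\<^sub>m 1\<^sub>m m) * mat_inv A = A * P * mat_inv A + d \<cdot>\<^sub>m 1\<^sub>m m" for d
  proof -
    have "A * (P + d \<cdot>\<^sub>m 1\<^sub>m m) = A * P + d \<cdot>\<^sub>m A"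
      using c P by (subst mult_add_distrib_mat[of _ m m _ m]) (auto simp: mult_smult_distrib[of _ m m])
    then have "A * (P + d \<cdot>\<^sub>m 1\<^sub>m m) * mat_inv A = A * P * mat_inv A + (d \<cdot>\<^sub>m A) * mat_inv A"
      using c P by (simp add: add_mult_distrib_mat[of _ m m])
    then show ?thesis using c mat_inv(2)[OF A] by (simp add: mult_smult_assoc_mat[of _ m m])
  qed
  then show ?thesis unfolding conj_act_def cls_def by (simp add: full_SetCompr_eq image_image)
qed

lemma transition_conj:
  assumes A: "A \<in> carrier (SL m)" and m: "0 < m" and x: "x \<in> gl_mod ((l + r) * m + z)"
  shows "transition m l r (conj_act (diag_emb l r z A) x) = conj_act A (transition m l r x)"
    "transition m l r x \<in> gl_mod m"
proof -
  let ?N = "(l + r) * m + z" let ?D = "diag_emb l r z A"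
  obtain M where M: "M \<in> carrier_mat ?N ?N" and x: "x = cls ?N M" using x by (auto simp: gl_mod_def)
  have c: "?D \<in> carrier_mat ?N ?N" "mat_inv ?D \<in> carrier_mat ?N ?N"
    using diag_emb_SL[OF A] mat_inv(1)[OF diag_emb_SL[OF A]] by auto
  then have "?D * M * mat_inv ?D \<in> carrier_mat ?N ?N" using M by auto
  then show "transition m l r (conj_act ?D x) = conj_act A (transition m l r x)"
    unfolding x conj_act_cls[OF diag_emb_SL[OF A] M] transition_cls[OF M]
      conj_act_cls[OF A trans_mat_carrier]
    by (simp add: transition_cls trans_mat_conj[OF A m M])
  show "transition m l r x \<in> gl_mod m" unfolding x transition_cls[OF M] by (simp add: gl_mod_def)
qed

lemma conj_act_gl: "A \<in> carrier (SL m) \<Longrightarrow> x \<in> gl_mod m \<Longrightarrow> conj_act A x \<in> gl_mod m"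
  using mat_inv(1)[of A m] by (auto simp: gl_mod_def conj_act_cls)

context
  fixes n l r z :: "nat \<Rightarrow> nat"
  assumes n0: "0 < n 0" and n_Suc: "\<And>i. n (Suc i) = (l i + r i) * n i + z i" and l1: "\<And>i. 1 \<le> l i"
begin

lemma n_pos: "0 < n i"
proof (induct i)
  case (Suc i) with l1[of i] show ?case by (simp add: n_Suc)
qed (rule n0)

lemma emb_self: "emb l r z i i A = A" by (simp add: emb_def)

lemma emb_Suc: "i \<le> j \<Longrightarrow> emb l r z i (Suc j) A = diag_emb (l j) (r j) (z j) (emb l r z i j A)"
  by (simp add: emb_def)

lemma emb_trans: "j \<le> k \<Longrightarrow> i \<le> j \<Longrightarrow> emb l r z j k (emb l r z i j A) = emb l r z i k A"
  by (induct k rule: dec_induct) (auto simp: emb_self emb_Suc)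

lemma emb_SL: "i \<le> j \<Longrightarrow> A \<in> carrier (SL (n i)) \<Longrightarrow> emb l r z i j A \<in> carrier (SL (n j))"
  by (induct j rule: dec_induct) (auto simp: emb_self emb_Suc n_Suc simp del: SL_simps intro: diag_emb_SL)

lemma emb_mult: "i \<le> j \<Longrightarrow> A \<in> carrier (SL (n i)) \<Longrightarrow> B \<in> carrier (SL (n i)) \<Longrightarrow>
   emb l r z i j (A * B) = emb l r z i j A * emb l r z i j B"
  by (induct j rule: dec_induct) (auto simp: emb_self emb_Suc diag_emb_mult[OF emb_SL emb_SL] simp del: SL_simps)

lemma equiv_dl_rel: "equiv (SIGMA i:UNIV. carrier (SL (n i))) (dl_rel n l r z :: ((nat \<times> 'a::field mat) \<times> _) set)"
proof (rule equivI)
  show "dl_rel n l r z \<subseteq> (SIGMA i:UNIV. carrier (SL (n i) :: 'a mat monoid)) \<times> (SIGMA i:UNIV. carrier (SL (n i)))"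
    by (auto simp: dl_rel_def simp del: SL_simps)
  show "refl_on (SIGMA i:UNIV. carrier (SL (n i))) (dl_rel n l r z :: ((nat \<times> 'a mat) \<times> _) set)"
    by (auto simp: refl_on_def dl_rel_def simp del: SL_simps)
  show "sym (dl_rel n l r z :: ((nat \<times> 'a mat) \<times> _) set)"
    by (rule symI) (auto simp: dl_rel_def simp del: SL_simps; metis)
  show "Relation.trans (dl_rel n l r z :: ((nat \<times> 'a mat) \<times> _) set)"
  proof (rule transI, clarify)
    fix i j k and A B C :: "'a mat"
    assume "((i, A), (j, B)) \<in> dl_rel n l r z" "((j, B), (k, C)) \<in> dl_rel n l r z"
    then obtain s t where s: "max i j \<le> s" "emb l r z i s A = emb l r z j s B"
      and t: "max j k \<le> t" "emb l r z j t B = emb l r z k t C"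
      and c: "A \<in> carrier (SL (n i))" "C \<in> carrier (SL (n k))"
      unfolding dl_rel_def by auto
    have "emb l r z i (max s t) A = emb l r z s (max s t) (emb l r z i s A)" using s by (subst emb_trans) auto
    also have "\<dots> = emb l r z j (max s t) B" unfolding s(2) using s by (subst emb_trans) auto
    also have "\<dots> = emb l r z t (max s t) (emb l r z j t B)" using t by (subst emb_trans) auto
    also have "\<dots> = emb l r z k (max s t) C" unfolding t(2) using t by (subst emb_trans) auto
    finally show "((i, A), (k, C)) \<in> dl_rel n l r z" using c s t
      unfolding dl_rel_def by (auto simp del: SL_simps intro!: exI[of _ "max s t"])
  qed
qed

lemma dl_act_unique:
  fixes g :: "(nat \<times> 'a::field mat) set"
  assumes g: "g \<in> carrier (dl_group n l r z)" and v: "v \<in> inv_lim n l r"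
  shows "\<exists>!w. w \<in> inv_lim n l r \<and> (\<forall>(i, A)\<in>g. \<forall>j\<ge>i. w j = conj_act (emb l r z i j A) (v j))"
proof -
  from g obtain i0 A0 where A0: "A0 \<in> carrier (SL (n i0))" and g: "g = dl_rel n l r z `` {(i0, A0)}"
    by (auto simp: dl_group_def quotient_def simp del: SL_simps)
  have mem: "(i0, A0) \<in> g" using A0 unfolding g dl_rel_def by (auto simp del: SL_simps)
  have vg: "v i \<in> gl_mod (n i)" and vt: "transition (n i) (l i) (r i) (v (Suc i)) = v i" for i
    using v by (auto simp: inv_lim_def)
  define tr :: "nat \<Rightarrow> 'a mat set \<Rightarrow> 'a mat set" where "tr i = transition (n i) (l i) (r i)" for i
  define u :: "nat \<Rightarrow> 'a mat \<Rightarrow> nat \<Rightarrow> 'a mat set" where "u i A j = conj_act (emb l r z i j A) (v j)" for i A j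
  have ug: "u i A j \<in> gl_mod (n j)" if "A \<in> carrier (SL (n i))" "i \<le> j" for i A j
    unfolding u_def by (rule conj_act_gl[OF emb_SL[OF that(2,1)] vg])
  have ut: "tr j (u i A (Suc j)) = u i A j" if "A \<in> carrier (SL (n i))" "i \<le> j" for i A j
    using transition_conj(1)[OF emb_SL[OF that(2,1)] n_pos, of "v (Suc j)" "l j" "r j" "z j"] vg[of "Suc j"] that vt[of j]
    by (simp add: tr_def u_def emb_Suc n_Suc)
  have down: "w j = w' j" if "\<And>i. j \<le> i \<Longrightarrow> tr i (w (Suc i)) = w i" "\<And>i. j \<le> i \<Longrightarrow> tr i (w' (Suc i)) = w' i" "w k = w' k" "j \<le> k" for w w' :: "nat \<Rightarrow> 'a mat set" and j k
    using that(4,1,2,3)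
  proof (induct j rule: inc_induct)
    case (step q)
    have "w (Suc q) = w' (Suc q)" by (rule step(3)) (use step(4-) in auto)
    then show ?case using step(4)[of q] step(5)[of q] by simp
  qed
  have tg: "tr i x \<in> gl_mod (n i)" if "x \<in> gl_mod (n (Suc i))" for i and x :: "'a mat set"
    using transition_conj(2)[of "1\<^sub>m (n i)" "n i" x "l i" "r i" "z i"] that n_pos by (auto simp: tr_def n_Suc)
  define w where "w j = (if i0 \<le> j then u i0 A0 j else fold tr (rev [j..<i0]) (u i0 A0 i0))" for j
  have wt: "tr j (w (Suc j)) = w j" for j
  proof (cases "i0 \<le> j")
    case True then show ?thesis using ut[OF A0] by (simp add: w_def)
  next
    case False
    then have "[j..<i0] = j # [Suc j..<i0]" by (simp add: upt_conv_Cons)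
    with False show ?thesis by (auto simp: w_def not_less_eq_eq[symmetric] dest!: le_antisym)
  qed
  have wg: "w j \<in> gl_mod (n j)" for j
  proof (cases "i0 \<le> j")
    case True then show ?thesis using ug[OF A0] by (simp add: w_def)
  next
    case False
    then have "j \<le> i0" by simp
    moreover have "w i0 \<in> gl_mod (n i0)" using ug[OF A0] by (simp add: w_def)
    ultimately show ?thesis
    proof (induct j rule: inc_induct)
      case (step q) then show ?case using tg[of "w (Suc q)" q] wt[of q] by simp
    qed
  qed
  have W: "w \<in> inv_lim n l r" using wt wg by (auto simp: inv_lim_def tr_def)
  have "w j = u i A j" if "(i, A) \<in> g" "i \<le> j" for i A j
  proof -
    from that(1) obtain k where k: "max i0 i \<le> k" "emb l r z i0 k A0 = emb l r z i k A" and A: "A \<in> carrier (SL (n i))"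
      unfolding g dl_rel_def by auto
    let ?k = "max j k"
    have "emb l r z i0 ?k A0 = emb l r z k ?k (emb l r z i0 k A0)" using k by (subst emb_trans) auto
    also have "\<dots> = emb l r z i ?k A" unfolding k(2) using k by (subst emb_trans) auto
    finally have "w ?k = u i A ?k" using k by (simp add: w_def u_def le_max_iff_disj)
    then show ?thesis using wt ut[OF A] that(2) by (intro down[of j w "u i A" ?k]) auto
  qed
  then have ex: "\<forall>(i, A)\<in>g. \<forall>j\<ge>i. w j = conj_act (emb l r z i j A) (v j)" by (auto simp: u_def)
  show ?thesis
  proof (rule ex1I[of _ w])
    show "w \<in> inv_lim n l r \<and> (\<forall>(i, A)\<in>g. \<forall>j\<ge>i. w j = conj_act (emb l r z i j A) (v j))" using W ex by blast
    fix w' assume w': "w' \<in> inv_lim n l r \<and> (\<forall>(i, A)\<in>g. \<forall>j\<ge>i. w' j = conj_act (emb l r z i j A) (v j))"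
    have "w' j = w j" for j
    proof (rule down[of _ _ _ "max i0 j"])
      show "w' (max i0 j) = w (max i0 j)" using w' mem ex by fastforce
    qed (use w' wt in \<open>auto simp: inv_lim_def tr_def\<close>)
    then show "w' = w" by blast
  qed
qed

end

declare SL_simps [simp del]

end

theory Submission
  imports Defs
begin

text \<open>Let \<open>v\<close> be a nonzero point and \<open>i\<close> a level. At a level \<open>j\<close> far above \<open>i\<close> the point \<open>v\<close> is
  a non-scalar matrix, and its component at level \<open>i\<close> is a signed sum of diagonal blocks of this
  matrix. Transvections conjugate the matrix so that one row, in a block or outside all blocks, takes
  prescribed values on \<open>n\<^sub>i\<close> other blocks, where the remaining rows of its own block vanish.
  One more transvection then changes the sum of blocks by \<open>D + \<epsilon> tr(D) E\<^sub>0\<^sub>0\<close> for any given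
  \<open>D\<close>, where \<open>\<epsilon>\<close> is \<open>-1\<close>, \<open>1\<close> or \<open>0\<close> if the row lies in a block \<open>A\<close>, in an inverse transpose block or
  outside all blocks. So the orbit of \<open>v\<close> reaches every matrix at level \<open>i\<close>, subject to a trace
  condition if only \<open>\<epsilon> = -1\<close> is available and the characteristic divides \<open>n\<^sub>i\<close>; no density
  argument is needed.

  If the embeddings are eventually \<open>A \<mapsto> Diag(A, I)\<close>, then the component at level \<open>i\<close> is a
  corner. Transvections either produce enough independent entries outside the corner to prescribe it,
  or make the matrix scalar on all rows and columns through the corner, and then the corners of its
  conjugates include, up to scalars, all matrices whose rank is at most that of the rest. Off-diagonal minors,
  which are functions on the quotient by the scalars, separate the rank loci.

  For irreducibility it suffices that any two points of a locus are, at each high level, joined by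
  a polynomial curve in the image of the locus, since the field is infinite.\<close>

text \<open>A closed set is cut out level by level, so a point belongs to it once its components at
  cofinally many levels are each matched by some point of the set (\<open>Closed_mem\<close>). All
  orbit arguments are therefore linear algebra at a single pair of levels. Since the field is merely
  infinite, normal forms that require eigenvalues are avoided. The trace term comes from the second
  half of a conjugation. The transvection adds \<open>D\<close> to the sum of blocks, and its
  inverse subtracts from the column of the controlled index a vector whose only nonzero entry in the
  controlled rows is \<open>tr D\<close>. A block \<open>A\<close> counts this entry with sign
  minus, an inverse transpose block with sign plus, and outside all blocks it is not seen. The
  number \<open>4 * n i + 2\<close> of blocks arises as follows: controlling at most
  \<open>n i\<close> rows loses at most \<open>n i\<close> further columns, which spoil at most
  \<open>n i\<close> blocks; one block may contain the row itself, and \<open>n i\<close> blocks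
  must carry \<open>D\<close>. The resulting \<open>2 * n i + 1\<close> blocks have to be of type
  \<open>A\<close>, and at least half of all blocks are, because
  \<open>r i \<le> l i\<close>.\<close>

abbreviation sqmat :: "nat \<Rightarrow> 'a mat set" where
  "sqmat m \<equiv> carrier_mat m m"

abbreviation rk :: "nat \<Rightarrow> 'a::field mat \<Rightarrow> nat" where
  "rk \<equiv> vec_space.rank"

subsection \<open>Rank factorizations\<close>

text \<open>Linearly independent vectors have dual functionals. Induction on their number: after
  \<open>x k\<close> is reduced by the functionals dual to its predecessors, some coordinate
  survives, and this coordinate, corrected and normalised, is the new functional.\<close>

lemma exists_left_inverse:
  fixes x :: "nat \<Rightarrow> nat \<Rightarrow> 'a::field"
  assumes "\<And>c. (\<And>i. i < p \<Longrightarrow> (\<Sum>a<k. c a * x a i) = 0) \<Longrightarrow> (\<And>a. a < k \<Longrightarrow> c a = 0)"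
  shows "\<exists>\<psi>. \<forall>a<k. \<forall>b<k. (\<Sum>i<p. \<psi> b i * x a i) = (if a = b then 1 else 0)"
  using assms
proof (induct k)
  case 0
  show ?case by simp
next
  case (Suc k)
  have "c a = 0" if c: "\<And>i. i < p \<Longrightarrow> (\<Sum>a<k. c a * x a i) = 0" and a: "a < k" for c a
  proof -
    have "(c(k := 0)) a = 0"
    proof (rule Suc(2)[of "c(k := 0)" a])
      fix i assume i: "i < p"
      have "(\<Sum>a<k. (c(k := 0)) a * x a i) = (\<Sum>a<k. c a * x a i)" by (rule sum.cong) auto
      with c[OF i] show "(\<Sum>a<Suc k. (c(k := 0)) a * x a i) = 0" by simp
    qed (use a in simp)
    with a show ?thesis by simp
  qed
  then have "\<exists>\<psi>. \<forall>a<k. \<forall>b<k. (\<Sum>i<p. \<psi> b i * x a i) = (if a = b then 1 else 0)" by (rule Suc(1))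
  then obtain \<psi> where \<psi>: "\<And>a b. a < k \<Longrightarrow> b < k \<Longrightarrow> (\<Sum>i<p. \<psi> b i * x a i) = (if a = b then 1 else 0)"
    by blast
  define d where "d b = (\<Sum>i<p. \<psi> b i * x k i)" for b
  have "\<exists>i<p. x k i - (\<Sum>b<k. d b * x b i) \<noteq> 0"
  proof (rule ccontr)
    assume "\<not> ?thesis"
    then have *: "x k i = (\<Sum>b<k. d b * x b i)" if "i < p" for i using that by auto
    let ?c = "\<lambda>b. if b = k then -1 else d b"
    have "?c k = 0"
    proof (rule Suc(2)[of ?c k])
      fix i assume "i < p"
      have "(\<Sum>a<k. ?c a * x a i) = (\<Sum>a<k. d a * x a i)" by (rule sum.cong) auto
      then show "(\<Sum>a<Suc k. ?c a * x a i) = 0" using *[OF \<open>i < p\<close>] by simp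
    qed simp
    then show False by simp
  qed
  then obtain i0 where i0: "i0 < p" and y0: "x k i0 - (\<Sum>b<k. d b * x b i0) \<noteq> 0" by auto
  define y where "y = x k i0 - (\<Sum>b<k. d b * x b i0)"
  \<comment> \<open>\<open>e\<close> reads coordinate \<open>i0\<close> of what remains after the
    projection to the earlier vectors is removed, so it kills these vectors and is 1 on
    \<open>x k\<close>.\<close>
  define e where "e i = ((if i = i0 then 1 else 0) - (\<Sum>b<k. x b i0 * \<psi> b i)) / y" for i
  have e: "(\<Sum>i<p. e i * x a i) = (x a i0 - (\<Sum>b<k. x b i0 * (\<Sum>i<p. \<psi> b i * x a i))) / y" for a
  proof -
    have "(\<Sum>i<p. e i * x a i) = (\<Sum>i<p. ((if i = i0 then 1 else 0) * x a i - (\<Sum>b<k. x b i0 * \<psi> b i) * x a i) / y)"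
      by (intro sum.cong refl) (simp add: e_def field_simps)
    also have "\<dots> = ((\<Sum>i<p. (if i = i0 then 1 else 0) * x a i) - (\<Sum>i<p. (\<Sum>b<k. x b i0 * \<psi> b i) * x a i)) / y"
      by (simp only: sum_divide_distrib[symmetric] sum_subtractf)
    also have "(\<Sum>i<p. (if i = i0 then 1 else 0) * x a i) = (\<Sum>i<p. if i = i0 then x a i else 0)"
      by (intro sum.cong refl) simp
    also have "\<dots> = x a i0" using i0 by simp
    also have "(\<Sum>i<p. (\<Sum>b<k. x b i0 * \<psi> b i) * x a i) = (\<Sum>b<k. x b i0 * (\<Sum>i<p. \<psi> b i * x a i))"
      unfolding sum_distrib_left sum_distrib_right by (subst sum.swap) (simp add: mult.assoc)
    finally show ?thesis .
  qed
  have e1: "(\<Sum>i<p. e i * x a i) = 0" if "a < k" for a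
  proof -
    have "(\<Sum>b<k. x b i0 * (\<Sum>i<p. \<psi> b i * x a i)) = (\<Sum>b<k. if b = a then x b i0 else 0)"
      by (intro sum.cong refl) (use \<psi>[OF that] in auto)
    then show ?thesis unfolding e using that by simp
  qed
  have e2: "(\<Sum>i<p. e i * x k i) = 1"
    unfolding e using y0 unfolding y_def d_def[symmetric] by (simp add: mult.commute)
  define \<psi>' where "\<psi>' b i = (if b = k then e i else \<psi> b i - d b * e i)" for b i
  have s: "(\<Sum>i<p. \<psi>' b i * x a i) = (\<Sum>i<p. \<psi> b i * x a i) - d b * (\<Sum>i<p. e i * x a i)" if "b < k" for a b
    using that by (simp add: \<psi>'_def left_diff_distrib sum_subtractf sum_distrib_left mult.assoc)
  have "(\<Sum>i<p. \<psi>' b i * x a i) = (if a = b then 1 else 0)" if "a < Suc k" "b < Suc k" for a b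
  proof (cases "b = k")
    case True
    then show ?thesis using that e1[of a] e2 by (cases "a = k") (auto simp: \<psi>'_def)
  next
    case False
    then have b: "b < k" using that by simp
    show ?thesis
    proof (cases "a = k")
      case True then show ?thesis using b by (simp add: s[OF b] e2 d_def[symmetric])
    next
      case F: False
      then have "a < k" using that by simp
      then show ?thesis using b by (simp add: s[OF b] e1 \<psi>)
    qed
  qed
  then show ?case by blast
qed

text \<open>Zero rows make the matrix square and singular, which reduces the claim to the
  determinant criterion.\<close>

lemma exists_kernel_vector:
  fixes A :: "'a::field mat"
  assumes A: "A \<in> carrier_mat p q" and pq: "p < q"
  shows "\<exists>v \<in> carrier_vec q. v \<noteq> 0\<^sub>v q \<and> A *\<^sub>v v = 0\<^sub>v p"
proof -
  define B where "B = mat q q (\<lambda>(i, j). if i < p then A $$ (i, j) else 0)"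
  have B: "B \<in> sqmat q" by (simp add: B_def)
  have "det B = 0"
  proof -
    have "det B = (\<Sum>j<q. B $$ (q - 1, j) * cofactor B (q - 1) j)"
      by (rule laplace_expansion_row[OF B]) (use pq in auto)
    also have "\<dots> = 0" using pq by (intro sum.neutral) (auto simp: B_def)
    finally show ?thesis .
  qed
  then obtain v where v: "v \<in> carrier_vec q" "v \<noteq> 0\<^sub>v q" "B *\<^sub>v v = 0\<^sub>v q"
    using det_0_iff_vec_prod_zero_field[OF B] by auto
  have "A *\<^sub>v v = 0\<^sub>v p"
  proof (rule eq_vecI)
    fix i assume "i < dim_vec (0\<^sub>v p :: 'a vec)"
    then have i: "i < p" by simp
    have "(A *\<^sub>v v) $ i = (B *\<^sub>v v) $ i"
      using i pq A v(1) by (auto simp: scalar_prod_def B_def intro!: sum.cong)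
    then show "(A *\<^sub>v v) $ i = 0\<^sub>v p $ i" using v(3) i pq by simp
  qed (use A in auto)
  with v show ?thesis by blast
qed

lemma one_mat_factor_le:
  fixes A :: "'a::field mat"
  assumes A: "A \<in> carrier_mat q p" and B: "B \<in> carrier_mat p q" and e: "A * B = 1\<^sub>m q"
  shows "q \<le> p"
proof (rule ccontr)
  assume "\<not> q \<le> p"
  then obtain v where v: "v \<in> carrier_vec q" "v \<noteq> 0\<^sub>v q" "B *\<^sub>v v = 0\<^sub>v p"
    using exists_kernel_vector[OF B] by auto
  have "v = (A * B) *\<^sub>v v" using v by (simp add: e)
  also have "\<dots> = A *\<^sub>v (B *\<^sub>v v)" using A B v by (simp add: assoc_mult_mat_vec)
  also have "\<dots> = 0\<^sub>v q" using A v(3) by (intro eq_vecI) auto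
  finally show False using v by simp
qed

lemma left_inverse_mat:
  fixes B :: "'a::field mat"
  assumes B: "B \<in> carrier_mat p k"
    and inj: "\<And>v. v \<in> carrier_vec k \<Longrightarrow> B *\<^sub>v v = 0\<^sub>v p \<Longrightarrow> v = 0\<^sub>v k"
  shows "\<exists>X \<in> carrier_mat k p. X * B = 1\<^sub>m k"
proof -
  have "\<exists>\<psi>. \<forall>a<k. \<forall>b<k. (\<Sum>i<p. \<psi> b i * B $$ (i, a)) = (if a = b then 1 else 0)"
  proof (rule exists_left_inverse)
    fix c a assume c: "\<And>i. i < p \<Longrightarrow> (\<Sum>a<k. c a * B $$ (i, a)) = 0" and a: "a < k"
    have "B *\<^sub>v vec k c = 0\<^sub>v p"
    proof (rule eq_vecI)
      fix i assume "i < dim_vec (0\<^sub>v p :: 'a vec)"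
      then show "(B *\<^sub>v vec k c) $ i = 0\<^sub>v p $ i" using c[of i] B
        by (simp add: scalar_prod_def lessThan_atLeast0 mult.commute)
    qed (use B in auto)
    then have "vec k c = 0\<^sub>v k" by (intro inj) auto
    then show "c a = 0" using a by (metis index_vec index_zero_vec(1))
  qed
  then obtain \<psi> where \<psi>: "\<And>a b. a < k \<Longrightarrow> b < k \<Longrightarrow> (\<Sum>i<p. \<psi> b i * B $$ (i, a)) = (if a = b then 1 else 0)" by blast
  show ?thesis
  proof (intro bexI[of _ "mat k p (\<lambda>(b, i). \<psi> b i)"] eq_matI)
    fix i j assume "i < dim_row (1\<^sub>m k :: 'a mat)" "j < dim_col (1\<^sub>m k :: 'a mat)"
    then show "(mat k p (\<lambda>(b, i). \<psi> b i) * B) $$ (i, j) = 1\<^sub>m k $$ (i, j)"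
      using B \<psi>[of j i] by (auto simp: scalar_prod_def lessThan_atLeast0)
  qed (use B in auto)
qed

text \<open>The rank comparisons below rest on this normal form: \<open>A\<close> factors through
  dimension \<open>k\<close>, and the identity of size \<open>k\<close> is recovered from
  \<open>A\<close>. Here \<open>B\<close> collects a maximal independent set of columns,
  \<open>X\<close> inverts it from the left, and \<open>Y\<close> selects these columns in
  \<open>A\<close>.\<close>

lemma rank_factorization:
  fixes A :: "'a::field mat"
  assumes A: "A \<in> carrier_mat p q"
  defines "k \<equiv> rk p A"
  shows "\<exists>B \<in> carrier_mat p k. \<exists>C \<in> carrier_mat k q. \<exists>X \<in> carrier_mat k p. \<exists>Y \<in> carrier_mat q k.
    A = B * C \<and> X * A * Y = 1\<^sub>m k"
proof -
  interpret V: vec_space "TYPE('a)" p .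
  let ?P = "\<lambda>T. T \<subseteq> set (cols A) \<and> V.lin_indpt T"
  obtain S where S: "maximal S ?P"
    using maximal_exists_superset[of "set (cols A)" ?P "{}"] V.finite_lin_indpt2[of "{}"] by auto
  have k: "k = card S" unfolding k_def by (rule V.rank_card_indpt[OF A S])
  have Ss: "S \<subseteq> set (cols A)" "V.lin_indpt S" using S by (auto simp: maximal_def)
  have cA: "set (cols A) \<subseteq> carrier_vec p" using A cols_dim by blast
  have fS: "finite S" using Ss finite_subset by blast
  obtain xs where xs: "set xs = S" "distinct xs" using fS finite_distinct_list by blast
  have len: "length xs = k" using xs k distinct_card by metis
  define B where "B = mat_of_cols p xs"
  have B: "B \<in> carrier_mat p k" using len by (simp add: B_def mat_of_cols_def)
  have cB: "cols B = xs" unfolding B_def by (rule cols_mat_of_cols) (use xs Ss cA in auto)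
  have inj: "v = 0\<^sub>v k" if "v \<in> carrier_vec k" "B *\<^sub>v v = 0\<^sub>v p" for v
    using V.lin_depI[OF B that(1) _ that(2)] xs Ss cB by auto
  obtain X where X: "X \<in> carrier_mat k p" "X * B = 1\<^sub>m k" using left_inverse_mat[OF B inj] by auto
  have "\<exists>w \<in> carrier_vec k. col A j = B *\<^sub>v w" if j: "j < q" for j
  proof -
    have cj: "col A j \<in> set (cols A)" using j A by (metis carrier_matD(2) cols_length cols_nth nth_mem)
    have "col A j \<in> V.span S"
    proof (rule ccontr)
      assume n: "col A j \<notin> V.span S"
      have nS: "col A j \<notin> S" using n V.span_mem Ss cA by blast
      have "V.lin_indpt (S \<union> {col A j})"
        using V.lin_dep_iff_in_span[of S "col A j"] n nS Ss cA cj by blast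
      then have "?P (S \<union> {col A j})" using Ss cj by auto
      then show False using S nS unfolding maximal_def by (metis UnI2 Un_upper1 singletonI)
    qed
    then obtain a where "V.lincomb a S = col A j" using V.finite_in_span[OF fS] Ss cA by (metis subset_trans)
    then have "col A j = B *\<^sub>v vec k (\<lambda>i. a (col B i))"
      using V.mat_mult_eq_lincomb[OF B, of a] cB xs by simp
    then show ?thesis by (intro bexI[of _ "vec k (\<lambda>i. a (col B i))"]) auto
  qed
  then obtain w where w: "\<And>j. j < q \<Longrightarrow> w j \<in> carrier_vec k \<and> col A j = B *\<^sub>v w j" by metis
  define C where "C = mat k q (\<lambda>(i, j). w j $ i)"
  have C: "C \<in> carrier_mat k q" by (simp add: C_def)
  have Cc: "col C j = w j" if "j < q" for j using w[OF that] that by (auto simp: C_def intro!: eq_vecI)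
  have AB: "A = B * C"
  proof (rule eq_matI)
    fix i j assume ij: "i < dim_row (B * C)" "j < dim_col (B * C)"
    then have j: "j < q" "i < p" using C B by auto
    have "A $$ (i, j) = col A j $ i" using j A by simp
    also have "\<dots> = (B *\<^sub>v col C j) $ i" using w[OF j(1)] Cc[OF j(1)] by simp
    also have "\<dots> = (B * C) $$ (i, j)" using ij by simp
    finally show "A $$ (i, j) = (B * C) $$ (i, j)" .
  qed (use A B C in auto)
  have "\<exists>j<q. xs ! a = col A j" if "a < k" for a
  proof -
    have "xs ! a \<in> set (cols A)" using that len xs Ss nth_mem by blast
    then show ?thesis using A by (auto simp: in_set_conv_nth)
  qed
  then obtain jj where jj: "\<And>a. a < k \<Longrightarrow> jj a < q \<and> xs ! a = col A (jj a)" by metis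
  define Y where "Y = mat q k (\<lambda>(i, a). if i = jj a then 1 else 0 :: 'a)"
  have Y: "Y \<in> carrier_mat q k" by (simp add: Y_def)
  have "A * Y = B"
  proof (rule eq_matI)
    fix i a assume "i < dim_row B" "a < dim_col B"
    then have ia: "i < p" "a < k" using B by auto
    have "(A * Y) $$ (i, a) = (\<Sum>j<q. A $$ (i, j) * Y $$ (j, a))"
      by (rule mult_index[OF A Y ia])
    also have "\<dots> = (\<Sum>j<q. if j = jj a then A $$ (i, j) else 0)"
      using ia by (intro sum.cong) (auto simp: Y_def)
    also have "\<dots> = A $$ (i, jj a)" using jj[OF ia(2)] by simp
    also have "\<dots> = xs ! a $ i" using jj[OF ia(2)] ia A by simp
    also have "\<dots> = B $$ (i, a)" using ia len by (simp add: B_def mat_of_cols_def)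
    finally show "(A * Y) $$ (i, a) = B $$ (i, a)" .
  qed (use A B Y in auto)
  then have "X * A * Y = 1\<^sub>m k" using X A Y by (simp add: assoc_mult_mat[of _ k p _ q _ k])
  with AB X Y B C show ?thesis by blast
qed

lemma rank_mult_le:
  fixes A :: "'a::field mat"
  assumes A: "A \<in> carrier_mat p k" and B: "B \<in> carrier_mat k q"
  shows "rk p (A * B) \<le> k"
proof -
  let ?r = "rk p (A * B)"
  have AB: "A * B \<in> carrier_mat p q" using A B by simp
  obtain X Y where X: "X \<in> carrier_mat ?r p" and Y: "Y \<in> carrier_mat q ?r" and e: "X * (A * B) * Y = 1\<^sub>m ?r"
    using rank_factorization[OF AB] by blast
  have "X * (A * B) * Y = (X * A) * (B * Y)"
  proof -
    have "X * (A * B) * Y = X * A * B * Y" using X A B by (simp add: assoc_mult_mat[of X ?r p A k B q])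
    also have "\<dots> = (X * A) * (B * Y)"
      by (rule assoc_mult_mat[of _ ?r k _ q _ ?r]) (use X A B Y in auto)
    finally show ?thesis .
  qed
  then show ?thesis using e X A B Y by (intro one_mat_factor_le[of "X * A" ?r k "B * Y"]) auto
qed

lemma rank_mult_mult_le:
  fixes A :: "'a::field mat"
  assumes X: "X \<in> carrier_mat s p" and A: "A \<in> carrier_mat p q" and Y: "Y \<in> carrier_mat q t"
  shows "rk s (X * A * Y) \<le> rk p A"
proof -
  let ?k = "rk p A"
  obtain B C where B: "B \<in> carrier_mat p ?k" and C: "C \<in> carrier_mat ?k q" and e: "A = B * C"
    using rank_factorization[OF A] by blast
  have "X * A * Y = X * (B * C) * Y" by (simp only: e[symmetric])
  also have "X * (B * C) = X * B * C" using X B C by (simp add: assoc_mult_mat[of X s p B ?k C q])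
  also have "X * B * C * Y = (X * B) * (C * Y)"
    by (rule assoc_mult_mat[of _ s ?k _ q _ t]) (use X B C Y in auto)
  finally show ?thesis using rank_mult_le[of "X * B" s ?k "C * Y" t] X B C Y by simp
qed

text \<open>Both matrices meet in the identity of size \<open>rk s F\<close>: the two factors of
  \<open>A\<close> are padded with zeros to that size, and \<open>F\<close> is compressed to
  it.\<close>

lemma rank_le_imp_factor:
  fixes A F :: "'a::field mat"
  assumes A: "A \<in> carrier_mat p q" and F: "F \<in> carrier_mat s t"
    and le: "rk p A \<le> rk s F"
  shows "\<exists>X \<in> carrier_mat p s. \<exists>Y \<in> carrier_mat t q. A = X * F * Y"
proof -
  let ?k = "rk p A" let ?m = "rk s F"
  obtain B C where B: "B \<in> carrier_mat p ?k" and C: "C \<in> carrier_mat ?k q" and e: "A = B * C"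
    using rank_factorization[OF A] by blast
  obtain X Y where X: "X \<in> carrier_mat ?m s" and Y: "Y \<in> carrier_mat t ?m" and f: "X * F * Y = 1\<^sub>m ?m"
    using rank_factorization[OF F] by blast
  define B' where "B' = mat p ?m (\<lambda>(i, j). if j < ?k then B $$ (i, j) else 0)"
  define C' where "C' = mat ?m q (\<lambda>(i, j). if i < ?k then C $$ (i, j) else 0)"
  have B': "B' \<in> carrier_mat p ?m" and C': "C' \<in> carrier_mat ?m q" by (simp_all add: B'_def C'_def)
  have "B' * C' = A"
  proof (rule eq_matI)
    fix i j assume "i < dim_row A" "j < dim_col A"
    then have ij: "i < p" "j < q" using A by auto
    have "(B' * C') $$ (i, j) = (\<Sum>a<?m. B' $$ (i, a) * C' $$ (a, j))" by (rule mult_index[OF B' C' ij])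
    also have "\<dots> = (\<Sum>a<?k. B' $$ (i, a) * C' $$ (a, j))"
      by (rule sum.mono_neutral_right) (use le ij in \<open>auto simp: B'_def\<close>)
    also have "\<dots> = (\<Sum>a<?k. B $$ (i, a) * C $$ (a, j))"
      by (rule sum.cong) (use le ij in \<open>auto simp: B'_def C'_def\<close>)
    also have "\<dots> = (B * C) $$ (i, j)" by (rule mult_index[OF B C ij, symmetric])
    finally show "(B' * C') $$ (i, j) = A $$ (i, j)" using e by simp
  qed (use A B' C' in auto)
  moreover have "(B' * X) * F * (Y * C') = B' * C'"
  proof -
    have e1: "(B' * X) * F * (Y * C') = (B' * X * F * Y) * C'"
      by (rule assoc_mult_mat[symmetric, of _ p t _ ?m _ q]) (use B' X F Y C' in auto)
    have e2: "B' * X * F = B' * (X * F)" by (rule assoc_mult_mat) (use B' X F in auto)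
    have e3: "B' * (X * F) * Y = B' * (X * F * Y)"
      by (rule assoc_mult_mat[of _ p ?m _ t _ ?m]) (use B' X F Y in auto)
    show ?thesis unfolding e1 unfolding e2 e3 f using B' by simp
  qed
  ultimately have "A = (B' * X) * F * (Y * C')" by simp
  with B' X Y C' show ?thesis by (intro bexI[of _ "B' * X"] bexI[of _ "Y * C'"]) auto
qed

subsection \<open>Conjugation by transvections\<close>

text \<open>Matrices are carried as functions of two indices, so that one \<open>f\<close>
  represents a matrix together with all its corners \<open>fmat m f\<close>, and pointwise changes
  need no carrier conditions.\<close>

definition fmat :: "nat \<Rightarrow> (nat \<Rightarrow> nat \<Rightarrow> 'a) \<Rightarrow> 'a mat" where
  "fmat N f = mat N N (\<lambda>(i, j). f i j)"

lemma fmat_carrier [simp]: "fmat N f \<in> sqmat N"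
  by (simp add: fmat_def)

lemma fmat_dim [simp]: "dim_row (fmat N f) = N" "dim_col (fmat N f) = N"
  by (simp_all add: fmat_def)

lemma fmat_index [simp]: "i < N \<Longrightarrow> j < N \<Longrightarrow> fmat N f $$ (i, j) = f i j"
  by (simp add: fmat_def)

lemma fmat_cong: "(\<And>i j. i < N \<Longrightarrow> j < N \<Longrightarrow> f i j = g i j) \<Longrightarrow> fmat N f = fmat N g"
  by (rule eq_matI) auto

lemma fmat_of_carrier: "P \<in> sqmat N \<Longrightarrow> fmat N (\<lambda>i j. P $$ (i, j)) = P"
  by (rule eq_matI) auto

lemma fmat_one: "fmat N (\<lambda>i j. if i = j then 1 else 0) = 1\<^sub>m N"
  by (rule eq_matI) auto

lemma fmat_mult: "fmat N f * fmat N g = fmat N (\<lambda>i j. \<Sum>k<N. f i k * g k j)"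
proof (rule eq_matI)
  fix i j assume "i < dim_row (fmat N (\<lambda>i j. \<Sum>k<N. f i k * g k j))" "j < dim_col (fmat N (\<lambda>i j. \<Sum>k<N. f i k * g k j))"
  then show "(fmat N f * fmat N g) $$ (i, j) = fmat N (\<lambda>i j. \<Sum>k<N. f i k * g k j) $$ (i, j)"
    by (simp add: mult_index[of _ N N _ N] del: index_mult_mat(1))
qed auto

abbreviation delta :: "nat \<Rightarrow> nat \<Rightarrow> 'a::zero_neq_one" where
  "delta i j \<equiv> (if i = j then 1 else 0)"

lemma sum_delta_mult:
  fixes h :: "nat \<Rightarrow> 'a::comm_ring_1"
  assumes "i < N"
  shows "(\<Sum>k<N. delta i k * h k) = h i" "(\<Sum>k<N. h k * delta k i) = h i"
proof -
  have "(\<Sum>k<N. delta i k * h k) = (\<Sum>k<N. if k = i then h k else 0)" by (rule sum.cong) auto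
  then show "(\<Sum>k<N. delta i k * h k) = h i" using assms by simp
  have "(\<Sum>k<N. h k * delta k i) = (\<Sum>k<N. if k = i then h k else 0)" by (rule sum.cong) auto
  then show "(\<Sum>k<N. h k * delta k i) = h i" using assms by simp
qed

definition sim :: "nat \<Rightarrow> (nat \<Rightarrow> nat \<Rightarrow> 'a::field) \<Rightarrow> (nat \<Rightarrow> nat \<Rightarrow> 'a) \<Rightarrow> bool" where
  "sim N f g \<longleftrightarrow> (\<exists>A \<in> carrier (SL N). fmat N g = A * fmat N f * mat_inv A)"

lemma sim_refl: "sim N f f"
proof -
  have o: "1\<^sub>m N \<in> carrier (SL N :: 'a mat monoid)" by (simp add: SL_simps)
  have "mat_inv (1\<^sub>m N) = (1\<^sub>m N :: 'a mat)" by (rule mat_inv_unique[OF o o]) simp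
  then have "fmat N f = 1\<^sub>m N * fmat N f * mat_inv (1\<^sub>m N)"
    by (simp add: right_mult_one_mat[OF fmat_carrier] left_mult_one_mat[OF fmat_carrier])
  with o show ?thesis unfolding sim_def by blast
qed

lemma sim_trans: assumes "sim N f g" "sim N g h" shows "sim N f h"
proof -
  from assms obtain A B where A: "A \<in> carrier (SL N)" and B: "B \<in> carrier (SL N)"
    and g: "fmat N g = A * fmat N f * mat_inv A" and h: "fmat N h = B * fmat N g * mat_inv B"
    unfolding sim_def by blast
  have c: "A \<in> sqmat N" "B \<in> sqmat N" "mat_inv A \<in> sqmat N" "mat_inv B \<in> sqmat N"
    using A B mat_inv(1)[OF A] mat_inv(1)[OF B] by (auto simp: SL_simps)
  have BA: "B * A \<in> carrier (SL N)" using A B by (auto simp: SL_simps det_mult)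
  have "fmat N h = (B * A) * fmat N f * (mat_inv A * mat_inv B)"
    unfolding h g
    by (simp add: assoc_mult_mat[of _ N N _ N _ N] mult_carrier_mat[of _ N N _ N] c)
  then have "fmat N h = (B * A) * fmat N f * mat_inv (B * A)" unfolding mat_inv_mult[OF B A] .
  with BA show ?thesis unfolding sim_def by blast
qed

lemma det_row_transvection:
  fixes \<tau> :: "nat \<Rightarrow> 'a::field"
  assumes c: "c < N" and \<tau>: "\<tau> c = 0"
  shows "det (fmat N (\<lambda>i j. delta i j + delta i c * \<tau> j)) = 1"
proof -
  let ?A = "fmat N (\<lambda>i j. delta i j + delta i c * \<tau> j)"
  have "det ?A = (\<Sum>i<N. ?A $$ (i, c) * cofactor ?A i c)"
    by (rule laplace_expansion_column) (use c in auto)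
  also have "\<dots> = (\<Sum>i<N. if i = c then cofactor ?A i c else 0)"
    by (rule sum.cong) (use c \<tau> in auto)
  also have "\<dots> = cofactor ?A c c" using c by simp
  also have "\<dots> = det (mat_delete ?A c c)" by (simp add: cofactor_def)
  also have "mat_delete ?A c c = 1\<^sub>m (N - 1)"
    by (rule eq_matI) (auto simp: mat_delete_def)
  finally show ?thesis by simp
qed

lemma det_column_transvection:
  fixes v :: "nat \<Rightarrow> 'a::field"
  assumes "\<zeta> < N" "v \<zeta> = 0"
  shows "det (fmat N (\<lambda>i j. delta i j + v i * delta \<zeta> j)) = 1"
proof -
  have "fmat N (\<lambda>i j. delta i j + v i * delta \<zeta> j) = (fmat N (\<lambda>i j. delta i j + delta i \<zeta> * v j))\<^sup>T"
    by (rule eq_matI) auto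
  then show ?thesis using det_row_transvection[of \<zeta> N v] assms by (simp add: det_transpose[of _ N])
qed

text \<open>The rank one matrix with entries \<open>u i * \<tau> j\<close> squares to zero, so that
  \<open>1 - u \<tau>\<close> inverts \<open>1 + u \<tau>\<close>; the formula is the expanded
  product of the conjugation.\<close>

lemma sim_transvection:
  fixes u \<tau> :: "nat \<Rightarrow> 'a::field"
  assumes d: "det (fmat N (\<lambda>i j. delta i j + u i * \<tau> j)) = 1" "det (fmat N (\<lambda>i j. delta i j + (- u i) * \<tau> j)) = 1"
    and o: "(\<Sum>k<N. \<tau> k * u k) = 0"
  shows "sim N f (\<lambda>i j. f i j + u i * (\<Sum>k<N. \<tau> k * f k j) - (\<Sum>k<N. f i k * u k) * \<tau> j
     - u i * (\<Sum>k<N. \<tau> k * (\<Sum>m<N. f k m * u m)) * \<tau> j)"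
proof -
  let ?A = "fmat N (\<lambda>i j. delta i j + u i * \<tau> j)" let ?B = "fmat N (\<lambda>i j. delta i j + (- u i) * \<tau> j)"
  have A: "?A \<in> carrier (SL N)" and B: "?B \<in> carrier (SL N)" using d by (auto simp: SL_simps)
  have l: "?A * fmat N h = fmat N (\<lambda>i j. h i j + u i * (\<Sum>k<N. \<tau> k * h k j))" for h
    unfolding fmat_mult
    by (rule fmat_cong) (simp add: distrib_right sum.distrib sum_delta_mult sum_distrib_left mult.assoc)
  have r: "fmat N h * ?B = fmat N (\<lambda>i j. h i j - (\<Sum>k<N. h i k * u k) * \<tau> j)" for h
    unfolding fmat_mult
    by (rule fmat_cong)
      (simp add: right_diff_distrib sum_subtractf sum_delta_mult sum_distrib_right mult.assoc)
  have "?A * ?B = fmat N (\<lambda>i j. delta i j)"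
    unfolding r
  proof (rule fmat_cong)
    fix i j assume ij: "i < N" "j < N"
    have "(\<Sum>k<N. (delta i k + u i * \<tau> k) * u k) = u i + u i * (\<Sum>k<N. \<tau> k * u k)"
      using ij by (simp add: distrib_right sum.distrib sum_delta_mult sum_distrib_left mult.assoc)
    then show "delta i j + u i * \<tau> j - (\<Sum>k<N. (delta i k + u i * \<tau> k) * u k) * \<tau> j = delta i j"
      using o by simp
  qed
  then have inv: "mat_inv ?A = ?B" by (intro mat_inv_unique[OF A B]) (simp add: fmat_one)
  have "?A * fmat N f * ?B = fmat N (\<lambda>i j. f i j + u i * (\<Sum>k<N. \<tau> k * f k j)
      - (\<Sum>k<N. (f i k + u i * (\<Sum>m<N. \<tau> m * f m k)) * u k) * \<tau> j)"
    unfolding l r ..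
  also have "\<dots> = fmat N (\<lambda>i j. f i j + u i * (\<Sum>k<N. \<tau> k * f k j) - (\<Sum>k<N. f i k * u k) * \<tau> j
     - u i * (\<Sum>k<N. \<tau> k * (\<Sum>m<N. f k m * u m)) * \<tau> j)"
  proof (rule fmat_cong)
    fix i j assume ij: "i < N" "j < N"
    have s: "(\<Sum>k<N. (\<Sum>m<N. \<tau> m * f m k) * u k) = (\<Sum>k<N. \<tau> k * (\<Sum>m<N. f k m * u m))"
      unfolding sum_distrib_left sum_distrib_right by (subst sum.swap) (simp add: mult.assoc)
    have "(\<Sum>k<N. (f i k + u i * (\<Sum>m<N. \<tau> m * f m k)) * u k)
      = (\<Sum>k<N. f i k * u k) + u i * (\<Sum>k<N. \<tau> k * (\<Sum>m<N. f k m * u m))"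
      unfolding s[symmetric] distrib_right sum.distrib mult.assoc sum_distrib_left[symmetric] ..
    then show "f i j + u i * (\<Sum>k<N. \<tau> k * f k j)
      - (\<Sum>k<N. (f i k + u i * (\<Sum>m<N. \<tau> m * f m k)) * u k) * \<tau> j =
      f i j + u i * (\<Sum>k<N. \<tau> k * f k j) - (\<Sum>k<N. f i k * u k) * \<tau> j
     - u i * (\<Sum>k<N. \<tau> k * (\<Sum>m<N. f k m * u m)) * \<tau> j"
      by (simp add: distrib_right)
  qed
  finally show ?thesis unfolding sim_def using A inv by (intro bexI[of _ ?A]) auto
qed

lemma sim_cong:
  assumes "sim N f g" "\<And>i j. i < N \<Longrightarrow> j < N \<Longrightarrow> g i j = h i j"
  shows "sim N f h"
  using assms fmat_cong[of N g h] unfolding sim_def by auto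

text \<open>Conjugation by the identity with \<open>v\<close> added to column
  \<open>\<zeta>\<close>. It adds multiples of row \<open>\<zeta>\<close> to other rows, and its
  side effect is confined to column \<open>\<zeta>\<close>.\<close>

definition column_move :: "nat \<Rightarrow> nat \<Rightarrow> (nat \<Rightarrow> 'a::field) \<Rightarrow> (nat \<Rightarrow> nat \<Rightarrow> 'a) \<Rightarrow> nat \<Rightarrow> nat \<Rightarrow> 'a" where
  "column_move N \<zeta> v f i j = f i j + v i * f \<zeta> j
     - (if j = \<zeta> then (\<Sum>k<N. f i k * v k) + v i * (\<Sum>k<N. f \<zeta> k * v k) else 0)"

text \<open>Conjugation by the identity with \<open>\<tau>\<close> added to row \<open>c\<close>. It
  subtracts multiples of column \<open>c\<close> from other columns, and its side effect is confined
  to row \<open>c\<close>.\<close>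

definition row_move :: "nat \<Rightarrow> nat \<Rightarrow> (nat \<Rightarrow> 'a::field) \<Rightarrow> (nat \<Rightarrow> nat \<Rightarrow> 'a) \<Rightarrow> nat \<Rightarrow> nat \<Rightarrow> 'a" where
  "row_move N c \<tau> f i j = f i j - f i c * \<tau> j
     + (if i = c then (\<Sum>k<N. \<tau> k * f k j) - \<tau> j * (\<Sum>k<N. \<tau> k * f k c) else 0)"

lemma sim_column_move:
  assumes "\<zeta> < N" "v \<zeta> = 0"
  shows "sim N f (column_move N \<zeta> v f)"
proof -
  have s: "(\<Sum>k<N. delta \<zeta> k * h k) = h \<zeta>" for h :: "nat \<Rightarrow> 'a" by (rule sum_delta_mult) fact
  have "sim N f (\<lambda>i j. f i j + v i * (\<Sum>k<N. delta \<zeta> k * f k j) - (\<Sum>k<N. f i k * v k) * delta \<zeta> j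
     - v i * (\<Sum>k<N. delta \<zeta> k * (\<Sum>m<N. f k m * v m)) * delta \<zeta> j)"
    by (rule sim_transvection)
      (use assms det_column_transvection[of \<zeta> N v] det_column_transvection[of \<zeta> N "\<lambda>i. - v i"] in \<open>auto simp: s\<close>)
  then show ?thesis by (rule sim_cong) (auto simp: s column_move_def)
qed

lemma sim_row_move:
  assumes "c < N" "\<tau> c = 0"
  shows "sim N f (row_move N c \<tau> f)"
proof -
  have s: "(\<Sum>k<N. h k * delta k c) = h c" for h :: "nat \<Rightarrow> 'a" by (rule sum_delta_mult) fact
  have m: "(\<lambda>i j. delta i j + - delta i c * \<tau> j) = (\<lambda>i j. delta i j + delta i c * (- \<tau> j))" by auto
  have "sim N f (\<lambda>i j. f i j + delta i c * (\<Sum>k<N. \<tau> k * f k j) - (\<Sum>k<N. f i k * delta k c) * \<tau> j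
     - delta i c * (\<Sum>k<N. \<tau> k * (\<Sum>m<N. f k m * delta m c)) * \<tau> j)"
    by (rule sim_transvection)
      (use assms det_row_transvection[of c N \<tau>] det_row_transvection[of c N "\<lambda>i. - \<tau> i"] in \<open>simp_all only: m s\<close>, simp)
  then show ?thesis by (rule sim_cong) (auto simp: s row_move_def)
qed

text \<open>Conjugation by \<open>1 + t E\<close> with \<open>E\<close> the matrix unit at
  \<open>(a, b)\<close>.\<close>

definition elem_move :: "nat \<Rightarrow> nat \<Rightarrow> 'a::field \<Rightarrow> (nat \<Rightarrow> nat \<Rightarrow> 'a) \<Rightarrow> nat \<Rightarrow> nat \<Rightarrow> 'a" where
  "elem_move a b t f i j = f i j + (if i = a then t * f b j else 0)
     - (if j = b then t * f i a + (if i = a then t * t * f b a else 0) else 0)"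

text \<open>Recording the index set \<open>R\<close> of the moves makes it possible to preserve
  structure outside \<open>R\<close>, which plain conjugacy would not.\<close>

inductive reach :: "nat set \<Rightarrow> (nat \<Rightarrow> nat \<Rightarrow> 'a::field) \<Rightarrow> (nat \<Rightarrow> nat \<Rightarrow> 'a) \<Rightarrow> bool" for R f where
  reach_refl: "reach R f f"
| reach_step: "reach R f g \<Longrightarrow> a \<in> R \<Longrightarrow> b \<in> R \<Longrightarrow> a \<noteq> b \<Longrightarrow> reach R f (elem_move a b t g)"

lemma sim_elem_move:
  assumes "a < N" "b < N" "a \<noteq> b"
  shows "sim N f (elem_move a b t f)"
proof -
  let ?v = "\<lambda>i. if i = a then t else 0"
  have s: "(\<Sum>k<N. h k * ?v k) = t * h a" for h :: "nat \<Rightarrow> 'a"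
  proof -
    have "(\<Sum>k<N. h k * ?v k) = (\<Sum>k<N. if k = a then t * h k else 0)" by (rule sum.cong) auto
    then show ?thesis using assms by simp
  qed
  have "sim N f (column_move N b ?v f)" by (rule sim_column_move) (use assms in auto)
  then show ?thesis by (rule sim_cong) (auto simp: column_move_def elem_move_def s)
qed

lemma reach_sim: "reach R f g \<Longrightarrow> R \<subseteq> {..<N} \<Longrightarrow> sim N f g"
proof (induct rule: reach.induct)
  case (reach_step g a b t)
  then have "sim N g (elem_move a b t g)" by (intro sim_elem_move) auto
  with reach_step show ?case by (blast intro: sim_trans)
qed (rule sim_refl)

section \<open>Creating a pivot and prescribing a row\<close>

definition scalar_on :: "nat set \<Rightarrow> (nat \<Rightarrow> nat \<Rightarrow> 'a::field) \<Rightarrow> bool" where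
  "scalar_on R f \<longleftrightarrow> (\<exists>c. \<forall>i\<in>R. \<forall>j\<in>R. f i j = (if i = j then c else 0))"

text \<open>If the entry \<open>(q0, p0)\<close> vanished on the whole orbit, comparing each
  reachable matrix with its images under elementary moves would carry the vanishing to all
  off-diagonal entries on \<open>R\<close>, and one more move would equate the diagonal
  entries.\<close>

lemma reach_offdiag:
  assumes R: "q0 \<in> R" "p0 \<in> R" "s \<in> R" "q0 \<noteq> p0" "s \<noteq> q0" "s \<noteq> p0"
    and ns: "\<not> scalar_on R f"
  shows "\<exists>g. reach R f g \<and> g q0 p0 \<noteq> 0"
proof (rule ccontr)
  assume "\<not> ?thesis"
  then have 0: "g q0 p0 = 0" if "reach R f g" for g using that by blast
  have st: "reach R f (elem_move a b 1 g)" if "reach R f g" "a \<in> R" "b \<in> R" "a \<noteq> b" for g a b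
    using that by (rule reach_step)
  have 1: "g c p0 = 0" if "reach R f g" "c \<in> R" "c \<noteq> p0" for g c
  proof (cases "c = q0")
    case False
    have "elem_move q0 c 1 g q0 p0 = 0" using st[OF that(1) R(1) that(2)] False 0 by auto
    then show ?thesis using 0[OF that(1)] that by (simp add: elem_move_def)
  qed (use 0 that in simp)
  have 2: "g c d = 0" if "reach R f g" "c \<in> R" "d \<in> R" "c \<noteq> d" "c \<noteq> p0" for g c d
  proof (cases "d = p0")
    case False
    have "elem_move d p0 1 g c p0 = 0" using st[OF that(1) that(3) R(2) False] 1 that by blast
    then show ?thesis using 1[OF that(1,2)] that by (simp add: elem_move_def)
  qed (use 1 that in simp)
  have 3: "g p0 d = 0" if "reach R f g" "d \<in> R" "d \<noteq> p0" for g d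
  proof (cases "d = q0")
    case False
    have "elem_move q0 p0 1 g q0 d = 0" using st[OF that(1) R(1,2,4)] 2 R that False by metis
    then show ?thesis using 2[OF that(1) R(1) that(2)] R that False by (simp add: elem_move_def)
  next
    case True
    \<comment> \<open>Adding row \<open>p0\<close> to row \<open>q0\<close>, as in the other case,
      would land on the diagonal here; hence the third index \<open>s\<close>.\<close>
    have "elem_move s p0 1 g s q0 = 0" using st[OF that(1) R(3,2,6)] 2 R by blast
    then show ?thesis using 2[OF that(1) R(3,1)] R True by (simp add: elem_move_def)
  qed
  have off: "g c d = 0" if "reach R f g" "c \<in> R" "d \<in> R" "c \<noteq> d" for g c d
    using 2[OF that] 3[OF that(1), of d] that by (cases "c = p0") auto
  have diag: "f c c = f d d" if "c \<in> R" "d \<in> R" for c d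
  proof (cases "c = d")
    case False
    have "elem_move c d 1 f c d = 0" using st[OF reach_refl that False] off that False by blast
    then show ?thesis using off[OF reach_refl] that False by (simp add: elem_move_def)
  qed simp
  have "scalar_on R f"
    unfolding scalar_on_def
  proof (intro exI ballI)
    fix i j assume "i \<in> R" "j \<in> R"
    then show "f i j = (if i = j then f q0 q0 else 0)" 
      using off[OF reach_refl, of i j] diag[of i q0] R(1) by auto
  qed
  with ns show False by blast
qed

lemma sim_clear_column:
  assumes Q: "Q \<subseteq> {..<N}" "q0 \<in> Q" and p0: "p0 < N" "p0 \<notin> Q" and ne: "f q0 p0 \<noteq> 0"
  shows "\<exists>g. sim N f g \<and> g q0 p0 \<noteq> 0 \<and> (\<forall>q \<in> Q - {q0}. g q p0 = 0)"
proof -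
  define v where "v q = (if q \<in> Q - {q0} then - f q p0 / f q0 p0 else 0)" for q
  have "sim N f (column_move N q0 v f)" by (rule sim_column_move) (use Q in \<open>auto simp: v_def\<close>)
  moreover have "p0 \<noteq> q0" using Q p0 by auto
  then have "column_move N q0 v f q0 p0 \<noteq> 0" "\<forall>q \<in> Q - {q0}. column_move N q0 v f q p0 = 0"
    using ne by (auto simp: column_move_def v_def)
  ultimately show ?thesis by blast
qed

text \<open>Each row cleared costs one column, the pivot, so that at least \<^term>\<open>N - 2 * card Q\<close>
  columns remain on which the rows in \<^term>\<open>Q\<close> are controlled.\<close>

lemma sim_clear_rows:
  assumes Q: "Q \<subseteq> {..<N}" "q0 \<in> Q" and p0: "p0 < N" "p0 \<notin> Q" and ne: "f q0 p0 \<noteq> 0"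
    and col: "\<And>q. q \<in> Q - {q0} \<Longrightarrow> f q p0 = 0" and Q': "Q' \<subseteq> Q - {q0}"
  shows "\<exists>g A. sim N f g \<and> A \<subseteq> {..<N} - Q - {p0} \<and> N \<le> card A + card Q + 1 + card Q' \<and>
    g q0 p0 \<noteq> 0 \<and> (\<forall>q \<in> Q - {q0}. g q p0 = 0) \<and> (\<forall>q\<in>Q'. \<forall>x\<in>A. g q x = 0)"
proof -
  have "finite Q'" using finite_subset[of Q' "{..<N}"] Q(1) Q' by auto
  then show ?thesis using Q'
  proof (induct rule: finite_induct)
    case empty
    have "card ({..<N} - Q - {p0}) = N - card Q - 1"
      using Q(1) p0 finite_subset[OF Q(1)] by (simp add: card_Diff_subset)
    then have "N \<le> card ({..<N} - Q - {p0}) + card Q + 1 + card {}" by simp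
    moreover have "\<forall>q \<in> Q - {q0}. f q p0 = 0" using col by blast
    ultimately show ?case using ne sim_refl[of N f] by blast
  next
    case (insert q Q')
    from insert(3,4) obtain g A where g: "sim N f g" and A: "A \<subseteq> {..<N} - Q - {p0}"
      and cd: "N \<le> card A + card Q + 1 + card Q'" and gp: "g q0 p0 \<noteq> 0"
      and gc: "\<And>q. q \<in> Q - {q0} \<Longrightarrow> g q p0 = 0" and gr: "\<And>q x. q \<in> Q' \<Longrightarrow> x \<in> A \<Longrightarrow> g q x = 0"
      by auto
    have ci: "card (insert q Q') = Suc (card Q')" using insert by simp
    show ?case
    proof (cases "\<forall>x\<in>A. g q x = 0")
      case True
      then show ?thesis using g A cd gp gc gr ci
        by (intro exI[of _ g] exI[of _ A]) auto
    next
      case False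
      then obtain c where c: "c \<in> A" "g q c \<noteq> 0" by auto
      \<comment> \<open>Column \<open>c\<close> is the pivot for row \<open>q\<close>. The side
        effect of the move falls on row \<open>c\<close>, which lies outside \<open>Q\<close>; rows
        cleared earlier vanish at \<open>c\<close> and do not change on \<open>A\<close>.\<close>
      define \<tau> where "\<tau> x = (if x \<in> A - {c} then g q x / g q c else 0)" for x
      let ?h = "row_move N c \<tau> g"
      have "sim N g ?h" by (rule sim_row_move) (use c A in \<open>auto simp: \<tau>_def\<close>)
      then have s: "sim N f ?h" using g sim_trans by blast
      have h: "?h i j = g i j - g i c * \<tau> j" if "i \<noteq> c" for i j
        using that by (simp add: row_move_def)
      have cQ: "c \<notin> Q" "q0 \<noteq> c" using c A Q by auto
      have p\<tau>: "\<tau> p0 = 0" using A by (auto simp: \<tau>_def)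
      have fA: "finite A" using finite_subset[of A "{..<N}"] A by auto
      have "card A = Suc (card (A - {c}))" using c(1) fA by (metis card_Suc_Diff1)
      then have "N \<le> card (A - {c}) + card Q + 1 + card (insert q Q')" using cd ci by simp
      moreover have "?h r p0 = g r p0" if "r \<in> Q" for r
        using that cQ p\<tau> by (subst h) auto
      moreover have "?h r x = 0" if "r \<in> insert q Q'" "x \<in> A - {c}" for r x
      proof -
        have "r \<noteq> c" using that insert(4) cQ by auto
        moreover have "r = q \<or> (g r x = 0 \<and> g r c = 0)" using that gr c by auto
        ultimately show ?thesis using that c by (auto simp: h \<tau>_def)
      qed
      ultimately show ?thesis using s A gp gc Q(2)
        by (intro exI[of _ ?h] exI[of _ "A - {c}"]) auto
    qed
  qed
qed

text \<open>A nonzero entry is created at \<open>(q0, p0)\<close>, the rest of column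
  \<open>p0\<close> is cleared in the rows \<open>Q\<close>, and then all rows of \<open>Q\<close>
  but \<open>q0\<close> are cleared on \<open>A\<close>. Subtracting multiples of column
  \<open>p0\<close> now affects only row \<open>q0\<close> among the rows \<open>Q\<close> and
  writes \<open>\<beta>\<close> into it. Only this last move depends on \<open>\<beta>\<close>, so
  \<open>A\<close> is fixed in advance. The columns lost are those in \<open>Q\<close>,
  \<open>p0\<close> and at most \<open>card Q - 1\<close> pivots.\<close>

lemma sim_control_rows:
  assumes Q: "Q \<subseteq> {..<N}" "q0 \<in> Q" "card Q + 2 \<le> N" and ns: "\<not> scalar_on {..<N} f"
  shows "\<exists>A. A \<subseteq> {..<N} - Q \<and> N \<le> card A + 2 * card Q \<and>
    (\<forall>\<beta>. \<exists>h. sim N f h \<and> (\<forall>x\<in>A. h q0 x = \<beta> x \<and> (\<forall>q \<in> Q - {q0}. h q x = 0)))"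
proof -
  have fQ: "finite Q" using finite_subset[of Q "{..<N}"] Q(1) by auto
  have "card ({..<N} - Q) \<ge> 2" using Q fQ by (simp add: card_Diff_subset)
  then obtain T where T: "T \<subseteq> {..<N} - Q" "card T = 2" by (meson obtain_subset_with_card_n)
  from T(2) obtain p0 s where ps: "T = {p0, s}" "p0 \<noteq> s" by (auto simp: card_2_iff)
  obtain g1 where g1: "reach {..<N} f g1" "g1 q0 p0 \<noteq> 0"
    using reach_offdiag[of q0 "{..<N}" p0 s f] ns Q T ps by auto
  then have s1: "sim N f g1" by (intro reach_sim) auto
  have p0: "p0 < N" "p0 \<notin> Q" using T ps by auto
  obtain g2 where s2: "sim N g1 g2" and g2: "g2 q0 p0 \<noteq> 0" "\<And>q. q \<in> Q - {q0} \<Longrightarrow> g2 q p0 = 0"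
    using sim_clear_column[where f = g1, OF Q(1,2) p0 g1(2)] by auto
  obtain g A where s3: "sim N g2 g" and A: "A \<subseteq> {..<N} - Q - {p0}"
    and cd: "N \<le> card A + card Q + 1 + card (Q - {q0})" and gp: "g q0 p0 \<noteq> 0"
    and gc: "\<And>q. q \<in> Q - {q0} \<Longrightarrow> g q p0 = 0" and gr: "\<And>q x. q \<in> Q - {q0} \<Longrightarrow> x \<in> A \<Longrightarrow> g q x = 0"
    using sim_clear_rows[where f = g2, OF Q(1,2) p0 g2 order_refl] by auto
  have s: "sim N f g" using s1 s2 s3 sim_trans by blast
  have "card Q = Suc (card (Q - {q0}))" using Q fQ by (metis card_Suc_Diff1)
  then have "N \<le> card A + 2 * card Q" using cd by simp
  moreover have "\<exists>h. sim N f h \<and> (\<forall>x\<in>A. h q0 x = \<beta> x \<and> (\<forall>q \<in> Q - {q0}. h q x = 0))" for \<beta>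
  proof -
    define \<tau> where "\<tau> x = (if x \<in> A then (g q0 x - \<beta> x) / g q0 p0 else 0)" for x
    let ?h = "row_move N p0 \<tau> g"
    have "sim N g ?h" by (rule sim_row_move) (use p0 A in \<open>auto simp: \<tau>_def\<close>)
    moreover have "?h i j = g i j - g i p0 * \<tau> j" if "i \<in> Q" for i j
      using that p0 by (auto simp: row_move_def)
    then have "\<forall>x\<in>A. ?h q0 x = \<beta> x \<and> (\<forall>q \<in> Q - {q0}. ?h q x = 0)"
      using Q gp gc gr by (auto simp: \<tau>_def)
    ultimately show ?thesis using s sim_trans by blast
  qed
  ultimately show ?thesis using A by (intro exI[of _ A]) auto
qed

subsection \<open>Corners of conjugates\<close>

text \<open>The inverse transpose conjugates the transposed matrix. This exchanges rows and columns,
  so that \<open>paired_unstick\<close> has to treat only the rows \<open>b\<close>.\<close>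

lemma sim_transpose:
  assumes "sim N f g"
  shows "sim N (\<lambda>i j. f j i) (\<lambda>i j. g j i)"
proof -
  from assms obtain A where A: "A \<in> carrier (SL N)" and g: "fmat N g = A * fmat N f * mat_inv A"
    unfolding sim_def by blast
  have t: "fmat N (\<lambda>i j. h j i) = (fmat N h)\<^sup>T" for h :: "nat \<Rightarrow> nat \<Rightarrow> 'a" by (rule eq_matI) auto
  let ?B = "(mat_inv A)\<^sup>T"
  have B: "?B \<in> carrier (SL N)" by (rule mat_inv_transpose_SL[OF A])
  have AT: "A\<^sup>T \<in> carrier (SL N)" using A by (auto simp: SL_simps det_transpose)
  have c: "A \<in> sqmat N" "mat_inv A \<in> sqmat N"
    using A mat_inv(1)[OF A] by (auto simp: SL_simps)
  have "?B * A\<^sup>T = (A * mat_inv A)\<^sup>T" by (rule transpose_mult[OF c, symmetric])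
  then have "?B * A\<^sup>T = 1\<^sub>m N" using mat_inv(2)[OF A] by simp
  then have i: "mat_inv ?B = A\<^sup>T" by (rule mat_inv_unique[OF B AT])
  have "(fmat N g)\<^sup>T = ?B * (A * fmat N f)\<^sup>T" unfolding g
    by (rule transpose_mult[of _ N N _ N]) (use c in auto)
  also have "(A * fmat N f)\<^sup>T = (fmat N f)\<^sup>T * A\<^sup>T"
    by (rule transpose_mult[of _ N N _ N]) (use c in auto)
  also have "?B * ((fmat N f)\<^sup>T * A\<^sup>T) = ?B * (fmat N f)\<^sup>T * A\<^sup>T"
    by (rule assoc_mult_mat[symmetric, of _ N N _ N _ N]) (use c in auto)
  finally have "(fmat N g)\<^sup>T = ?B * (fmat N f)\<^sup>T * mat_inv ?B" unfolding i .
  then show ?thesis unfolding sim_def t[of f] t[of g] using B by blast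
qed

text \<open>The rows \<^term>\<open>z\<close> and the columns \<^term>\<open>b\<close> meet in an invertible diagonal block and
  vanish on \<^term>\<open>R\<close>, so that conjugations supported on \<^term>\<open>R\<close> preserve the property.\<close>

definition paired :: "(nat \<Rightarrow> nat) \<Rightarrow> (nat \<Rightarrow> nat) \<Rightarrow> nat set \<Rightarrow> nat \<Rightarrow> (nat \<Rightarrow> nat \<Rightarrow> 'a::field) \<Rightarrow> bool" where
  "paired b z R m f \<longleftrightarrow> (\<forall>a<m. \<forall>c<m. (f (z a) (b c) = 0) = (a \<noteq> c)) \<and>
     (\<forall>a<m. \<forall>j\<in>R. f (z a) j = 0 \<and> f j (b a) = 0)"

lemma paired_transpose: "paired b z R m f \<Longrightarrow> paired z b R m (\<lambda>i j. f j i)"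
  by (auto simp: paired_def)

lemma reach_paired:
  assumes "reach R f g" "paired b z R m f"
    and nR: "\<And>a. a < m \<Longrightarrow> b a \<notin> R" "\<And>a. a < m \<Longrightarrow> z a \<notin> R"
  shows "paired b z R m g"
  using assms(1,2)
proof (induct rule: reach.induct)
  case (reach_step g p q t)
  then have g: "paired b z R m g" by blast
  have n: "b a \<noteq> p" "b a \<noteq> q" "z a \<noteq> p" "z a \<noteq> q" if "a < m" for a
    using nR[OF that] reach_step(3,4) by auto
  have "elem_move p q t g (z a) (b c) = g (z a) (b c)" if "a < m" "c < m" for a c
    using n(3)[OF that(1)] n(2)[OF that(2)] by (simp add: elem_move_def)
  moreover have "elem_move p q t g (z a) j = 0" if "a < m" "j \<in> R" for a j
    using n[OF that(1)] g that reach_step(3) by (simp add: elem_move_def paired_def)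
  moreover have "elem_move p q t g i (b a) = 0" if "a < m" "i \<in> R" for a i
    using n[OF that(1)] g that reach_step(4) by (simp add: elem_move_def paired_def)
  ultimately show ?case using g unfolding paired_def by simp
qed blast

text \<open>If the matrix is scalar on \<open>R\<close>, no new pivot can be created by moves inside
  \<open>R\<close>. A row \<open>b a\<close> that does not vanish on \<open>R\<close> still helps:
  added to row \<open>d\<close>, it leaves a nonzero entry at \<open>(d, e)\<close> and destroys
  scalarity.\<close>

lemma paired_unstick:
  fixes f :: "nat \<Rightarrow> nat \<Rightarrow> 'a::field"
  assumes p: "paired b z R m f" and sc: "scalar_on R f"
    and b: "\<And>a. a < m \<Longrightarrow> b a \<notin> R" "\<And>a. a < m \<Longrightarrow> b a < N" "inj_on b {..<m}"
    and z: "\<And>a. a < m \<Longrightarrow> z a \<notin> R" "\<And>a. a < m \<Longrightarrow> z a < N"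
    and bz: "\<And>a c. a < m \<Longrightarrow> c < m \<Longrightarrow> b a \<noteq> z c" and R: "R \<subseteq> {..<N}"
    and a: "a < m" and e: "e \<in> R" "f (b a) e \<noteq> 0" and d: "d \<in> R" "d \<noteq> e"
  shows "\<exists>g. sim N f g \<and> paired b z R m g \<and> \<not> scalar_on R g"
proof -
  from sc obtain s where s: "\<And>i j. i \<in> R \<Longrightarrow> j \<in> R \<Longrightarrow> f i j = (if i = j then s else 0)"
    unfolding scalar_on_def by blast
  \<comment> \<open>The conjugation adds row \<^term>\<open>b a\<close> to row \<^term>\<open>d\<close>; the multiples \<^term>\<open>\<kappa> c\<close> of the rows
    \<^term>\<open>z c\<close> restore the zeros in the columns \<^term>\<open>b\<close>.\<close>
  define \<kappa> where "\<kappa> c = (f (b a) (b c) - (if c = a then s + f (b a) d else 0)) / f (z c) (b c)" for c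
  define \<tau> where "\<tau> k = (if k = b a then 1 else 0) - (\<Sum>c<m. if k = z c then \<kappa> c else 0)" for k
  have \<tau>0: "\<tau> k = (if k = b a then 1 else 0)" if "\<And>c. c < m \<Longrightarrow> k \<noteq> z c" for k
    using that by (simp add: \<tau>_def)
  have \<tau>R: "\<tau> j = 0" if "j \<in> R" for j using \<tau>0[of j] that b(1)[OF a] z(1) by metis
  have \<tau>b: "\<tau> (b c) = (if c = a then 1 else 0)" if "c < m" for c
    using \<tau>0[of "b c"] bz that b(3) a by (auto simp: inj_on_def)
  have sum\<tau>: "(\<Sum>k<N. \<tau> k * h k) = h (b a) - (\<Sum>c<m. \<kappa> c * h (z c))" for h
  proof -
    have "(\<Sum>k<N. \<tau> k * h k) = (\<Sum>k<N. if k = b a then h k else 0) - (\<Sum>k<N. \<Sum>c<m. if k = z c then \<kappa> c * h k else 0)"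
      unfolding \<tau>_def left_diff_distrib sum_subtractf sum_distrib_right
      by (intro arg_cong2[of _ _ _ _ minus] sum.cong) auto
    also have "(\<Sum>k<N. \<Sum>c<m. if k = z c then \<kappa> c * h k else 0) = (\<Sum>c<m. \<Sum>k<N. if k = z c then \<kappa> c * h k else 0)"
      by (rule sum.swap)
    also have "\<dots> = (\<Sum>c<m. \<kappa> c * h (z c))" by (rule sum.cong) (use z in auto)
    finally show ?thesis using b(2)[OF a] by simp
  qed
  let ?g = "row_move N d \<tau> f"
  have sim: "sim N f ?g" by (rule sim_row_move) (use d R \<tau>R in auto)
  have g: "?g i j = f i j - f i d * \<tau> j" if "i \<noteq> d" for i j using that by (simp add: row_move_def)
  have zd: "z c \<noteq> d" if "c < m" for c using z(1)[OF that] d by auto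
  have fz: "f (z c) j = 0" "f j (b c) = 0" if "c < m" "j \<in> R" for c j using p that by (auto simp: paired_def)
  have gz: "?g (z c) j = f (z c) j" if "c < m" for c j
    using g[OF zd[OF that]] fz(1)[OF that d(1)] by simp
  \<comment> \<open>Besides row \<open>b a\<close>, row \<open>d\<close> feels that column
    \<open>d\<close> is subtracted from column \<open>b a\<close>; this is the origin of the term
    \<open>s + f (b a) d\<close> in \<open>\<kappa> a\<close>.\<close>
  have gd: "?g d j = f d j - s * \<tau> j + (f (b a) j - (\<Sum>c<m. \<kappa> c * f (z c) j)) - \<tau> j * f (b a) d" for j
  proof -
    have "(\<Sum>c<m. \<kappa> c * f (z c) d) = 0" using fz d by simp
    then show ?thesis using s[OF d(1) d(1)] by (simp add: row_move_def sum\<tau>)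
  qed
  have "?g d (b c) = 0" if c: "c < m" for c
  proof -
    have fd: "f d (b c) = 0" by (rule fz(2)[OF c d(1)])
    have "f (z c') (b c) = 0" if "c' < m" "c' \<noteq> c" for c'
      using p that c by (auto simp: paired_def)
    then have "(\<Sum>c'<m. \<kappa> c' * f (z c') (b c)) = (\<Sum>c'<m. if c' = c then \<kappa> c' * f (z c') (b c) else 0)"
      by (intro sum.cong) simp_all
    also have "\<dots> = \<kappa> c * f (z c) (b c)" using c by simp
    also have "\<dots> = f (b a) (b c) - (if c = a then s + f (b a) d else 0)"
      using p c by (simp add: \<kappa>_def paired_def)
    finally show ?thesis unfolding gd \<tau>b[OF c] fd by simp
  qed
  moreover have "?g i (b c) = 0" if "i \<in> R" "i \<noteq> d" "c < m" for i c
    using g[OF that(2)] fz(2)[OF that(3,1)] s[OF that(1) d(1)] that(2) by simp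
  ultimately have "?g i (b c) = 0" if "i \<in> R" "c < m" for i c using that by blast
  then have "paired b z R m ?g" using p gz unfolding paired_def by simp
  moreover have "(\<Sum>c<m. \<kappa> c * f (z c) e) = 0" using fz e by simp
  then have "?g d e \<noteq> 0" unfolding gd using s[OF d(1) e(1)] d(2) \<tau>R[OF e(1)] e(2) by simp
  then have "\<not> scalar_on R ?g" using d e by (auto simp: scalar_on_def)
  ultimately show ?thesis using sim by blast
qed

text \<open>Elimination around a new pivot at \<open>(z m, b m)\<close>: column \<open>b m\<close>
  clears row \<open>z m\<close> on \<open>R'\<close>, and row \<open>z m\<close> clears column
  \<open>b m\<close> on \<open>R'\<close>. The side effects hit row \<open>b m\<close> and column
  \<open>z m\<close>; both indices leave \<open>R\<close>, and pairing speaks only of rows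
  \<open>z\<close> and columns \<open>b\<close>.\<close>

lemma paired_extend:
  fixes f :: "nat \<Rightarrow> nat \<Rightarrow> 'a::field"
  assumes p: "paired b z R m f" and ns: "\<not> scalar_on R f"
    and b: "\<And>a. a < m \<Longrightarrow> b a \<notin> R" and z: "\<And>a. a < m \<Longrightarrow> z a \<notin> R"
    and bz: "\<And>a. a < m \<Longrightarrow> b a \<noteq> z m" and R: "R \<subseteq> {..<N}"
    and new: "b m \<in> R" "z m \<in> R" "b m \<noteq> z m" and R': "R' = R - {b m, z m}" "R' \<noteq> {}"
  shows "\<exists>g. sim N f g \<and> paired b z R' (Suc m) g"
proof -
  obtain s where s: "s \<in> R'" using R' by blast
  obtain g where rg: "reach R f g" and g0: "g (z m) (b m) \<noteq> 0"
    using reach_offdiag[of "z m" R "b m" s f] new s R' ns by auto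
  have pg: "paired b z R m g" by (rule reach_paired[OF rg p b z])
  have s1: "sim N f g" by (rule reach_sim[OF rg R])
  define \<tau> where "\<tau> j = (if j \<in> R' then g (z m) j / g (z m) (b m) else 0)" for j
  let ?g = "row_move N (b m) \<tau> g"
  have s2: "sim N g ?g" by (rule sim_row_move) (use new R R' in \<open>auto simp: \<tau>_def\<close>)
  have h: "?g i j = g i j - g i (b m) * \<tau> j" if "i \<noteq> b m" for i j using that by (simp add: row_move_def)
  have nR': "b a \<notin> R'" "z a \<notin> R'" if "a < Suc m" for a using that b z R' by (auto simp: less_Suc_eq)
  have \<tau>b: "\<tau> (b a) = 0" if "a < Suc m" for a using nR'[OF that] by (simp add: \<tau>_def)
  have zb: "z a \<noteq> b m" if "a < Suc m" for a using that z[of a] new by (cases "a = m") auto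
  have old: "g (z a) (b c) = 0 \<longleftrightarrow> a \<noteq> c" if "a < Suc m" "c < Suc m" for a c
    using pg g0 new that by (auto simp: paired_def less_Suc_eq)
  have hzb: "?g (z a) (b c) = g (z a) (b c)" if "a < Suc m" "c < Suc m" for a c
    using h[OF zb[OF that(1)]] \<tau>b[OF that(2)] by simp
  have hzR: "?g (z a) j = 0" if "a < Suc m" "j \<in> R'" for a j
  proof (cases "a = m")
    case True then show ?thesis using that g0 h[of "z m" j] new by (simp add: \<tau>_def)
  next
    case False
    then have "a < m" using that by simp
    then have "g (z a) j = 0" "g (z a) (b m) = 0" using pg that new R' by (auto simp: paired_def)
    then show ?thesis by (simp add: h[OF zb[OF that(1)]])
  qed
  have hRb: "?g i (b a) = g i (b a)" if "i \<in> R'" "a < Suc m" for i a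
    using that \<tau>b[OF that(2)] R' by (subst h) auto
  define v where "v i = (if i \<in> R' then - g i (b m) / g (z m) (b m) else 0)" for i
  let ?h = "column_move N (z m) v ?g"
  have s3: "sim N ?g ?h" by (rule sim_column_move) (use new R R' in \<open>auto simp: v_def\<close>)
  have k: "?h i j = ?g i j + v i * ?g (z m) j" if "j \<noteq> z m" for i j using that by (simp add: column_move_def)
  have bzm: "b a \<noteq> z m" if "a < Suc m" for a using that bz new by (auto simp: less_Suc_eq)
  have vz: "v (z a) = 0" if "a < Suc m" for a using nR'[OF that] by (simp add: v_def)
  have "?h (z a) (b c) = g (z a) (b c)" if "a < Suc m" "c < Suc m" for a c
    using k[OF bzm[OF that(2)], of "z a"] vz[OF that(1)] hzb[OF that] by simp
  moreover have "?h (z a) j = 0" if "a < Suc m" "j \<in> R'" for a j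
    using k[of j "z a"] vz[OF that(1)] hzR[OF that] that R' by auto
  moreover have "?h i (b a) = 0" if "i \<in> R'" "a < Suc m" for i a
  proof (cases "a = m")
    case True
    then show ?thesis using that g0 hRb[OF that] hzb[of m m] k[of "b m" i] new by (simp add: v_def)
  next
    case False
    then have "a < m" using that by simp
    then have "g i (b a) = 0" "g (z m) (b a) = 0" using pg that new R' by (auto simp: paired_def)
    then show ?thesis using hRb[OF that] hzb[of m a] that by (simp add: k[OF bzm[OF that(2)]])
  qed
  ultimately have "paired b z R' (Suc m) ?h" using old unfolding paired_def by simp
  moreover have "sim N f ?h" using s1 s2 s3 sim_trans by blast
  ultimately show ?thesis by blast
qed


text \<open>The corner takes \<open>n\<close> indices and the pairs take the next
  \<open>2 * n\<close>. A new pair is obtained at once if the matrix is not scalar on the remaining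
  set \<open>R\<close>, and after unsticking if some row \<open>b a\<close> or, by transposition,
  some column \<open>z a\<close> is nonzero on \<open>R\<close>. If neither happens, the rows
  \<open>z\<close> and columns \<open>b\<close> vanish on \<open>R\<close> by pairing and the rows
  \<open>b\<close> and columns \<open>z\<close> by assumption; as every index outside
  \<open>R\<close> is a \<open>b\<close> or a \<open>z\<close>, the border of the corner is
  scalar.\<close>

lemma paired_or_scalar_border:
  fixes f :: "nat \<Rightarrow> nat \<Rightarrow> 'a::field"
  assumes n: "1 \<le> n" "3 * n + 3 \<le> N" and m: "m \<le> n"
  shows "\<exists>g. sim N f g \<and> (paired (\<lambda>a. n + 2 * a) (\<lambda>a. n + 2 * a + 1) ({..<n} \<union> {n + 2 * m..<N}) m g \<or>
    (\<exists>c. \<forall>i<N. \<forall>j<N. i < n \<or> j < n \<longrightarrow> g i j = (if i = j then c else 0)))"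
  using m
proof (induct m)
  case 0
  have "paired (\<lambda>a. n + 2 * a) (\<lambda>a. n + 2 * a + 1) ({..<n} \<union> {n + 2 * 0..<N}) 0 f" by (simp add: paired_def)
  then show ?case using sim_refl by blast
next
  case (Suc m)
  let ?b = "\<lambda>a. n + 2 * a" let ?z = "\<lambda>a. n + 2 * a + 1"
  let ?R = "{..<n} \<union> {n + 2 * m..<N}" let ?R' = "{..<n} \<union> {n + 2 * Suc m..<N}"
  from Suc obtain g where s: "sim N f g" and g: "paired ?b ?z ?R m g \<or>
    (\<exists>c. \<forall>i<N. \<forall>j<N. i < n \<or> j < n \<longrightarrow> g i j = (if i = j then c else 0))" by auto
  have ext: ?case if s': "sim N f h" and p: "paired ?b ?z ?R m h" and ns: "\<not> scalar_on ?R h" for h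
  proof -
    have "\<exists>k. sim N h k \<and> paired ?b ?z ?R' (Suc m) k"
    proof (rule paired_extend[OF p ns])
      show "?R' = ?R - {?b m, ?z m}" by auto
      show "?R' \<noteq> {}" using n by (auto simp: lessThan_empty_iff)
    qed (use n Suc(2) in auto)
    then show ?case using s' sim_trans by blast
  qed
  show ?case
  proof (cases "paired ?b ?z ?R m g")
    case False
    then show ?thesis using s g by blast
  next
    case p: True
    show ?thesis
    proof (cases "scalar_on ?R g")
      case False then show ?thesis using ext[OF s p] by blast
    next
      case sc: True
      have other: "\<exists>d\<in>?R. d \<noteq> e" for e
      proof -
        have "n + 2 * m \<in> ?R" "n + 2 * m + 1 \<in> ?R" using n Suc(2) by auto
        moreover have "n + 2 * m \<noteq> e \<or> n + 2 * m + 1 \<noteq> e" by auto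
        ultimately show ?thesis by metis
      qed
      have RN: "?R \<subseteq> {..<N}" using n by auto
      show ?thesis
      proof (cases "\<exists>a<m. \<exists>e\<in>?R. g (?b a) e \<noteq> 0")
        case True
        then obtain a e where ae: "a < m" "e \<in> ?R" "g (?b a) e \<noteq> 0" by blast
        obtain d where d: "d \<in> ?R" "d \<noteq> e" using other by blast
        have "\<exists>h. sim N g h \<and> paired ?b ?z ?R m h \<and> \<not> scalar_on ?R h"
          by (rule paired_unstick[OF p sc _ _ _ _ _ _ RN ae d])
            (use n Suc(2) in \<open>auto simp: inj_on_def, presburger?\<close>)
        then show ?thesis using s sim_trans ext by blast
      next
        case F1: False
        show ?thesis
        proof (cases "\<exists>a<m. \<exists>e\<in>?R. g e (?z a) \<noteq> 0")
          case True
          then obtain a e where ae: "a < m" "e \<in> ?R" "g e (?z a) \<noteq> 0" by blast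
          obtain d where d: "d \<in> ?R" "d \<noteq> e" using other by blast
          have sc': "scalar_on ?R (\<lambda>i j. g j i)" using sc unfolding scalar_on_def by metis
          have "\<exists>h. sim N (\<lambda>i j. g j i) h \<and> paired ?z ?b ?R m h \<and> \<not> scalar_on ?R h"
            by (rule paired_unstick[OF paired_transpose[OF p] sc' _ _ _ _ _ _ RN ae d])
              (use n Suc(2) in \<open>auto simp: inj_on_def, presburger?\<close>)
          then obtain h where h: "sim N (\<lambda>i j. g j i) h" "paired ?z ?b ?R m h" "\<not> scalar_on ?R h" by blast
          have "\<not> scalar_on ?R (\<lambda>i j. h j i)" using h(3) unfolding scalar_on_def by metis
          then show ?thesis using s sim_trans ext sim_transpose[OF h(1)] paired_transpose[OF h(2)] by blast
        next
          case F2: False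
          from sc obtain c where c: "\<And>i j. i \<in> ?R \<Longrightarrow> j \<in> ?R \<Longrightarrow> g i j = (if i = j then c else 0)"
            unfolding scalar_on_def by blast
          have split: "i \<in> ?R \<or> (\<exists>a<m. i = ?b a) \<or> (\<exists>a<m. i = ?z a)" if "i < N" for i
          proof (cases "i \<in> ?R")
            case False
            then have "n \<le> i" "i < n + 2 * m" using that by auto
            then have "(i - n) div 2 < m" "i = ?b ((i - n) div 2) \<or> i = ?z ((i - n) div 2)" by presburger+
            then show ?thesis by blast
          qed simp
          have pz: "g (?z a) j = 0" "g j (?b a) = 0" if "a < m" "j \<in> ?R" for a j
            using p that unfolding paired_def by blast+
          have row: "g i j = 0" if "i \<in> ?R" "j \<notin> ?R" "j < N" for i j
            using split[OF that(3)] that F2 pz(2) by blast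
          have col: "g i j = 0" if "i \<notin> ?R" "j \<in> ?R" "i < N" for i j
            using split[OF that(3)] that F1 pz(1) by blast
          have "g i j = (if i = j then c else 0)" if "i < N" "j < N" "i < n \<or> j < n" for i j
          proof (cases "i \<in> ?R \<and> j \<in> ?R")
            case False
            moreover have "i \<in> ?R \<or> j \<in> ?R" using that by auto
            ultimately show ?thesis using row col that by (cases "i = j") auto
          qed (use c in blast)
          then show ?thesis using s by blast
        qed
      qed
    qed
  qed
qed

text \<open>The invertible diagonal block in rows \<open>z\<close> and columns \<open>b\<close>
  first writes the identity into the rows \<open>z\<close> over the corner columns. Row
  \<open>z k\<close> is then a unit vector there, and adding its multiples to the corner rows
  prescribes column \<open>k\<close> of the corner. The side effects hit rows \<open>b k\<close> and
  columns \<open>z k\<close>, away from what has been arranged.\<close>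

lemma paired_corner:
  fixes f :: "nat \<Rightarrow> nat \<Rightarrow> 'a::field"
  assumes p: "paired b z R n f" and R: "{..<n} \<subseteq> R"
    and b: "\<And>a. a < n \<Longrightarrow> b a < N" "\<And>a. a < n \<Longrightarrow> n \<le> b a"
    and z: "\<And>a. a < n \<Longrightarrow> z a < N" "\<And>a. a < n \<Longrightarrow> n \<le> z a"
    and bz: "\<And>a c. a < n \<Longrightarrow> c < n \<Longrightarrow> b a \<noteq> z c"
  shows "\<exists>h. sim N f h \<and> (\<forall>i<n. \<forall>j<n. h i j = M i j)"
proof -
  have "\<exists>h. sim N f h \<and> (\<forall>a<n. \<forall>c<n. (h (z a) (b c) = 0) = (a \<noteq> c)) \<and>
     (\<forall>a<n. \<forall>j<n. h (z a) j = (if a = j \<and> a < k then 1 else 0))" if "k \<le> n" for k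
    using that
  proof (induct k)
    case 0
    have "f (z a) j = 0" if "a < n" "j < n" for a j using p R that unfolding paired_def by blast
    moreover have "\<forall>a<n. \<forall>c<n. (f (z a) (b c) = 0) = (a \<noteq> c)" using p unfolding paired_def by blast
    ultimately show ?case using sim_refl[of N f] by (intro exI[of _ f]) simp
  next
    case (Suc k)
    then obtain h where s: "sim N f h" and hb: "\<And>a c. a < n \<Longrightarrow> c < n \<Longrightarrow> (h (z a) (b c) = 0) = (a \<noteq> c)"
      and hj: "\<And>a j. a < n \<Longrightarrow> j < n \<Longrightarrow> h (z a) j = (if a = j \<and> a < k then 1 else 0)" by auto
    have k: "k < n" using Suc by simp
    define \<tau> where "\<tau> j = (if j = k then - 1 / h (z k) (b k) else 0)" for j
    let ?g = "row_move N (b k) \<tau> h"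
    have "sim N h ?g" by (rule sim_row_move) (use b[OF k] k in \<open>auto simp: \<tau>_def\<close>)
    then have "sim N f ?g" using s sim_trans by blast
    moreover have g: "?g (z a) j = h (z a) j - h (z a) (b k) * \<tau> j" if "a < n" for a j
      using bz[OF k that] by (simp add: row_move_def)
    have "(?g (z a) (b c) = 0) = (a \<noteq> c)" if "a < n" "c < n" for a c
      using b(2)[OF that(2)] k hb[OF that] by (simp add: g[OF that(1)] \<tau>_def)
    moreover have "?g (z a) j = (if a = j \<and> a < Suc k then 1 else 0)" if "a < n" "j < n" for a j
      using hj[OF that] hb[OF that(1) k] hb[OF k k] by (auto simp: g[OF that(1)] \<tau>_def)
    ultimately show ?case by (intro exI[of _ ?g]) auto
  qed
  from this[OF order_refl] obtain f1 where s1: "sim N f f1"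
    and f1: "\<And>a j. a < n \<Longrightarrow> j < n \<Longrightarrow> f1 (z a) j = (if a = j then 1 else 0)" by auto
  have "\<exists>h. sim N f h \<and> (\<forall>a<n. \<forall>j<n. h (z a) j = (if a = j then 1 else 0)) \<and>
     (\<forall>i<n. \<forall>j<k. h i j = M i j)" if "k \<le> n" for k
    using that
  proof (induct k)
    case 0 show ?case using s1 f1 by (intro exI[of _ f1]) simp
  next
    case (Suc k)
    then obtain h where s: "sim N f h" and hj: "\<And>a j. a < n \<Longrightarrow> j < n \<Longrightarrow> h (z a) j = (if a = j then 1 else 0)"
      and hM: "\<And>i j. i < n \<Longrightarrow> j < k \<Longrightarrow> h i j = M i j" by auto
    have k: "k < n" using Suc by simp
    define v where "v i = (if i < n then M i k - h i k else 0)" for i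
    let ?g = "column_move N (z k) v h"
    have "sim N h ?g" by (rule sim_column_move) (use z[OF k] k in \<open>auto simp: v_def\<close>)
    then have "sim N f ?g" using s sim_trans by blast
    moreover have g: "?g i j = h i j + v i * (if k = j then 1 else 0)" if "j < n" for i j
      using z(2)[OF k] that hj[OF k that] by (simp add: column_move_def)
    have "?g (z a) j = (if a = j then 1 else 0)" if "a < n" "j < n" for a j
      using z(2)[OF that(1)] hj[OF that] by (simp add: g[OF that(2)] v_def)
    moreover have "?g i j = M i j" if "i < n" "j < Suc k" for i j
      using that k hM[of i j] by (cases "j = k") (auto simp: g v_def)
    ultimately show ?case by (intro exI[of _ ?g]) auto
  qed
  from this[OF order_refl] show ?thesis by auto
qed

text \<open>In block form \<open>F\<close> is \<open>diag(0, G)\<close>. A lower unipotent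
  conjugation puts \<open>G Y\<close> below the corner, and an upper unipotent one then adds
  \<open>X\<close> times it to the corner; both square to nothing there because the border
  vanishes.\<close>

lemma zero_border_corner:
  fixes F X Y :: "nat \<Rightarrow> nat \<Rightarrow> 'a::field"
  assumes n: "n \<le> N" and F: "\<And>i j. i < N \<Longrightarrow> j < N \<Longrightarrow> i < n \<or> j < n \<Longrightarrow> F i j = 0"
  shows "\<exists>h. sim N F h \<and> (\<forall>i<n. \<forall>j<n. h i j = (\<Sum>k<N. X i k * (\<Sum>l<N. F k l * Y l j)))"
proof -
  define W where "W i j = (\<Sum>l<N. F i l * Y l j)" for i j
  have W0: "W i j = 0" if "i < n" for i j
    unfolding W_def by (rule sum.neutral) (use that n F in auto)
  have "\<exists>h. sim N F h \<and> (\<forall>i<N. \<forall>j<N. h i j = F i j + (if j < k then W i j else 0))" if "k \<le> n" for k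
    using that
  proof (induct k)
    case 0 show ?case using sim_refl by (intro exI[of _ F]) simp
  next
    case (Suc k)
    then obtain h where s: "sim N F h" and h: "\<And>i j. i < N \<Longrightarrow> j < N \<Longrightarrow> h i j = F i j + (if j < k then W i j else 0)"
      by auto
    have k: "k < n" "k < N" using Suc n by auto
    define v where "v i = (if i < n then 0 else - Y i k)" for i
    let ?g = "column_move N k v h"
    have "sim N h ?g" by (rule sim_column_move) (use k in \<open>auto simp: v_def\<close>)
    then have "sim N F ?g" using s sim_trans by blast
    moreover have "?g i j = F i j + (if j < Suc k then W i j else 0)" if ij: "i < N" "j < N" for i j
    proof -
      have hk: "h k l = 0" if "l < N" for l using h[OF k(2) that] F[OF k(2) that] W0[OF k(1)] k by simp
      have "(\<Sum>l<N. h i l * v l) = (\<Sum>l<N. - (F i l * Y l k))"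
        by (rule sum.cong) (use k ij F h in \<open>auto simp: v_def\<close>)
      then have "(\<Sum>l<N. h i l * v l) = - W i k" by (simp add: W_def sum_negf)
      moreover have "(\<Sum>l<N. h k l * v l) = 0" by (rule sum.neutral) (use hk in auto)
      moreover have "h i j = F i j + (if j < k then W i j else 0)" by (rule h[OF ij])
      ultimately show ?thesis using hk[OF ij(2)] by (auto simp: column_move_def less_Suc_eq)
    qed
    ultimately show ?case by blast
  qed
  from this[OF order_refl] obtain f1 where s1: "sim N F f1"
    and f1: "\<And>i j. i < N \<Longrightarrow> j < N \<Longrightarrow> f1 i j = F i j + (if j < n then W i j else 0)" by auto
  have "\<exists>h. sim N F h \<and> (\<forall>i<N. \<forall>j<n. h i j = W i j + (if i < m then \<Sum>k<N. X i k * W k j else 0))" if "m \<le> n" for m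
    using that
  proof (induct m)
    case 0 show ?case using s1 f1 F n by (intro exI[of _ f1]) simp
  next
    case (Suc m)
    then obtain h where s: "sim N F h" and h: "\<And>i j. i < N \<Longrightarrow> j < n \<Longrightarrow> h i j = W i j + (if i < m then \<Sum>k<N. X i k * W k j else 0)"
      by auto
    have m: "m < n" "m < N" using Suc n by auto
    define \<tau> where "\<tau> j = (if j < n then 0 else X m j)" for j
    let ?g = "row_move N m \<tau> h"
    have "sim N h ?g" by (rule sim_row_move) (use m in \<open>auto simp: \<tau>_def\<close>)
    then have "sim N F ?g" using s sim_trans by blast
    moreover have "?g i j = W i j + (if i < Suc m then \<Sum>k<N. X i k * W k j else 0)" if ij: "i < N" "j < n" for i j
    proof -
      have "(\<Sum>k<N. \<tau> k * h k j) = (\<Sum>k<N. X m k * W k j)"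
        by (rule sum.cong) (use m ij h W0 in \<open>auto simp: \<tau>_def\<close>)
      moreover have "\<tau> j = 0" using ij by (simp add: \<tau>_def)
      moreover note h[OF ij]
      ultimately show ?thesis by (auto simp: row_move_def less_Suc_eq)
    qed
    ultimately show ?case by blast
  qed
  from this[OF order_refl] obtain f2 where "sim N F f2"
    "\<And>i j. i < N \<Longrightarrow> j < n \<Longrightarrow> f2 i j = W i j + (if i < n then \<Sum>k<N. X i k * W k j else 0)" by auto
  then show ?thesis using W0 n by (intro exI[of _ f2]) (auto simp: W_def)
qed

lemma sim_sym: assumes "sim N f g" shows "sim N g f"
proof -
  from assms obtain A where A: "A \<in> carrier (SL N)" and g: "fmat N g = A * fmat N f * mat_inv A"
    unfolding sim_def by blast
  note iA = mat_inv[OF A]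
  have c: "A \<in> sqmat N" "mat_inv A \<in> sqmat N" using A iA(1) by (auto simp: SL_simps)
  have ii: "mat_inv (mat_inv A) = A" by (rule mat_inv_unique[OF iA(1) A iA(3)])
  have "mat_inv A * fmat N g * A = mat_inv A * (A * fmat N f * mat_inv A * A)"
    unfolding g by (rule assoc_mult_mat[of _ N N _ N _ N]) (use c in auto)
  also have "A * fmat N f * mat_inv A * A = A * fmat N f * (mat_inv A * A)"
    by (rule assoc_mult_mat[of _ N N _ N _ N]) (use c in auto)
  also have "\<dots> = A * fmat N f"
    unfolding iA(3) by (rule right_mult_one_mat[of _ N N]) (use c in auto)
  also have "mat_inv A * (A * fmat N f) = mat_inv A * A * fmat N f"
    by (rule assoc_mult_mat[symmetric, of _ N N _ N _ N]) (use c in auto)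
  also have "\<dots> = fmat N f" unfolding iA(3) by (rule left_mult_one_mat[of _ N N]) simp
  finally show ?thesis unfolding sim_def using iA(1) ii by (intro bexI[of _ "mat_inv A"]) auto
qed

lemma conj_pencil:
  fixes A :: "'a::field mat"
  assumes A: "A \<in> carrier (SL m)" and P: "P \<in> sqmat m"
  shows "A * (a \<cdot>\<^sub>m P + b \<cdot>\<^sub>m 1\<^sub>m m) * mat_inv A = a \<cdot>\<^sub>m (A * P * mat_inv A) + b \<cdot>\<^sub>m 1\<^sub>m m"
proof -
  have c: "A \<in> sqmat m" "mat_inv A \<in> sqmat m" using A mat_inv(1)[OF A] by (auto simp: SL_simps)
  have "A * (a \<cdot>\<^sub>m P + b \<cdot>\<^sub>m 1\<^sub>m m) = a \<cdot>\<^sub>m (A * P) + b \<cdot>\<^sub>m A"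
    using c P by (subst mult_add_distrib_mat[of _ m m _ m]) (auto simp: mult_smult_distrib[of _ m m])
  also have "\<dots> * mat_inv A = a \<cdot>\<^sub>m (A * P * mat_inv A) + b \<cdot>\<^sub>m (A * mat_inv A)"
    using c P by (subst add_mult_distrib_mat[of _ m m]) (auto simp: mult_smult_assoc_mat[of _ m m])
  finally show ?thesis using mat_inv(2)[OF A] by simp
qed

lemma sim_shift:
  assumes "sim N f g"
  shows "sim N (\<lambda>i j. f i j + c * delta i j) (\<lambda>i j. g i j + c * delta i j)"
proof -
  have s: "fmat N (\<lambda>i j. h i j + c * delta i j) = 1 \<cdot>\<^sub>m fmat N h + c \<cdot>\<^sub>m 1\<^sub>m N" for h
    by (rule eq_matI) auto
  from assms obtain A where A: "A \<in> carrier (SL N)" and g: "fmat N g = A * fmat N f * mat_inv A"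
    unfolding sim_def by blast
  have "A * (1 \<cdot>\<^sub>m fmat N f + c \<cdot>\<^sub>m 1\<^sub>m N) * mat_inv A = 1 \<cdot>\<^sub>m fmat N g + c \<cdot>\<^sub>m 1\<^sub>m N"
    unfolding g by (rule conj_pencil[OF A]) simp
  then show ?thesis unfolding sim_def s[of f] s[of g] using A by (intro bexI[of _ A]) auto
qed

section \<open>Rank modulo the scalar matrices\<close>

abbreviation scalar_rank :: "nat \<Rightarrow> 'a::field mat \<Rightarrow> nat" where
  "scalar_rank m P \<equiv> pencil_rank m P (1\<^sub>m m)"

lemma scalar_rank_le:
  assumes "(a, b) \<noteq> (0, 0)"
  shows "scalar_rank m P \<le> rk m (a \<cdot>\<^sub>m P + b \<cdot>\<^sub>m 1\<^sub>m m)"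
  unfolding pencil_rank_def by (rule wellorder_Inf_le1) (use assms in blast)

lemma scalar_rank_attained:
  "\<exists>a b. (a, b) \<noteq> (0, 0) \<and> scalar_rank m P = rk m (a \<cdot>\<^sub>m P + b \<cdot>\<^sub>m 1\<^sub>m m)"
proof -
  let ?K = "{rk m (a \<cdot>\<^sub>m P + b \<cdot>\<^sub>m 1\<^sub>m m) | a b. (a, b) \<noteq> (0, 0)}"
  have "rk m (1 \<cdot>\<^sub>m P + 0 \<cdot>\<^sub>m 1\<^sub>m m) \<in> ?K" by (rule CollectI, rule exI[of _ 1], rule exI[of _ 0]) simp
  then have "Inf ?K \<in> ?K" by (intro Inf_nat_def1) blast
  then show ?thesis unfolding pencil_rank_def by blast
qed

lemma scalar_rank_le_rank:
  assumes P: "P \<in> sqmat m"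
  shows "scalar_rank m P \<le> rk m (P + c \<cdot>\<^sub>m 1\<^sub>m m)"
proof -
  have "1 \<cdot>\<^sub>m P = P" using P by (intro eq_matI) auto
  then show ?thesis using scalar_rank_le[of 1 c m P] by simp
qed

lemma rank_scalar:
  assumes "b \<noteq> (0::'a::field)"
  shows "m \<le> rk m (b \<cdot>\<^sub>m 1\<^sub>m m)"
proof -
  let ?k = "rk m (b \<cdot>\<^sub>m 1\<^sub>m m)"
  obtain B C where B: "B \<in> carrier_mat m ?k" and C: "C \<in> carrier_mat ?k m" and e: "b \<cdot>\<^sub>m 1\<^sub>m m = B * C"
    using rank_factorization[of "b \<cdot>\<^sub>m 1\<^sub>m m" m m] by auto
  have "(1 / b) \<cdot>\<^sub>m B * C = (1 / b) \<cdot>\<^sub>m (B * C)" using B C by (rule mult_smult_assoc_mat)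
  also have "\<dots> = 1\<^sub>m m" unfolding e[symmetric] using assms by (intro eq_matI) auto
  finally show ?thesis using B C by (intro one_mat_factor_le[of "(1 / b) \<cdot>\<^sub>m B" m ?k C]) auto
qed

text \<open>The pencil also contains the nonzero multiples of the identity, of rank
  \<open>m\<close>. Below \<open>m\<close> the minimum is therefore attained with nonzero
  coefficient of \<open>P\<close>, which can be normalised to 1.\<close>

lemma exists_scalar_shift:
  fixes P :: "'a::field mat"
  assumes P: "P \<in> sqmat m" and k: "scalar_rank m P \<le> k" "k < m"
  shows "\<exists>c. rk m (P + c \<cdot>\<^sub>m 1\<^sub>m m) \<le> k"
proof -
  obtain a b where ab: "(a, b) \<noteq> (0, 0)" and r: "rk m (a \<cdot>\<^sub>m P + b \<cdot>\<^sub>m 1\<^sub>m m) \<le> k"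
    using scalar_rank_attained[of m P] k by metis
  have "a \<noteq> 0"
  proof
    assume "a = 0"
    then have "b \<noteq> 0" "a \<cdot>\<^sub>m P + b \<cdot>\<^sub>m 1\<^sub>m m = b \<cdot>\<^sub>m 1\<^sub>m m" using ab P by (auto intro!: eq_matI)
    then show False using rank_scalar[of b m] r k by simp
  qed
  let ?Q = "a \<cdot>\<^sub>m P + b \<cdot>\<^sub>m 1\<^sub>m m"
  have Q: "?Q \<in> sqmat m" using P by simp
  have "((1 / a) \<cdot>\<^sub>m 1\<^sub>m m) * ?Q * 1\<^sub>m m = (1 / a) \<cdot>\<^sub>m ?Q"
    using Q by (simp add: mult_smult_assoc_mat[OF one_carrier_mat Q] right_mult_one_mat[of _ m m] left_mult_one_mat[of _ m m])
  also have "\<dots> = P + (b / a) \<cdot>\<^sub>m 1\<^sub>m m" using P \<open>a \<noteq> 0\<close> by (intro eq_matI) (auto simp: field_simps)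
  finally have "rk m (P + (b / a) \<cdot>\<^sub>m 1\<^sub>m m) \<le> rk m ?Q"
    using rank_mult_mult_le[of "(1 / a) \<cdot>\<^sub>m 1\<^sub>m m" m m ?Q m "1\<^sub>m m" m] Q by simp
  then show ?thesis using r by (intro exI[of _ "b / a"]) simp
qed

lemma scalar_rank_shift:
  assumes P: "P \<in> sqmat m"
  shows "scalar_rank m (P + c \<cdot>\<^sub>m 1\<^sub>m m) \<le> scalar_rank m P"
proof -
  obtain a b where ab: "(a, b) \<noteq> (0, 0)" "scalar_rank m P = rk m (a \<cdot>\<^sub>m P + b \<cdot>\<^sub>m 1\<^sub>m m)"
    using scalar_rank_attained by blast
  have "a \<cdot>\<^sub>m P + b \<cdot>\<^sub>m 1\<^sub>m m = a \<cdot>\<^sub>m (P + c \<cdot>\<^sub>m 1\<^sub>m m) + (b - a * c) \<cdot>\<^sub>m 1\<^sub>m m"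
    using P by (intro eq_matI) (auto simp: algebra_simps)
  then show ?thesis using scalar_rank_le[of a "b - a * c" m "P + c \<cdot>\<^sub>m 1\<^sub>m m"] ab by auto
qed

lemma scalar_rank_conj:
  assumes A: "A \<in> carrier (SL m)" and P: "P \<in> sqmat m"
  shows "scalar_rank m (A * P * mat_inv A) \<le> scalar_rank m P"
proof -
  obtain a b where ab: "(a, b) \<noteq> (0, 0)" "scalar_rank m P = rk m (a \<cdot>\<^sub>m P + b \<cdot>\<^sub>m 1\<^sub>m m)"
    using scalar_rank_attained by blast
  have c: "A \<in> sqmat m" "mat_inv A \<in> sqmat m" using A mat_inv(1)[OF A] by (auto simp: SL_simps)
  have "scalar_rank m (A * P * mat_inv A) \<le> rk m (A * (a \<cdot>\<^sub>m P + b \<cdot>\<^sub>m 1\<^sub>m m) * mat_inv A)"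
    unfolding conj_pencil[OF A P] by (rule scalar_rank_le[OF ab(1)])
  also have "\<dots> \<le> rk m (a \<cdot>\<^sub>m P + b \<cdot>\<^sub>m 1\<^sub>m m)"
    by (rule rank_mult_mult_le) (use c P in auto)
  finally show ?thesis using ab by simp
qed

text \<open>If enough pairs can be formed, the corner is arbitrary. Otherwise, up to conjugation and
  a shift by \<open>c\<close>, the matrix has zero border, and the shifted matrix still has rank at
  least that of \<open>M\<close>, because the scalar rank is a minimum over all shifts. Hence
  \<open>M\<close> factors through it, and \<open>zero_border_corner\<close> applies.\<close>

lemma conj_corner:
  fixes f :: "nat \<Rightarrow> nat \<Rightarrow> 'a::field"
  assumes n: "1 \<le> n" "3 * n + 3 \<le> N" and M: "M \<in> sqmat n"
    and r: "rk n M \<le> scalar_rank N (fmat N f)"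
  shows "\<exists>h c. sim N f h \<and> (\<forall>i<n. \<forall>j<n. h i j = M $$ (i, j) + c * delta i j)"
proof -
  let ?b = "\<lambda>a. n + 2 * a" let ?z = "\<lambda>a. n + 2 * a + 1" let ?R = "{..<n} \<union> {n + 2 * n..<N}"
  from paired_or_scalar_border[OF n order_refl, of f]
  obtain g where s: "sim N f g" and
    g: "paired ?b ?z ?R n g \<or> (\<exists>c. \<forall>i<N. \<forall>j<N. i < n \<or> j < n \<longrightarrow> g i j = (if i = j then c else 0))" by blast
  show ?thesis
  proof (cases "paired ?b ?z ?R n g")
    case True
    have "\<exists>h. sim N g h \<and> (\<forall>i<n. \<forall>j<n. h i j = M $$ (i, j))"
      by (rule paired_corner[OF True]) (use n in \<open>auto, presburger?\<close>)
    then obtain h where "sim N g h" "\<And>i j. i < n \<Longrightarrow> j < n \<Longrightarrow> h i j = M $$ (i, j)" by blast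
    then show ?thesis using sim_trans[OF s] by (intro exI[of _ h] exI[of _ 0]) auto
  next
    case False
    then obtain c where c: "\<And>i j. i < N \<Longrightarrow> j < N \<Longrightarrow> i < n \<or> j < n \<Longrightarrow> g i j = (if i = j then c else 0)"
      using g by blast
    define F where "F i j = g i j + (- c) * delta i j" for i j
    define F0 where "F0 i j = f i j + (- c) * delta i j" for i j
    have sF: "sim N F0 F" unfolding F_def F0_def by (rule sim_shift[OF s])
    have F: "F i j = 0" if "i < N" "j < N" "i < n \<or> j < n" for i j using c[OF that] by (simp add: F_def)
    obtain A where A: "A \<in> carrier (SL N)" and e: "fmat N F0 = A * fmat N F * mat_inv A"
      using sim_sym[OF sF] unfolding sim_def by blast
    have cA: "A \<in> sqmat N" "mat_inv A \<in> sqmat N" using A mat_inv(1)[OF A] by (auto simp: SL_simps)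
    have "fmat N F0 = fmat N f + (- c) \<cdot>\<^sub>m 1\<^sub>m N" by (rule eq_matI) (auto simp: F0_def)
    then have "scalar_rank N (fmat N f) \<le> rk N (fmat N F0)"
      using scalar_rank_le_rank[of "fmat N f" N "- c"] by simp
    also have "\<dots> \<le> rk N (fmat N F)"
      unfolding e by (rule rank_mult_mult_le[OF cA(1) fmat_carrier cA(2)])
    finally have "rk n M \<le> rk N (fmat N F)" using r by simp
    then obtain X Y where X: "X \<in> carrier_mat n N" and Y: "Y \<in> carrier_mat N n" and MX: "M = X * fmat N F * Y"
      using rank_le_imp_factor[OF M fmat_carrier] by blast
    obtain h where h: "sim N F h" "\<And>i j. i < n \<Longrightarrow> j < n \<Longrightarrow>
        h i j = (\<Sum>k<N. X $$ (i, k) * (\<Sum>l<N. F k l * Y $$ (l, j)))"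
      using zero_border_corner[of n N F "\<lambda>i k. X $$ (i, k)" "\<lambda>l j. Y $$ (l, j)"] F n by auto
    have hM: "h i j = M $$ (i, j)" if ij: "i < n" "j < n" for i j
    proof -
      have FY: "fmat N F * Y \<in> carrier_mat N n" by (rule mult_carrier_mat[OF fmat_carrier Y])
      have "M = X * (fmat N F * Y)" unfolding MX by (rule assoc_mult_mat) (use X Y in auto)
      then have "M $$ (i, j) = (\<Sum>k<N. X $$ (i, k) * (fmat N F * Y) $$ (k, j))"
        using mult_index[OF X FY ij] by simp
      also have "\<dots> = h i j" unfolding h(2)[OF ij]
        by (intro sum.cong refl arg_cong2[of _ _ _ _ times])
          (use mult_index[OF fmat_carrier Y _ ij(2), of _ F] in auto)
      finally show ?thesis by simp
    qed
    have "sim N (\<lambda>i j. F i j + c * delta i j) (\<lambda>i j. h i j + c * delta i j)" by (rule sim_shift[OF h(1)])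
    moreover have "(\<lambda>i j. F i j + c * delta i j) = g" by (intro ext) (simp add: F_def)
    ultimately have "sim N f (\<lambda>i j. h i j + c * delta i j)" using sim_trans[OF s] by simp
    then show ?thesis using hM by (intro exI[of _ "\<lambda>i j. h i j + c * delta i j"] exI[of _ c]) auto
  qed
qed

text \<open>The index maps may leave the range: such rows and columns are filled with zeros, so that
  the lemma covers submatrices and paddings alike.\<close>

lemma rank_select_le:
  fixes Q :: "'a::field mat"
  assumes Q: "Q \<in> sqmat N"
  shows "rk p (mat p q (\<lambda>(i, j). if u i < N \<and> w j < N then Q $$ (u i, w j) else 0)) \<le> rk N Q"
    (is "rk p ?S \<le> _")
proof -
  let ?X = "mat p N (\<lambda>(i, t). delta (u i) t :: 'a)" let ?Y = "mat N q (\<lambda>(t, j). delta t (w j) :: 'a)"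
  have X: "?X \<in> carrier_mat p N" and Y: "?Y \<in> carrier_mat N q" by auto
  have d: "(\<Sum>t<N. delta a t * g t) = (if a < N then g a else 0)" "(\<Sum>t<N. g t * delta t a) = (if a < N then g a else 0)"
    for a and g :: "nat \<Rightarrow> 'a"
    by (cases "a < N"; simp add: sum_delta_mult; intro sum.neutral; auto)+
  have "?X * Q * ?Y = ?S"
  proof (rule eq_matI)
    fix i j assume "i < dim_row ?S" "j < dim_col ?S"
    then have ij: "i < p" "j < q" by auto
    have "(?X * Q) $$ (i, k) = (if u i < N then Q $$ (u i, k) else 0)" if "k < N" for k
      using mult_index[OF X Q ij(1) that] ij by (simp add: d(1)[of "u i" "\<lambda>t. Q $$ (t, k)"])
    then have "(?X * Q * ?Y) $$ (i, j) = (\<Sum>k<N. (if u i < N then Q $$ (u i, k) else 0) * delta k (w j))"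
      using mult_index[OF mult_carrier_mat[OF X Q] Y ij] ij by simp
    then show "(?X * Q * ?Y) $$ (i, j) = ?S $$ (i, j)" unfolding d using ij by simp
  qed auto
  then show ?thesis using rank_mult_mult_le[OF X Q Y] by simp
qed

text \<open>The submatrix avoids the diagonal, so it is the same for \<open>P\<close> and for the
  shift of \<open>P\<close> whose rank is at most \<open>k\<close>.\<close>

lemma det_zero_of_scalar_rank:
  fixes P :: "'a::field mat"
  assumes P: "P \<in> sqmat m" and k: "scalar_rank m P \<le> k" "2 * k + 2 \<le> m"
  shows "det (mat (Suc k) (Suc k) (\<lambda>(i, j). P $$ (Suc k + i, j))) = 0"
proof -
  let ?D = "mat (Suc k) (Suc k) (\<lambda>(i, j). P $$ (Suc k + i, j))"
  obtain c where c: "rk m (P + c \<cdot>\<^sub>m 1\<^sub>m m) \<le> k" using exists_scalar_shift[OF P k(1)] k(2) by auto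
  let ?Q = "P + c \<cdot>\<^sub>m 1\<^sub>m m"
  have "mat (Suc k) (Suc k) (\<lambda>(i, j). if Suc k + i < m \<and> j < m then ?Q $$ (Suc k + i, j) else 0) = ?D"
    by (rule eq_matI) (use P k(2) in auto)
  then have "rk (Suc k) ?D \<le> k"
    using rank_select_le[of ?Q m "Suc k" "Suc k" "\<lambda>i. Suc k + i" "\<lambda>j. j"] P c by simp
  then have "rk (Suc k) ?D \<noteq> Suc k" by simp
  then show ?thesis using vec_space.det_rank_iff[of ?D "Suc k"] by simp
qed

definition zero_pad :: "nat \<Rightarrow> nat \<Rightarrow> 'a::zero mat \<Rightarrow> 'a mat" where
  "zero_pad m N M = mat N N (\<lambda>(a, b). if a < m \<and> b < m then M $$ (a, b) else 0)"

lemma zero_pad_carrier [simp]: "zero_pad m N M \<in> sqmat N"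
  by (simp add: zero_pad_def)

lemma zero_pad_self: "M \<in> sqmat m \<Longrightarrow> zero_pad m m M = M"
  by (rule eq_matI) (auto simp: zero_pad_def)

lemma rank_zero_pad:
  fixes M :: "'a::field mat"
  assumes M: "M \<in> sqmat m"
  shows "rk N (zero_pad m N M) \<le> rk m M"
  using rank_select_le[OF M, of N N "\<lambda>i. i" "\<lambda>j. j"] by (simp add: zero_pad_def)

subsection \<open>Closed subsets of the inverse limit\<close>

lemma linear_funD:
  assumes "linear_fun m \<phi>" "P \<in> sqmat m"
  shows "Q \<in> sqmat m \<Longrightarrow> \<phi> (cls m (P + Q)) = \<phi> (cls m P) + \<phi> (cls m Q)"
    "\<phi> (cls m (c \<cdot>\<^sub>m P)) = c * \<phi> (cls m P)"
  using assms by (auto simp: linear_fun_def)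

text \<open>Evaluation at a chosen representative; for a linear \<open>\<psi>\<close> that kills the
  identity, the choice does not matter.\<close>

definition induced_fun :: "('a::field mat \<Rightarrow> 'a) \<Rightarrow> 'a mat set \<Rightarrow> 'a" where
  "induced_fun \<psi> x = \<psi> (SOME M. M \<in> x)"

lemma induced_fun:
  fixes \<psi> :: "'a::field mat \<Rightarrow> 'a"
  assumes add: "\<And>P Q. P \<in> sqmat m \<Longrightarrow> Q \<in> sqmat m \<Longrightarrow> \<psi> (P + Q) = \<psi> P + \<psi> Q"
    and scale: "\<And>c P. P \<in> sqmat m \<Longrightarrow> \<psi> (c \<cdot>\<^sub>m P) = c * \<psi> P"
    and one: "\<psi> (1\<^sub>m m) = 0"
  shows "P \<in> sqmat m \<Longrightarrow> induced_fun \<psi> (cls m P) = \<psi> P"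
    "linear_fun m (induced_fun \<psi>)"
proof -
  show v: "induced_fun \<psi> (cls m P) = \<psi> P" if P: "P \<in> sqmat m" for P
  proof -
    have "(SOME M. M \<in> cls m P) \<in> cls m P" using cls_self[OF P] by (rule someI)
    then obtain c where "(SOME M. M \<in> cls m P) = P + c \<cdot>\<^sub>m 1\<^sub>m m" unfolding cls_def by auto
    then show ?thesis using P by (simp add: induced_fun_def add scale one)
  qed
  show "linear_fun m (induced_fun \<psi>)" unfolding linear_fun_def by (simp add: v add scale)
qed

text \<open>Subtracting the entry \<open>(0, 0)\<close> on the diagonal makes the value independent of the
  representative.\<close>

definition entry_fun :: "nat \<Rightarrow> nat \<Rightarrow> 'a::field mat set \<Rightarrow> 'a" where
  "entry_fun a b = induced_fun (\<lambda>P. P $$ (a, b) - (if a = b then P $$ (0, 0) else 0))"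

lemma entry_fun:
  assumes "a < m" "b < m"
  shows "P \<in> sqmat m \<Longrightarrow> entry_fun a b (cls m P) = P $$ (a, b) - (if a = b then P $$ (0, 0) else 0)"
    "linear_fun m (entry_fun a b)"
  unfolding entry_fun_def
  by (rule induced_fun; use assms in \<open>auto simp: algebra_simps\<close>)+

lemma linear_fun_zero: "linear_fun m \<phi> \<Longrightarrow> \<phi> (cls m (0\<^sub>m m m)) = 0"
  using linear_funD(2)[of m \<phi> "0\<^sub>m m m" 0] by simp

lemma cls_eq_zero:
  fixes P :: "'a::field mat"
  assumes P: "P \<in> sqmat m" and 0: "\<And>\<phi>. linear_fun m \<phi> \<Longrightarrow> \<phi> (cls m P) = 0"
  shows "cls m P = cls m (0\<^sub>m m m)"
proof -
  obtain c where e: "\<And>a b. a < m \<Longrightarrow> b < m \<Longrightarrow> P $$ (a, b) = (if a = b then c else 0)"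
  proof
    fix a b assume "a < m" "b < m"
    then show "P $$ (a, b) = (if a = b then P $$ (0, 0) else 0)"
      using 0[OF entry_fun(2)[of a m b]] entry_fun(1)[of a m b P] P by (cases "a = b") simp_all
  qed
  have "P = 0\<^sub>m m m + c \<cdot>\<^sub>m 1\<^sub>m m"
    by (rule eq_matI) (use P e in auto)
  then have "P \<in> cls m (0\<^sub>m m m)" unfolding cls_def by blast
  then show ?thesis by (rule cls_memD) simp
qed

lemma gl_modE:
  assumes "x \<in> gl_mod m"
  obtains P where "P \<in> sqmat m" "x = cls m P"
  using assms unfolding gl_mod_def by blast

lemma cls_in_gl_mod: "P \<in> sqmat m \<Longrightarrow> cls m P \<in> gl_mod m"
  unfolding gl_mod_def by blast

lemma block_bound: "k < K \<Longrightarrow> a < m \<Longrightarrow> k * m + a < K * m + (z::nat)"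
proof -
  assume "k < K" "a < m"
  then have "k * m + a < Suc k * m" by simp
  also have "\<dots> \<le> K * m" using \<open>k < K\<close> by (intro mult_le_mono1) simp
  finally show ?thesis by simp
qed

lemma trans_mat_index:
  "a < m \<Longrightarrow> b < m \<Longrightarrow> trans_mat m l r M $$ (a, b) =
    (\<Sum>k<l. M $$ (k * m + a, k * m + b)) - (\<Sum>k<r. M $$ ((l + k) * m + b, (l + k) * m + a))"
  by (simp add: trans_mat_def block_def)

lemma trans_mat_linear:
  assumes "P \<in> sqmat ((l + r) * m + z)"
  shows "Q \<in> sqmat ((l + r) * m + z) \<Longrightarrow>
      trans_mat m l r (P + Q) = trans_mat m l r P + trans_mat m l r Q"
    "trans_mat m l r (c \<cdot>\<^sub>m P) = c \<cdot>\<^sub>m trans_mat m l r P"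
proof -
  let ?N = "(l + r) * m + z"
  have bd: "k * m + a < ?N" if "k < l" "a < m" for k a using block_bound[of k "l + r" a m z] that by simp
  have bd': "(l + k) * m + a < ?N" if "k < r" "a < m" for k a using block_bound[of "l + k" "l + r" a m z] that by simp
  show "trans_mat m l r (c \<cdot>\<^sub>m P) = c \<cdot>\<^sub>m trans_mat m l r P"
  proof (rule eq_matI)
    fix a b assume "a < dim_row (c \<cdot>\<^sub>m trans_mat m l r P)" "b < dim_col (c \<cdot>\<^sub>m trans_mat m l r P)"
    then have ab: "a < m" "b < m" by (auto simp: trans_mat_def)
    have "(\<Sum>k<l. (c \<cdot>\<^sub>m P) $$ (k * m + a, k * m + b)) = c * (\<Sum>k<l. P $$ (k * m + a, k * m + b))"
      unfolding sum_distrib_left by (rule sum.cong) (use bd ab assms in auto)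
    moreover have "(\<Sum>k<r. (c \<cdot>\<^sub>m P) $$ ((l + k) * m + b, (l + k) * m + a)) = c * (\<Sum>k<r. P $$ ((l + k) * m + b, (l + k) * m + a))"
      unfolding sum_distrib_left by (rule sum.cong) (use bd' ab assms in auto)
    ultimately show "trans_mat m l r (c \<cdot>\<^sub>m P) $$ (a, b) = (c \<cdot>\<^sub>m trans_mat m l r P) $$ (a, b)"
      using ab by (simp add: trans_mat_index right_diff_distrib carrier_matD[OF trans_mat_carrier])
  qed (auto simp: trans_mat_def)
  assume Q: "Q \<in> sqmat ?N"
  show "trans_mat m l r (P + Q) = trans_mat m l r P + trans_mat m l r Q"
  proof (rule eq_matI)
    fix a b assume "a < dim_row (trans_mat m l r P + trans_mat m l r Q)" "b < dim_col (trans_mat m l r P + trans_mat m l r Q)"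
    then have ab: "a < m" "b < m" by (auto simp: trans_mat_def)
    have "(\<Sum>k<l. (P + Q) $$ (k * m + a, k * m + b)) = (\<Sum>k<l. P $$ (k * m + a, k * m + b)) + (\<Sum>k<l. Q $$ (k * m + a, k * m + b))"
      unfolding sum.distrib[symmetric] by (rule sum.cong) (use bd ab assms Q in auto)
    moreover have "(\<Sum>k<r. (P + Q) $$ ((l + k) * m + b, (l + k) * m + a)) =
       (\<Sum>k<r. P $$ ((l + k) * m + b, (l + k) * m + a)) + (\<Sum>k<r. Q $$ ((l + k) * m + b, (l + k) * m + a))"
      unfolding sum.distrib[symmetric] by (rule sum.cong) (use bd' ab assms Q in auto)
    ultimately show "trans_mat m l r (P + Q) $$ (a, b) = (trans_mat m l r P + trans_mat m l r Q) $$ (a, b)"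
      using ab by (simp add: trans_mat_index carrier_matD[OF trans_mat_carrier])
  qed (auto simp: trans_mat_def)
qed

lemma linear_fun_transition:
  assumes "linear_fun m \<phi>"
  shows "linear_fun ((l + r) * m + z) (\<lambda>x. \<phi> (transition m l r x))"
  unfolding linear_fun_def
  using linear_funD[OF assms trans_mat_carrier]
  by (auto simp: transition_cls trans_mat_linear[of _ l r m z])

lemma poly_fun_transition:
  "f \<in> poly_fun m \<Longrightarrow> (\<lambda>x. f (transition m l r x)) \<in> poly_fun ((l + r) * m + z)"
  by (induct rule: poly_fun.induct) (auto intro: poly_fun.intros linear_fun_transition)

lemma linear_fun_conj:
  assumes \<phi>: "linear_fun m \<phi>" and A: "A \<in> carrier (SL m)"
  shows "linear_fun m (\<lambda>x. \<phi> (conj_act A x))"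
proof -
  have c: "A \<in> sqmat m" "mat_inv A \<in> sqmat m" using A mat_inv(1)[OF A] by (auto simp: SL_simps)
  have "A * (P + Q) * mat_inv A = A * P * mat_inv A + A * Q * mat_inv A"
    if P: "P \<in> sqmat m" and Q: "Q \<in> sqmat m" for P Q
  proof -
    have "A * (P + Q) = A * P + A * Q" by (rule mult_add_distrib_mat[OF c(1) P Q])
    then show ?thesis using add_mult_distrib_mat[of "A * P" m m "A * Q" "mat_inv A" m] c P Q by simp
  qed
  moreover have "A * (d \<cdot>\<^sub>m P) * mat_inv A = d \<cdot>\<^sub>m (A * P * mat_inv A)" if P: "P \<in> sqmat m" for P d
    using that c by (simp add: mult_smult_distrib[of _ m m _ m] mult_smult_assoc_mat[of _ m m _ m])
  ultimately show ?thesis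
    unfolding linear_fun_def using linear_funD[OF \<phi>] c
    by (auto simp: conj_act_cls[OF A])
qed

lemma poly_fun_conj:
  "f \<in> poly_fun m \<Longrightarrow> A \<in> carrier (SL m) \<Longrightarrow> (\<lambda>x. f (conj_act A x)) \<in> poly_fun m"
  by (induct rule: poly_fun.induct) (auto intro: poly_fun.intros linear_fun_conj)

lemma poly_fun_sum: "finite I \<Longrightarrow> (\<And>i. i \<in> I \<Longrightarrow> f i \<in> poly_fun m) \<Longrightarrow> (\<lambda>x. \<Sum>i\<in>I. f i x) \<in> poly_fun m"
  by (induct rule: finite_induct) (auto intro: poly_fun.intros)

lemma poly_fun_prod: "finite I \<Longrightarrow> (\<And>i. i \<in> I \<Longrightarrow> f i \<in> poly_fun m) \<Longrightarrow> (\<lambda>x. \<Prod>i\<in>I. f i x) \<in> poly_fun m"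
  by (induct rule: finite_induct) (auto intro: poly_fun.intros)

text \<open>Degree two suffices: \<open>V\<close> and the trace loci are joined by lines, and the
  rank loci by products \<open>(A0 + t A1) Q (B0 + t B1)\<close>.\<close>

abbreviation curve :: "'a::field mat \<Rightarrow> 'a mat \<Rightarrow> 'a mat \<Rightarrow> 'a \<Rightarrow> 'a mat" where
  "curve P0 P1 P2 t \<equiv> P0 + t \<cdot>\<^sub>m P1 + (t * t) \<cdot>\<^sub>m P2"

lemma poly_fun_curve:
  fixes P0 P1 P2 :: "'a::field mat"
  assumes "f \<in> poly_fun m" and P: "P0 \<in> sqmat m" "P1 \<in> sqmat m" "P2 \<in> sqmat m"
  shows "\<exists>q. \<forall>t. f (cls m (curve P0 P1 P2 t)) = poly q t"
  using assms(1)
proof (induct rule: poly_fun.induct)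
  case (const c)
  show ?case by (intro exI[of _ "[:c:]"]) simp
next
  case (linear \<phi>)
  have "\<phi> (cls m (curve P0 P1 P2 t)) = poly [:\<phi> (cls m P0), \<phi> (cls m P1), \<phi> (cls m P2):] t" for t
    using P by (simp add: linear_funD[OF linear] algebra_simps)
  then show ?case by blast
next
  case (add f g)
  then show ?case by (metis poly_add)
next
  case (mult f g)
  then show ?case by (metis poly_mult)
qed

lemma zariski_closed_Un:
  assumes "zariski_closed m Y" "zariski_closed m Z"
  shows "zariski_closed m (Y \<union> Z)"
proof -
  from assms obtain F H where F: "F \<subseteq> poly_fun m" "Y = {x \<in> gl_mod m. \<forall>f\<in>F. f x = 0}"
    and H: "H \<subseteq> poly_fun m" "Z = {x \<in> gl_mod m. \<forall>f\<in>H. f x = 0}" unfolding zariski_closed_def by blast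
  let ?G = "{\<lambda>x. f x * h x | f h. f \<in> F \<and> h \<in> H}"
  have "?G \<subseteq> poly_fun m" using F H by (auto intro: poly_fun.mult)
  moreover have "Y \<union> Z = {x \<in> gl_mod m. \<forall>f\<in>?G. f x = 0}"
    unfolding F(2) H(2) by (auto, metis mult_eq_0_iff)
  ultimately show ?thesis unfolding zariski_closed_def by blast
qed

lemma zariski_closed_Int:
  assumes "zariski_closed m Y" "zariski_closed m Z"
  shows "zariski_closed m (Y \<inter> Z)"
proof -
  from assms obtain F H where F: "F \<subseteq> poly_fun m" "Y = {x \<in> gl_mod m. \<forall>f\<in>F. f x = 0}"
    and H: "H \<subseteq> poly_fun m" "Z = {x \<in> gl_mod m. \<forall>f\<in>H. f x = 0}" unfolding zariski_closed_def by blast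
  then show ?thesis unfolding zariski_closed_def by (intro exI[of _ "F \<union> H"]) auto
qed

lemma zariski_closed_separate:
  assumes "zariski_closed m Y" "x \<in> gl_mod m" "x \<notin> Y"
  obtains f where "f \<in> poly_fun m" "f x \<noteq> 0" "\<And>y. y \<in> Y \<Longrightarrow> f y = 0"
proof -
  obtain F where F: "F \<subseteq> poly_fun m" "Y = {x \<in> gl_mod m. \<forall>f\<in>F. f x = 0}"
    using assms(1) unfolding zariski_closed_def by blast
  then obtain f where "f \<in> F" "f x \<noteq> 0" using assms(2,3) by blast
  with F that[of f] show ?thesis by blast
qed

section \<open>The inverse limit and the action on it\<close>

locale diag_sequence =
  fixes n l r z :: "nat \<Rightarrow> nat" and K :: "'a::field itself"
  assumes inf_field: "infinite (UNIV :: 'a set)"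
    and n0: "0 < n 0" and n_Suc: "\<And>i. n (Suc i) = (l i + r i) * n i + z i"
    and l_pos: "\<And>i. 1 \<le> l i" and r_le_l: "\<And>i. r i \<le> l i"
begin

abbreviation V :: "(nat \<Rightarrow> 'a mat set) set" where "V \<equiv> inv_lim n l r"

abbreviation Closed :: "(nat \<Rightarrow> 'a mat set) set \<Rightarrow> bool" where "Closed \<equiv> closed_in_lim n l r"

abbreviation Stable :: "(nat \<Rightarrow> 'a mat set) set \<Rightarrow> bool" where "Stable \<equiv> G_stable n l r z"

abbreviation Irreducible :: "(nat \<Rightarrow> 'a mat set) set \<Rightarrow> bool" where "Irreducible \<equiv> irreducible_in_lim n l r"

abbreviation StableClosed :: "(nat \<Rightarrow> 'a mat set) set \<Rightarrow> bool" where "StableClosed \<equiv> stable_closed n l r z"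

abbreviation tr :: "nat \<Rightarrow> 'a mat set \<Rightarrow> 'a mat set" where "tr i \<equiv> transition (n i) (l i) (r i)"

lemma pos: "0 < n i" by (rule n_pos[OF n0 n_Suc l_pos])

lemma V_gl: "v \<in> V \<Longrightarrow> v i \<in> gl_mod (n i)" by (simp add: inv_lim_def)

lemma V_tr: "v \<in> V \<Longrightarrow> tr i (v (Suc i)) = v i" by (simp add: inv_lim_def)

lemma V_rep: assumes "v \<in> V" obtains P where "P \<in> sqmat (n i)" "v i = cls (n i) P"
  using V_gl[OF assms] gl_modE by blast

lemma tr_cls: "M \<in> sqmat (n (Suc i)) \<Longrightarrow>
    tr i (cls (n (Suc i)) M) = cls (n i) (trans_mat (n i) (l i) (r i) M)"
  unfolding n_Suc by (rule transition_cls)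

lemma tr_gl: "x \<in> gl_mod (n (Suc i)) \<Longrightarrow> tr i x \<in> gl_mod (n i)"
  by (metis gl_modE tr_cls cls_in_gl_mod trans_mat_carrier)

lemma poly_fun_tr: "f \<in> poly_fun (n i) \<Longrightarrow> (\<lambda>x. f (tr i x)) \<in> poly_fun (n (Suc i))"
  unfolding n_Suc by (rule poly_fun_transition)

lemma V_down:
  assumes "v \<in> V" "w \<in> V" "v j = w j" "i \<le> j"
  shows "v i = w i"
  using assms(4,3)
proof (induct i rule: inc_induct)
  case (step i)
  then show ?case using V_tr[OF assms(1), of i] V_tr[OF assms(2), of i] by simp
qed simp

lemma dl_act_spec:
  assumes g: "g \<in> carrier (dl_group n l r z)" and v: "v \<in> V"
  shows "dl_act n l r z g v \<in> V"
    "(i, A) \<in> g \<Longrightarrow> i \<le> j \<Longrightarrow> dl_act n l r z g v j = conj_act (emb l r z i j A) (v j)"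
proof -
  have "dl_act n l r z g v \<in> V \<and> (\<forall>(i, A)\<in>g. \<forall>j\<ge>i. dl_act n l r z g v j = conj_act (emb l r z i j A) (v j))"
    unfolding dl_act_def by (rule theI'[OF dl_act_unique[OF n0 n_Suc l_pos g v]])
  then show "dl_act n l r z g v \<in> V"
    "(i, A) \<in> g \<Longrightarrow> i \<le> j \<Longrightarrow> dl_act n l r z g v j = conj_act (emb l r z i j A) (v j)" by auto
qed

lemma dl_group_rep:
  assumes "g \<in> carrier (dl_group n l r z :: (nat \<times> 'a mat) set monoid)"
  obtains i A where "A \<in> carrier (SL (n i))" "(i, A) \<in> g"
proof -
  from assms obtain i A where A: "A \<in> carrier (SL (n i))" and g: "g = dl_rel n l r z `` {(i, A)}"
    by (auto simp: dl_group_def quotient_def)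
  have "(i, A) \<in> g" using A unfolding g dl_rel_def by auto
  with A that show ?thesis by blast
qed

lemma Stable_conj:
  assumes X: "Stable X" "X \<subseteq> V" and v: "v \<in> X" and A: "A \<in> carrier (SL (n j))"
  shows "\<exists>w\<in>X. w j = conj_act A (v j)"
proof -
  let ?g = "dl_rel n l r z `` {(j, A)}"
  have g: "?g \<in> carrier (dl_group n l r z)" using A by (auto simp: dl_group_def quotient_def)
  have m: "(j, A) \<in> ?g" using A unfolding dl_rel_def by auto
  have "dl_act n l r z ?g v j = conj_act A (v j)"
    using dl_act_spec(2)[OF g _ m order_refl, of v] v X(2)
    by (auto simp: emb_self[OF n0 n_Suc l_pos])
  moreover have "dl_act n l r z ?g v \<in> X" using X(1) g v unfolding G_stable_def by blast
  ultimately show ?thesis by blast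
qed

lemma Stable_sim:
  assumes X: "Stable X" "X \<subseteq> V" and v: "v \<in> X" and f: "v j = cls (n j) (fmat (n j) f)" and s: "sim (n j) f g"
  shows "\<exists>w\<in>X. w j = cls (n j) (fmat (n j) g)"
proof -
  from s obtain A where A: "A \<in> carrier (SL (n j))" and g: "fmat (n j) g = A * fmat (n j) f * mat_inv A"
    unfolding sim_def by blast
  then show ?thesis using Stable_conj[OF X v A] conj_act_cls[OF A fmat_carrier] f by metis
qed

text \<open>A group element has a representative at some level \<open>i\<close> and acts at all
  higher levels by conjugation. The levels below \<open>i\<close> are governed by membership in
  \<open>V\<close>.\<close>

lemma StableI:
  assumes "X \<subseteq> V"
    and "\<And>v w i A. v \<in> X \<Longrightarrow> w \<in> V \<Longrightarrow> A i \<in> carrier (SL (n i)) \<Longrightarrow>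
      (\<And>j. i \<le> j \<Longrightarrow> A j \<in> carrier (SL (n j)) \<and> w j = conj_act (A j) (v j)) \<Longrightarrow> w \<in> X"
  shows "Stable X"
  unfolding G_stable_def
proof (intro ballI)
  fix g :: "(nat \<times> 'a mat) set" and v assume g: "g \<in> carrier (dl_group n l r z)" and v: "v \<in> X"
  then have vV: "v \<in> V" using assms(1) by blast
  obtain i A where A: "A \<in> carrier (SL (n i))" "(i, A) \<in> g" using dl_group_rep[OF g] .
  show "dl_act n l r z g v \<in> X"
  proof (rule assms(2)[OF v dl_act_spec(1)[OF g vV], of "\<lambda>j. emb l r z i j A" i])
    show "emb l r z i i A \<in> carrier (SL (n i))" using A by (simp add: emb_self[OF n0 n_Suc l_pos])
    show "emb l r z i j A \<in> carrier (SL (n j)) \<and> dl_act n l r z g v j = conj_act (emb l r z i j A) (v j)"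
      if "i \<le> j" for j
      using emb_SL[OF n0 n_Suc l_pos that A(1)] dl_act_spec(2)[OF g vV A(2) that] by blast
  qed
qed

section \<open>Closed sets and closures, level by level\<close>

lemma Closed_sub: "Closed X \<Longrightarrow> X \<subseteq> V" by (auto simp: closed_in_lim_def)

lemma ClosedE:
  assumes "Closed X"
  obtains Y where "\<And>i. zariski_closed (n i) (Y i)" "\<And>i. tr i ` Y (Suc i) \<subseteq> Y i" "X = {v \<in> V. \<forall>i. v i \<in> Y i}"
  using assms unfolding closed_in_lim_def by blast

lemma closed_seq_down:
  assumes "\<And>i. tr i ` Y (Suc i) \<subseteq> Y i" "w \<in> V" "w j \<in> Y j" "i \<le> j"
  shows "w i \<in> Y i"
  using assms(4,3)
proof (induct i rule: inc_induct)
  case (step i)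
  then show ?case using V_tr[OF assms(2), of i] assms(1)[of i] by force
qed simp

text \<open>The point \<open>v\<close> may vary with the level: membership is tested against each
  \<open>Y i\<close> separately, and the transition maps carry membership down from cofinally many
  levels. This turns statements about single levels into inclusions of closed sets.\<close>

lemma Closed_mem:
  assumes X: "Closed X" and w: "w \<in> V" and m: "\<And>i. \<exists>j\<ge>i. \<exists>v\<in>X. v j = w j"
  shows "w \<in> X"
proof -
  from X obtain Y where Y: "\<And>i. tr i ` Y (Suc i) \<subseteq> Y i" and e: "X = {v \<in> V. \<forall>i. v i \<in> Y i}"
    unfolding closed_in_lim_def by blast
  have "w i \<in> Y i" for i
  proof -
    obtain j v where j: "i \<le> j" "v \<in> X" "v j = w j" using m by blast
    have "v j \<in> Y j" using j(2) unfolding e by blast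
    then have "w j \<in> Y j" unfolding j(3) .
    then show ?thesis using closed_seq_down[of Y w j i] Y w j by blast
  qed
  then show ?thesis using e w by blast
qed

text \<open>The union is formed levelwise. A point outside \<open>A\<close> at level
  \<open>i\<close> and outside \<open>B\<close> at level \<open>j\<close> is outside both at level
  \<open>max i j\<close>, since leaving a compatible sequence persists upwards.\<close>

lemma Closed_Un: assumes "Closed X" "Closed Y" shows "Closed (X \<union> Y)"
proof -
  obtain A where A: "\<And>i. zariski_closed (n i) (A i)" "\<And>i. tr i ` A (Suc i) \<subseteq> A i" "X = {v \<in> V. \<forall>i. v i \<in> A i}"
    by (rule ClosedE[OF assms(1)], rule that) blast+
  obtain B where B: "\<And>i. zariski_closed (n i) (B i)" "\<And>i. tr i ` B (Suc i) \<subseteq> B i" "Y = {v \<in> V. \<forall>i. v i \<in> B i}"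
    by (rule ClosedE[OF assms(2)], rule that) blast+
  have "X \<union> Y = {v \<in> V. \<forall>i. v i \<in> A i \<union> B i}"
  proof (intro equalityI subsetI)
    fix v assume v: "v \<in> {v \<in> V. \<forall>i. v i \<in> A i \<union> B i}"
    show "v \<in> X \<union> Y"
    proof (rule ccontr)
      assume "v \<notin> X \<union> Y"
      then obtain i j where ij: "v i \<notin> A i" "v j \<notin> B j" using A(3) B(3) v by blast
      then have "v (max i j) \<notin> A (max i j)" "v (max i j) \<notin> B (max i j)"
        using closed_seq_down[of A v "max i j" i] closed_seq_down[of B v "max i j" j] A(2) B(2) v by auto
      then show False using v by blast
    qed
  qed (use A(3) B(3) in auto)
  moreover have "tr i ` (A (Suc i) \<union> B (Suc i)) \<subseteq> A i \<union> B i" for i using A(2)[of i] B(2)[of i] by auto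
  ultimately show ?thesis unfolding closed_in_lim_def
    using zariski_closed_Un[OF A(1) B(1)] by (intro exI[of _ "\<lambda>i. A i \<union> B i"]) blast
qed

lemma Closed_Int: assumes "Closed X" "Closed Y" shows "Closed (X \<inter> Y)"
proof -
  obtain A where A: "\<And>i. zariski_closed (n i) (A i)" "\<And>i. tr i ` A (Suc i) \<subseteq> A i" "X = {v \<in> V. \<forall>i. v i \<in> A i}"
    by (rule ClosedE[OF assms(1)], rule that) blast+
  obtain B where B: "\<And>i. zariski_closed (n i) (B i)" "\<And>i. tr i ` B (Suc i) \<subseteq> B i" "Y = {v \<in> V. \<forall>i. v i \<in> B i}"
    by (rule ClosedE[OF assms(2)], rule that) blast+
  have "tr i ` (A (Suc i) \<inter> B (Suc i)) \<subseteq> A i \<inter> B i" for i using A(2)[of i] B(2)[of i] by auto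
  moreover have "X \<inter> Y = {v \<in> V. \<forall>i. v i \<in> A i \<inter> B i}" using A(3) B(3) by auto
  ultimately show ?thesis unfolding closed_in_lim_def
    using zariski_closed_Int[OF A(1) B(1)] by (intro exI[of _ "\<lambda>i. A i \<inter> B i"]) blast
qed

lemma StableClosed_Int: "StableClosed X \<Longrightarrow> StableClosed Y \<Longrightarrow> StableClosed (X \<inter> Y)"
  using Closed_Int unfolding stable_closed_def G_stable_def by blast

lemma StableClosed_sub: "StableClosed X \<Longrightarrow> X \<subseteq> V"
  using Closed_sub by (simp add: stable_closed_def)

text \<open>The smallest closed set containing \<open>S\<close>. Closedness of a locus is proved by
  showing that its closure adds nothing (\<open>StableClosedI\<close>), which avoids exhibiting a
  full set of equations.\<close>

definition zclosure :: "(nat \<Rightarrow> 'a mat set) set \<Rightarrow> (nat \<Rightarrow> 'a mat set) set" where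
  "zclosure S = {v \<in> V. \<forall>i. \<forall>f \<in> poly_fun (n i). (\<forall>s\<in>S. f (s i) = 0) \<longrightarrow> f (v i) = 0}"

text \<open>An equation at a low level pulls back along the transition maps to one at a high
  level.\<close>

lemma zclosure_eventually:
  assumes S: "S \<subseteq> V" and v: "v \<in> V"
    and 0: "\<And>i f. i0 \<le> i \<Longrightarrow> f \<in> poly_fun (n i) \<Longrightarrow> (\<And>s. s \<in> S \<Longrightarrow> f (s i) = 0) \<Longrightarrow> f (v i) = 0"
  shows "v \<in> zclosure S"
proof -
  have "f (v i) = 0" if "f \<in> poly_fun (n i)" "\<And>s. s \<in> S \<Longrightarrow> f (s i) = 0" for i f
  proof (cases "i0 \<le> i")
    case False
    then have "i \<le> i0" by simp
    then show ?thesis using that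
    proof (induct i arbitrary: f rule: inc_induct)
      case base then show ?case using 0 by blast
    next
      case (step i)
      have "f (tr i (v (Suc i))) = 0"
        by (rule step(3)[OF poly_fun_tr[OF step(4)]]) (use step(5) V_tr S in auto)
      then show ?case using V_tr[OF v] by simp
    qed
  qed (use 0 that in blast)
  then show ?thesis using v unfolding zclosure_def by blast
qed

lemma Closed_zclosure: assumes S: "S \<subseteq> V" shows "Closed (zclosure S)"
proof -
  define F where "F i = {f \<in> poly_fun (n i). \<forall>s\<in>S. f (s i) = 0}" for i
  define Y where "Y i = {x \<in> gl_mod (n i). \<forall>f\<in>F i. f x = 0}" for i
  have "zariski_closed (n i) (Y i)" for i unfolding zariski_closed_def Y_def F_def by blast
  moreover have "tr i ` Y (Suc i) \<subseteq> Y i" for i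
  proof
    fix y assume "y \<in> tr i ` Y (Suc i)"
    then obtain x where x: "x \<in> Y (Suc i)" "y = tr i x" by blast
    have "f y = 0" if "f \<in> F i" for f
    proof -
      have "(\<lambda>x. f (tr i x)) \<in> F (Suc i)" using that poly_fun_tr V_tr S unfolding F_def by auto
      moreover have "\<forall>f \<in> F (Suc i). f x = 0" using x(1) unfolding Y_def by simp
      ultimately have "f (tr i x) = 0" by (rule bspec[rotated])
      then show ?thesis using x by simp
    qed
    then show "y \<in> Y i" using x tr_gl unfolding Y_def by blast
  qed
  moreover have "zclosure S = {v \<in> V. \<forall>i. v i \<in> Y i}"
    unfolding zclosure_def Y_def F_def using V_gl by blast
  ultimately show ?thesis unfolding closed_in_lim_def by blast
qed

lemma Stable_zclosure: assumes S: "S \<subseteq> V" "Stable S" shows "Stable (zclosure S)"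
proof (rule StableI)
  show "zclosure S \<subseteq> V" by (auto simp: zclosure_def)
next
  fix v w i and A :: "nat \<Rightarrow> 'a mat"
  assume v: "v \<in> zclosure S" and w: "w \<in> V"
    and A: "\<And>j. i \<le> j \<Longrightarrow> A j \<in> carrier (SL (n j)) \<and> w j = conj_act (A j) (v j)"
  show "w \<in> zclosure S"
  proof (rule zclosure_eventually[OF S(1) w, of i])
    fix j f assume j: "i \<le> j" and f: "f \<in> poly_fun (n j)" and f0: "\<And>s. s \<in> S \<Longrightarrow> f (s j) = 0"
    have Aj: "A j \<in> carrier (SL (n j))" using A j by blast
    have "f (conj_act (A j) (s j)) = 0" if "s \<in> S" for s
      using Stable_conj[OF S(2,1) that Aj] f0 by metis
    moreover have "\<forall>f \<in> poly_fun (n j). (\<forall>s\<in>S. f (s j) = 0) \<longrightarrow> f (v j) = 0"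
      using v by (simp add: zclosure_def)
    ultimately have "f (conj_act (A j) (v j)) = 0"
      by (auto dest!: bspec[OF _ poly_fun_conj[OF f Aj]])
    then show "f (w j) = 0" using A j by simp
  qed
qed

lemma StableClosedI:
  assumes "S \<subseteq> V" "Stable S" "zclosure S \<subseteq> S"
  shows "StableClosed S"
proof -
  have "zclosure S = S" using assms by (auto simp: zclosure_def)
  then show ?thesis using Closed_zclosure[OF assms(1)] assms(2) by (simp add: stable_closed_def)
qed

section \<open>Irreducibility\<close>

definition curve_connected :: "nat \<Rightarrow> (nat \<Rightarrow> 'a mat set) set \<Rightarrow> 'a mat set \<Rightarrow> 'a mat set \<Rightarrow> bool" where
  "curve_connected i X x y \<longleftrightarrow> (\<exists>P0 \<in> sqmat (n i). \<exists>P1 \<in> sqmat (n i). \<exists>P2 \<in> sqmat (n i).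
      x = cls (n i) (curve P0 P1 P2 0) \<and> y = cls (n i) (curve P0 P1 P2 1) \<and>
      (\<forall>t. \<exists>v\<in>X. v i = cls (n i) (curve P0 P1 P2 t)))"

lemma IrreducibleI:
  assumes X: "X \<subseteq> V" "X \<noteq> {}"
    and c: "\<And>i v w. i0 \<le> i \<Longrightarrow> v \<in> X \<Longrightarrow> w \<in> X \<Longrightarrow> curve_connected i X (v i) (w i)"
  shows "Irreducible X"
  unfolding irreducible_in_lim_def
proof (intro conjI allI impI)
  fix Y Z assume Y: "Closed Y" and Z: "Closed Z" and e: "X = Y \<union> Z"
  show "X = Y \<or> X = Z"
  proof (rule ccontr)
    assume "\<not> ?thesis"
    then obtain a b where a: "a \<in> X" "a \<notin> Y" and b: "b \<in> X" "b \<notin> Z" using e by blast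
    obtain A where A: "\<And>i. zariski_closed (n i) (A i)" "\<And>i. tr i ` A (Suc i) \<subseteq> A i" "Y = {v \<in> V. \<forall>i. v i \<in> A i}"
      by (rule ClosedE[OF Y], rule that) blast+
    obtain B where B: "\<And>i. zariski_closed (n i) (B i)" "\<And>i. tr i ` B (Suc i) \<subseteq> B i" "Z = {v \<in> V. \<forall>i. v i \<in> B i}"
      by (rule ClosedE[OF Z], rule that) blast+
    have V: "a \<in> V" "b \<in> V" using a b X by auto
    obtain i1 i2 where i: "a i1 \<notin> A i1" "b i2 \<notin> B i2" using a b A(3) B(3) V by blast
    \<comment> \<open>\<open>a\<close> misses \<open>Y\<close> and \<open>b\<close> misses
      \<open>Z\<close> possibly at different levels; above both levels, and above \<open>i0\<close>,
      they do so simultaneously.\<close>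
    define j where "j = max i0 (max i1 i2)"
    have j: "i0 \<le> j" "i1 \<le> j" "i2 \<le> j" by (auto simp: j_def)
    have aj: "a j \<notin> A j" using closed_seq_down[of A a j i1] A(2) V i j by blast
    have bj: "b j \<notin> B j" using closed_seq_down[of B b j i2] B(2) V i j by blast
    obtain f where f: "f \<in> poly_fun (n j)" "f (a j) \<noteq> 0" "\<And>y. y \<in> A j \<Longrightarrow> f y = 0"
      by (rule zariski_closed_separate[OF A(1) V_gl[OF V(1)] aj], rule that)
    obtain h where h: "h \<in> poly_fun (n j)" "h (b j) \<noteq> 0" "\<And>y. y \<in> B j \<Longrightarrow> h y = 0"
      by (rule zariski_closed_separate[OF B(1) V_gl[OF V(2)] bj], rule that)
    obtain P0 P1 P2 where P: "P0 \<in> sqmat (n j)" "P1 \<in> sqmat (n j)" "P2 \<in> sqmat (n j)"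
      and ab: "a j = cls (n j) (curve P0 P1 P2 0)" "b j = cls (n j) (curve P0 P1 P2 1)"
      and ct: "\<And>t. \<exists>x\<in>X. x j = cls (n j) (curve P0 P1 P2 t)" using c[OF j(1) a(1) b(1)] unfolding curve_connected_def by blast
    obtain p where p: "\<And>t. f (cls (n j) (curve P0 P1 P2 t)) = poly p t" using poly_fun_curve[OF f(1) P] by blast
    obtain q where q: "\<And>t. h (cls (n j) (curve P0 P1 P2 t)) = poly q t" using poly_fun_curve[OF h(1) P] by blast
    have "poly (p * q) t = 0" for t
    proof -
      obtain x where x: "x \<in> X" "x j = cls (n j) (curve P0 P1 P2 t)" using ct by blast
      then have "x j \<in> A j \<or> x j \<in> B j" using e A(3) B(3) by blast
      then have "f (x j) = 0 \<or> h (x j) = 0" using f h by blast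
      then show ?thesis using x p q by auto
    qed
    then have "{t. poly (p * q) t = 0} = UNIV" by blast
    then have "p * q = 0" using poly_roots_finite[of "p * q"] inf_field by auto
    then have "p = 0 \<or> q = 0" by simp
    then show False using p[of 0] q[of 1] ab f(2) h(2) by auto
  qed
qed (rule X(2))

lemma Irreducible_finite_Union:
  assumes "finite \<F>" "\<And>Y. Y \<in> \<F> \<Longrightarrow> Closed Y" "Irreducible (\<Union>\<F>)"
  shows "\<Union>\<F> \<in> \<F>"
  using assms
proof (induct rule: finite_induct)
  case empty
  then show ?case by (simp add: irreducible_in_lim_def)
next
  case (insert Y \<F>)
  show ?case
  proof (cases "\<F> = {}")
    case False
    have "Closed (\<Union>\<F>)" using insert(1) False insert(4)
    proof (induct rule: finite_ne_induct)
      case (insert Z \<G>)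
      then show ?case using Closed_Un[of Z "\<Union>\<G>"] by auto
    qed auto
    then have "\<Union>(insert Y \<F>) = Y \<or> \<Union>(insert Y \<F>) = \<Union>\<F>"
      using insert(4,5) unfolding irreducible_in_lim_def by auto
    then show ?thesis using insert(3,4,5) by auto
  qed simp
qed

section \<open>From orbits to the classification\<close>

text \<open>A stable closed set is the union of the members of \<^term>\<open>\<Lambda>\<close> that it contains; if it is
  proper, there are finitely many of them, which makes descending chains stationary.\<close>

definition classifies :: "(nat \<Rightarrow> 'a mat set) set set \<Rightarrow> bool" where
  "classifies \<Lambda> \<longleftrightarrow> V \<in> \<Lambda> \<and> (\<forall>Z\<in>\<Lambda>. StableClosed Z \<and> Irreducible Z) \<and>
     (\<forall>X. StableClosed X \<longrightarrow> (\<forall>v\<in>X. \<exists>Z\<in>\<Lambda>. v \<in> Z \<and> Z \<subseteq> X)) \<and>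
     (\<forall>X. StableClosed X \<longrightarrow> X \<noteq> V \<longrightarrow> finite {Z\<in>\<Lambda>. Z \<subseteq> X})"

lemma classifiesI:
  assumes "V \<in> \<Lambda>"
    and "\<And>Z. Z \<in> \<Lambda> \<Longrightarrow> StableClosed Z \<and> Irreducible Z"
    and "\<And>X v. StableClosed X \<Longrightarrow> v \<in> X \<Longrightarrow> \<exists>Z\<in>\<Lambda>. v \<in> Z \<and> Z \<subseteq> X"
    and "\<And>X. StableClosed X \<Longrightarrow> X \<noteq> V \<Longrightarrow> finite {Z\<in>\<Lambda>. Z \<subseteq> X}"
  shows "classifies \<Lambda>"
  using assms unfolding classifies_def by simp

text \<open>A stable closed set is recovered from the set of members of \<open>\<Lambda>\<close>
  below it, so a descending chain turns into a descending chain of finite sets as soon as one term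
  is proper. An irreducible set that is a finite union of members is one of them.\<close>

lemma classification:
  assumes c: "classifies \<Lambda>"
  shows "(\<forall>j. StableClosed (X j)) \<longrightarrow> (\<forall>j. X (Suc j) \<subseteq> X j) \<longrightarrow> (\<exists>N. \<forall>j\<ge>N. X j = X N)"
    "StableClosed Y \<longrightarrow> (\<exists>\<F>. finite \<F> \<and> (\<forall>Y\<in>\<F>. StableClosed Y \<and> Irreducible Y) \<and> Y = \<Union>\<F>)"
    "{X. StableClosed X \<and> Irreducible X} = \<Lambda>"
proof -
  have VL: "V \<in> \<Lambda>" and L: "\<And>Z. Z \<in> \<Lambda> \<Longrightarrow> StableClosed Z \<and> Irreducible Z"
    and orbit: "\<And>X v. StableClosed X \<Longrightarrow> v \<in> X \<Longrightarrow> \<exists>Z\<in>\<Lambda>. v \<in> Z \<and> Z \<subseteq> X"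
    and fin: "\<And>X. StableClosed X \<Longrightarrow> X \<noteq> V \<Longrightarrow> finite {Z\<in>\<Lambda>. Z \<subseteq> X}"
    using c unfolding classifies_def by simp_all
  have un: "Y = \<Union>{Z\<in>\<Lambda>. Z \<subseteq> Y}" if "StableClosed Y" for Y using orbit[OF that] by blast
  have fu: "\<exists>\<F>. finite \<F> \<and> \<F> \<subseteq> \<Lambda> \<and> Y = \<Union>\<F>" if "StableClosed Y" for Y
  proof (cases "Y = V")
    case True then show ?thesis using VL by (intro exI[of _ "{V}"]) auto
  next
    case False
    show ?thesis using fin[OF that False] un[OF that] by (intro exI[of _ "{Z\<in>\<Lambda>. Z \<subseteq> Y}"]) auto
  qed
  then show "StableClosed Y \<longrightarrow> (\<exists>\<F>. finite \<F> \<and> (\<forall>Y\<in>\<F>. StableClosed Y \<and> Irreducible Y) \<and> Y = \<Union>\<F>)"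
    using L by (meson subsetD)
  show "{X. StableClosed X \<and> Irreducible X} = \<Lambda>"
  proof (intro equalityI subsetI)
    fix X assume X: "X \<in> {X. StableClosed X \<and> Irreducible X}"
    then obtain \<F> where F: "finite \<F>" "\<F> \<subseteq> \<Lambda>" "X = \<Union>\<F>" using fu by blast
    have "Closed Z" if "Z \<in> \<F>" for Z using that F L unfolding stable_closed_def by blast
    then show "X \<in> \<Lambda>" using Irreducible_finite_Union[OF F(1)] F X by auto
  qed (use L in blast)
  show "(\<forall>j. StableClosed (X j)) \<longrightarrow> (\<forall>j. X (Suc j) \<subseteq> X j) \<longrightarrow> (\<exists>N. \<forall>j\<ge>N. X j = X N)"
  proof (intro impI)
    assume X: "\<forall>j. StableClosed (X j)" and d: "\<forall>j. X (Suc j) \<subseteq> X j"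
    have mono: "X j \<subseteq> X i" if "i \<le> j" for i j
      by (rule lift_Suc_antimono_le[of X i j]) (use d that in auto)
    define S where "S j = {Z\<in>\<Lambda>. Z \<subseteq> X j}" for j
    have XS: "X j = \<Union>(S j)" for j using un X unfolding S_def by blast
    show "\<exists>N. \<forall>j\<ge>N. X j = X N"
    proof (cases "\<exists>N0. X N0 \<noteq> V")
      case True
      then obtain N0 where N0: "X N0 \<noteq> V" by blast
      have fS: "finite (S j)" if "N0 \<le> j" for j
        by (rule finite_subset[OF _ fin[OF X[rule_format] N0]]) (use mono[OF that] in \<open>auto simp: S_def\<close>)
      \<comment> \<open>From a position of minimal cardinality on, nested finite sets cannot shrink
        any more.\<close>
      obtain N where N: "N0 \<le> N" "\<And>j. N0 \<le> j \<Longrightarrow> card (S N) \<le> card (S j)"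
        using ex_has_least_nat[of "\<lambda>j. N0 \<le> j" N0 "\<lambda>j. card (S j)"] by blast
      have "S j = S N" if "N \<le> j" for j
      proof (rule card_subset_eq)
        show "finite (S N)" by (rule fS[OF N(1)])
        show sub: "S j \<subseteq> S N" using mono[OF that] by (auto simp: S_def)
        show "card (S j) = card (S N)"
          using card_mono[OF fS[OF N(1)] sub] N(2)[of j] N(1) that by simp
      qed
      then show ?thesis using XS by metis
    qed auto
  qed
qed

end

subsection \<open>Sums of diagonal blocks\<close>

text \<open>The composite of transition maps from a level \<open>j\<close> down to a level \<open>i\<close>: the map
  \<^term>\<open>E s\<close> is the inclusion of the \<open>s\<close>-th diagonal block, and \<^term>\<open>\<sigma> s\<close> tells whether the
  group acts there by \<open>A\<close> or by its inverse transpose.\<close>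

definition block_sum :: "nat \<Rightarrow> (nat \<Rightarrow> nat \<Rightarrow> nat) \<Rightarrow> (nat \<Rightarrow> bool) \<Rightarrow> (nat \<Rightarrow> nat \<Rightarrow> 'a::field) \<Rightarrow> nat \<Rightarrow> nat \<Rightarrow> 'a" where
  "block_sum S E \<sigma> f a b = (\<Sum>s<S. if \<sigma> s then f (E s a) (E s b) else - f (E s b) (E s a))"

text \<open>At most \<open>card Q\<close>, hence at most \<open>m\<close>, columns outside
  \<open>Q\<close> escape control. The blocks are disjoint, so these columns spoil at most
  \<open>m\<close> blocks. Removing the spoilt blocks and \<open>sq\<close> from
  \<open>2 * m + 1\<close> blocks of type \<open>A\<close> leaves \<open>m\<close> of them, one for
  each column of the prescribed matrix.\<close>

lemma block_sum_controlled:
  fixes f :: "nat \<Rightarrow> nat \<Rightarrow> 'a::field" and E :: "nat \<Rightarrow> nat \<Rightarrow> nat"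
  assumes inj: "inj_on (\<lambda>(s, a). E s a) ({..<S} \<times> {..<m})" and EN: "\<And>s a. s < S \<Longrightarrow> a < m \<Longrightarrow> E s a < N"
    and m: "1 \<le> m" and S: "2 * m + 1 \<le> card {s. s < S \<and> \<sigma> s}"
    and Q: "Q \<subseteq> {..<N}" "q0 \<in> Q" "card Q \<le> m" and sq: "\<And>s a. s < S \<Longrightarrow> s \<noteq> sq \<Longrightarrow> a < m \<Longrightarrow> E s a \<notin> Q"
    and ns: "\<not> scalar_on {..<N} f"
  shows "\<exists>p h. sim N f h \<and> inj_on p {..<m} \<and> (\<forall>b<m. p b < S \<and> \<sigma> (p b) \<and> p b \<noteq> sq) \<and>
    (\<forall>b<m. \<forall>a<m. h q0 (E (p b) a) = delta a b \<and> (\<forall>q \<in> Q - {q0}. h q (E (p b) a) = 0))"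
proof -
  have EI: "s = s' \<and> a = a'" if "E s a = E s' a'" "s < S" "s' < S" "a < m" "a' < m" for s s' a a'
    using inj_onD[OF inj, of "(s, a)" "(s', a')"] that by auto
  have "card {s. s < S \<and> \<sigma> s} \<le> card {..<S}" by (rule card_mono) auto
  then have S': "2 * m + 1 \<le> S" using S by simp
  \<comment> \<open>\<open>sim_control_rows\<close> needs two indices outside \<open>Q\<close>; the
    disjoint blocks provide them.\<close>
  have "S * m = card ((\<lambda>(s, a). E s a) ` ({..<S} \<times> {..<m}))" by (simp add: card_image[OF inj])
  also have "\<dots> \<le> card {..<N}" by (rule card_mono) (use EN in auto)
  finally have "S * m \<le> N" by simp
  moreover have "(2 * m + 1) * m \<le> S * m" using S' by (rule mult_le_mono1)
  moreover have "m + 2 \<le> (2 * m + 1) * m"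
  proof -
    have "2 * 1 \<le> 2 * m * m" using m mult_le_mono[OF m m] by simp
    then show ?thesis using m by (simp add: algebra_simps)
  qed
  ultimately have "card Q + 2 \<le> N" using Q(3) by linarith
  from sim_control_rows[OF Q(1,2) this ns] obtain A where A: "A \<subseteq> {..<N} - Q" "N \<le> card A + 2 * card Q"
    and ctl: "\<And>\<beta>. \<exists>h. sim N f h \<and> (\<forall>x\<in>A. h q0 x = \<beta> x \<and> (\<forall>q \<in> Q - {q0}. h q x = 0))" by blast
  let ?B = "{..<N} - Q - A"
  have fin: "finite Q" "finite A" using finite_subset[of Q "{..<N}"] finite_subset[of A "{..<N}"] Q A by auto
  have cB: "card ?B \<le> m"
  proof -
    have "card ?B = N - card Q - card A"
      using A Q fin by (simp add: card_Diff_subset)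
    then show ?thesis using A(2) Q(3) by simp
  qed
  let ?G = "{s. s < S \<and> \<sigma> s} - {sq}"
  define bad where "bad = {s \<in> ?G. \<exists>a<m. E s a \<notin> A}"
  have "\<forall>s\<in>bad. \<exists>a<m. E s a \<notin> A" by (simp add: bad_def)
  then obtain c where c: "\<And>s. s \<in> bad \<Longrightarrow> c s < m \<and> E s (c s) \<notin> A" by metis
  have "card bad \<le> card ?B"
  proof (rule card_inj_on_le[of "\<lambda>s. E s (c s)"])
    show "inj_on (\<lambda>s. E s (c s)) bad"
    proof (rule inj_onI)
      fix s s' assume s: "s \<in> bad" "s' \<in> bad" "E s (c s) = E s' (c s')"
      then have "s < S" "s' < S" by (auto simp: bad_def)
      then show "s = s'" using EI[OF s(3)] c s by blast
    qed
    show "(\<lambda>s. E s (c s)) ` bad \<subseteq> ?B"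
    proof (rule image_subsetI)
      fix s assume s: "s \<in> bad"
      then have "s < S" "s \<noteq> sq" by (auto simp: bad_def)
      then show "E s (c s) \<in> ?B" using c[OF s] EN[of s "c s"] sq[of s "c s"] by simp
    qed
  qed simp
  then have "card bad \<le> m" using cB by simp
  moreover have "card {s. s < S \<and> \<sigma> s} \<le> Suc (card ?G)"
    using card_Suc_Diff1[of "{s. s < S \<and> \<sigma> s}" sq] by (cases "sq \<in> {s. s < S \<and> \<sigma> s}") auto
  moreover have "card (?G - bad) = card ?G - card bad" by (rule card_Diff_subset) (auto simp: bad_def)
  ultimately have "m \<le> card (?G - bad)" using S by simp
  then obtain p where p: "inj_on p {..<m}" "p ` {..<m} \<subseteq> ?G - bad"
    using card_le_inj[of "{..<m}" "?G - bad"] by auto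
  have pG: "p b < S \<and> \<sigma> (p b) \<and> p b \<noteq> sq \<and> (\<forall>a<m. E (p b) a \<in> A)" if "b < m" for b
    using p(2) that by (auto simp: bad_def)
  \<comment> \<open>On block \<open>p b\<close>, row \<open>q0\<close> is to become the unit vector
    with index \<open>b\<close>; injectivity of \<open>p\<close> makes these demands
    consistent.\<close>
  define \<beta> where "\<beta> x = (if \<exists>b<m. x = E (p b) b then 1 else 0 :: 'a)" for x
  obtain h where h: "sim N f h" "\<And>x. x \<in> A \<Longrightarrow> h q0 x = \<beta> x \<and> (\<forall>q \<in> Q - {q0}. h q x = 0)" using ctl by blast
  have "\<beta> (E (p b) a) = delta a b" if "b < m" "a < m" for a b
  proof -
    have "(\<exists>b'<m. E (p b) a = E (p b') b') \<longleftrightarrow> a = b"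
    proof
      assume "\<exists>b'<m. E (p b) a = E (p b') b'"
      then obtain b' where b': "b' < m" "E (p b) a = E (p b') b'" by blast
      then have "p b = p b'" "a = b'" using EI[OF b'(2)] pG that by auto
      then show "a = b" using p(1) that b' by (auto simp: inj_on_def)
    qed (use that in blast)
    then show ?thesis by (simp add: \<beta>_def)
  qed
  then show ?thesis using p(1) pG h by (intro exI[of _ p] exI[of _ h]) auto
qed

text \<open>Let \<open>v\<close> carry column \<open>b\<close> of \<open>D\<close> on the rows of
  block \<open>p b\<close>. As row \<open>q0\<close> is the unit vector \<open>b\<close> on that
  block, adding \<open>v\<close> times row \<open>q0\<close> puts column \<open>b\<close> of
  \<open>D\<close> into the block, and the blocks together contribute \<open>D\<close>. The inverse
  changes only column \<open>q0\<close>. Among the blocks only \<open>sq\<close> can contain this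
  index, and on the rows \<open>Q\<close> the change is the trace of \<open>D\<close> at
  \<open>q0\<close> and zero elsewhere, that is, an entry at \<open>(0, 0)\<close> of the
  block.\<close>

lemma block_sum_translate:
  fixes f D :: "nat \<Rightarrow> nat \<Rightarrow> 'a::field"
  assumes inj: "inj_on (\<lambda>(s, a). E s a) ({..<S} \<times> {..<m})" and EN: "\<And>s a. s < S \<Longrightarrow> a < m \<Longrightarrow> E s a < N"
    and q0: "q0 \<in> Q" "q0 < N"
    and sq: "\<And>s a. s < S \<Longrightarrow> s \<noteq> sq \<Longrightarrow> a < m \<Longrightarrow> E s a \<notin> Q"
    and sqQ: "\<And>a. sq < S \<Longrightarrow> a < m \<Longrightarrow> E sq a \<in> Q \<and> (E sq a = q0 \<longleftrightarrow> a = 0)"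
    and p: "inj_on p {..<m}" "\<And>b. b < m \<Longrightarrow> p b < S \<and> \<sigma> (p b) \<and> p b \<noteq> sq"
    and h: "\<And>a b. b < m \<Longrightarrow> a < m \<Longrightarrow> h q0 (E (p b) a) = delta a b"
      "\<And>a b q. b < m \<Longrightarrow> a < m \<Longrightarrow> q \<in> Q \<Longrightarrow> q \<noteq> q0 \<Longrightarrow> h q (E (p b) a) = 0"
  shows "\<exists>g. sim N h g \<and> (\<forall>a<m. \<forall>b<m. block_sum S E \<sigma> g a b = block_sum S E \<sigma> h a b + D a b +
    (if sq < S then if \<sigma> sq then -1 else 1 else 0) * (\<Sum>c<m. D c c) * (if a = 0 \<and> b = 0 then 1 else 0))"
proof -
  have EI: "s = s' \<and> a = a'" if "E s a = E s' a'" "s < S" "s' < S" "a < m" "a' < m" for s s' a a'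
    using inj_onD[OF inj, of "(s, a)" "(s', a')"] that by auto
  have pE: "E (p b) a = E (p b') a' \<longleftrightarrow> b = b' \<and> a = a'" if "b < m" "b' < m" "a < m" "a' < m" for a a' b b'
    using EI[of "p b" a "p b'" a'] p that by (auto simp: inj_on_def)
  define v where "v x = (\<Sum>b<m. \<Sum>a<m. if x = E (p b) a then D a b else 0)" for x
  have v1: "v (E (p b) a) = D a b" if "b < m" "a < m" for a b
  proof -
    have "v (E (p b) a) = (\<Sum>b'<m. \<Sum>a'<m. if b' = b then if a' = a then D a b else 0 else 0)"
      unfolding v_def by (intro sum.cong refl) (use that pE in auto)
    also have "\<dots> = (\<Sum>b'<m. if b' = b then \<Sum>a'<m. if a' = a then D a b else 0 else 0)"
      by (intro sum.cong refl) auto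
    finally show ?thesis using that by simp
  qed
  have v0: "v x = 0" if "\<And>b a. b < m \<Longrightarrow> a < m \<Longrightarrow> x \<noteq> E (p b) a" for x
    unfolding v_def by (intro sum.neutral ballI) (use that in auto)
  have vE: "v (E s a) = 0" if "s < S" "a < m" "\<And>b. b < m \<Longrightarrow> s \<noteq> p b" for s a
    by (rule v0) (use EI that p in blast)
  have vQ: "v q = 0" if "q \<in> Q" for q
    by (rule v0) (use sq p that in metis)
  define t where "t = (\<Sum>c<m. D c c)"
  have R: "(\<Sum>k<N. h i k * v k) = (if i = q0 then t else 0)" if "i \<in> Q" for i
  proof -
    have "(\<Sum>k<N. h i k * v k) = (\<Sum>k<N. \<Sum>b<m. \<Sum>a<m. if k = E (p b) a then h i k * D a b else 0)"
      unfolding v_def sum_distrib_left by (intro sum.cong refl) auto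
    also have "\<dots> = (\<Sum>b<m. \<Sum>a<m. \<Sum>k<N. if k = E (p b) a then h i k * D a b else 0)"
      by (subst sum.swap, rule sum.cong[OF refl], rule sum.swap)
    also have "\<dots> = (\<Sum>b<m. \<Sum>a<m. h i (E (p b) a) * D a b)"
      by (intro sum.cong refl) (use EN p in auto)
    also have "\<dots> = (\<Sum>b<m. \<Sum>a<m. if a = b then if i = q0 then D a b else 0 else 0)"
      by (intro sum.cong refl) (use h that in auto)
    also have "\<dots> = (\<Sum>b<m. if i = q0 then D b b else 0)" by (intro sum.cong refl) auto
    finally show ?thesis by (simp add: t_def)
  qed
  let ?g = "column_move N q0 v h"
  let ?R = "\<lambda>i. \<Sum>k<N. h i k * v k"
  have sim: "sim N h ?g" by (rule sim_column_move) (use q0 vQ in auto)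
  have g: "?g i j = h i j + v i * h q0 j - (if j = q0 then ?R i + v i * t else 0)" for i j
    using R[OF q0(1)] by (simp add: column_move_def)
  let ?e = "if sq < S then if \<sigma> sq then -1 else 1 else 0 :: 'a"
  have "block_sum S E \<sigma> ?g a b = block_sum S E \<sigma> h a b + D a b + ?e * t * (if a = 0 \<and> b = 0 then 1 else 0)"
    if ab: "a < m" "b < m" for a b
  proof -
    \<comment> \<open>Block by block: a chosen block gains one column of \<open>D\<close>, block
      \<open>sq\<close> gains the trace correction, and the others contribute as before.\<close>
    have step: "(if \<sigma> s then ?g (E s a) (E s b) else - ?g (E s b) (E s a)) =
      (if \<sigma> s then h (E s a) (E s b) else - h (E s b) (E s a)) + (\<Sum>b'<m. if s = p b' then D a b' * delta b b' else 0)
      + (if s = sq then (if \<sigma> s then -1 else 1) * t * (if a = 0 \<and> b = 0 then 1 else 0) else 0)" if s: "s < S" for s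
    proof (cases "\<exists>b'<m. s = p b'")
      case True
      then obtain b' where b': "b' < m" "s = p b'" by blast
      have "E s b \<noteq> q0" using sq[OF s _ ab(2)] p(2)[OF b'(1)] b' q0 by auto
      moreover have "(\<Sum>b''<m. if s = p b'' then D a b'' * delta b b'' else 0) = (\<Sum>b''<m. if b'' = b' then D a b'' * delta b b'' else 0)"
        by (intro sum.cong refl) (use b' p(1) in \<open>auto simp: inj_on_def\<close>)
      ultimately show ?thesis using b' p(2)[OF b'(1)] ab h(1)[OF b'(1) ab(2)] v1[OF b'(1) ab(1)] by (simp add: g)
    next
      case False
      then have vs: "v (E s a) = 0" "v (E s b) = 0" using vE[OF s] ab by auto
      have z: "(\<Sum>b'<m. if s = p b' then D a b' * delta b b' else 0) = 0" using False by (intro sum.neutral) auto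
      show ?thesis
      proof (cases "s = sq")
        case True
        then have Q: "E s a \<in> Q" "E s b \<in> Q" "E s a = q0 \<longleftrightarrow> a = 0" "E s b = q0 \<longleftrightarrow> b = 0" using sqQ s ab by auto
        show ?thesis unfolding z g vs using True Q R[OF Q(1)] R[OF Q(2)] by auto
      next
        case F: False
        have "E s a \<noteq> q0" "E s b \<noteq> q0" using sq[OF s F] ab q0 by auto
        then show ?thesis unfolding z g vs using F by simp
      qed
    qed
    have "(\<Sum>s<S. \<Sum>b'<m. if s = p b' then D a b' * delta b b' else 0) = (\<Sum>b'<m. \<Sum>s<S. if s = p b' then D a b' * delta b b' else 0)"
      by (rule sum.swap)
    also have "\<dots> = (\<Sum>b'<m. D a b' * delta b b')" by (intro sum.cong refl) (use p(2) in auto)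
    also have "\<dots> = (\<Sum>b'<m. if b' = b then D a b' else 0)" by (intro sum.cong refl) auto
    finally have 1: "(\<Sum>s<S. \<Sum>b'<m. if s = p b' then D a b' * delta b b' else 0) = D a b" using ab by simp
    have 2: "(\<Sum>s<S. if s = sq then (if \<sigma> s then -1 else 1) * t * (if a = 0 \<and> b = 0 then 1 else 0) else 0) =
       ?e * t * (if a = 0 \<and> b = 0 then 1 else 0 :: 'a)"
      by simp
    have "block_sum S E \<sigma> ?g a b = (\<Sum>s<S. (if \<sigma> s then h (E s a) (E s b) else - h (E s b) (E s a)) + (\<Sum>b'<m. if s = p b' then D a b' * delta b b' else 0)
      + (if s = sq then (if \<sigma> s then -1 else 1) * t * (if a = 0 \<and> b = 0 then 1 else 0) else 0))"
      unfolding block_sum_def by (rule sum.cong[OF refl]) (use step in auto)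
    also have "\<dots> = block_sum S E \<sigma> h a b + D a b + ?e * t * (if a = 0 \<and> b = 0 then 1 else 0)"
      unfolding sum.distrib 1 2 by (simp add: block_sum_def)
    finally show ?thesis .
  qed
  then show ?thesis unfolding t_def[symmetric] using sim by blast
qed

lemma sum_div_mod:
  fixes h :: "nat \<Rightarrow> nat \<Rightarrow> 'b::comm_monoid_add"
  shows "(\<Sum>x<K * S. h (x div S) (x mod S)) = (\<Sum>k<K. \<Sum>s<S. h k s)"
proof (cases "S = 0")
  case False
  have "(\<Sum>x\<in>{k * S..<k * S + S}. h (x div S) (x mod S)) = (\<Sum>s<S. h k s)" for k
  proof -
    have "(\<Sum>x\<in>{k * S..<k * S + S}. h (x div S) (x mod S)) = (\<Sum>s\<in>{0..<S}. h ((s + k * S) div S) ((s + k * S) mod S))"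
      using sum.shift_bounds_nat_ivl[of "\<lambda>x. h (x div S) (x mod S)" 0 "k * S" S] by (simp add: add.commute)
    then show ?thesis using False by (simp add: lessThan_atLeast0)
  qed
  then show ?thesis using sum.nat_group[of "\<lambda>x. h (x div S) (x mod S)" S K] by simp
qed simp

subsection \<open>Composite embeddings\<close>

context diag_sequence
begin

lemma n_mono: "i \<le> j \<Longrightarrow> n i \<le> n j"
proof (rule lift_Suc_mono_le[of n])
  fix i show "n i \<le> n (Suc i)"
  proof -
    have "1 * n i \<le> (l i + r i) * n i" by (rule mult_le_mono1) (use l_pos[of i] in simp)
    then show ?thesis unfolding n_Suc by linarith
  qed
qed

lemma V_rep_fun: assumes "v \<in> V" obtains f where "v i = cls (n i) (fmat (n i) f)"
proof -
  obtain P where "P \<in> sqmat (n i)" "v i = cls (n i) P" by (rule V_rep[OF assms])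
  then show ?thesis using that[of "\<lambda>a b. P $$ (a, b)"] by (simp add: fmat_of_carrier)
qed

lemma exists_V_above:
  assumes g: "\<And>j. i \<le> j \<Longrightarrow> x j \<in> gl_mod (n j)" and t: "\<And>j. i \<le> j \<Longrightarrow> tr j (x (Suc j)) = x j"
  shows "\<exists>v\<in>V. \<forall>j\<ge>i. v j = x j"
proof -
  \<comment> \<open>\<open>D d\<close> is the component at level \<open>i - d\<close>, forced by the
    transition maps.\<close>
  define D where "D = rec_nat (x i) (\<lambda>d y. tr (i - Suc d) y)"
  have D: "D 0 = x i" "\<And>d. D (Suc d) = tr (i - Suc d) (D d)" by (simp_all add: D_def)
  define v where "v j = (if i \<le> j then x j else D (i - j))" for j
  have vt: "tr j (v (Suc j)) = v j" for j
  proof (cases "i \<le> j")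
    case True then show ?thesis using t by (simp add: v_def)
  next
    case False
    then have e: "i - j = Suc (i - Suc j)" "i - Suc (i - Suc j) = j" by auto
    have "v (Suc j) = D (i - Suc j)" using False D(1) by (cases "i = Suc j") (auto simp: v_def)
    then show ?thesis using False D(2)[of "i - Suc j"] by (simp add: v_def e)
  qed
  have "v j \<in> gl_mod (n j)" for j
  proof (cases "i \<le> j")
    case True then show ?thesis using g by (simp add: v_def)
  next
    case False
    then have "j \<le> i" by simp
    then show ?thesis
    proof (induct j rule: inc_induct)
      case base then show ?case using g by (simp add: v_def)
    next
      case (step q) then show ?case using tr_gl[of "v (Suc q)" q] vt[of q] by simp
    qed
  qed
  then have "v \<in> V" using vt by (simp add: inv_lim_def)
  then show ?thesis by (intro bexI[of _ v]) (auto simp: v_def)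
qed

text \<open>Because \<open>l' \<ge> 1\<close>, the first diagonal block enters the transition with a
  plus sign and untransposed. Padding by zeros is thus a section of all transition maps, and one
  that does not raise the rank.\<close>

lemma trans_mat_zero_pad:
  assumes m: "m \<le> N" and l: "1 \<le> l'"
  shows "trans_mat N l' r' (zero_pad m ((l' + r') * N + z') M) = zero_pad m N (M :: 'a mat)"
proof (rule eq_matI)
  let ?L = "(l' + r') * N + z'"
  fix a b assume "a < dim_row (zero_pad m N M)" "b < dim_col (zero_pad m N M)"
  then have ab: "a < N" "b < N" by (auto simp: zero_pad_def)
  have bd: "k * N + c < ?L" if "k < l' + r'" "c < N" for k c using block_bound that by blast
  have out: "zero_pad m ?L M $$ (k * N + c, k * N + d) = 0" if "0 < k" "k < l' + r'" "c < N" "d < N" for k c d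
  proof -
    have "1 * N \<le> k * N" by (rule mult_le_mono1) (use that(1) in simp)
    then have "m \<le> k * N + c" using m by linarith
    then show ?thesis using bd[OF that(2,3)] bd[OF that(2,4)] by (simp add: zero_pad_def)
  qed
  have 1: "(\<Sum>k<l'. zero_pad m ?L M $$ (k * N + a, k * N + b)) = (\<Sum>k<l'. if k = 0 then zero_pad m ?L M $$ (a, b) else 0)"
  proof (rule sum.cong[OF refl])
    fix k assume "k \<in> {..<l'}"
    then show "zero_pad m ?L M $$ (k * N + a, k * N + b) = (if k = 0 then zero_pad m ?L M $$ (a, b) else 0)"
      using out[of k a b] ab by simp
  qed
  have 2: "(\<Sum>k<r'. zero_pad m ?L M $$ ((l' + k) * N + b, (l' + k) * N + a)) = 0"
  proof (rule sum.neutral, rule ballI)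
    fix k assume "k \<in> {..<r'}"
    then show "zero_pad m ?L M $$ ((l' + k) * N + b, (l' + k) * N + a) = 0"
      by (intro out) (use ab l in auto)
  qed
  have "a < ?L" "b < ?L" using bd[of 0] ab l by auto
  then show "trans_mat N l' r' (zero_pad m ?L M) $$ (a, b) = zero_pad m N M $$ (a, b)"
    unfolding trans_mat_index[OF ab] 1 2 using ab l by (simp add: zero_pad_def)
qed (auto simp: trans_mat_def zero_pad_def)

lemma exists_V_zero_pad:
  assumes M: "M \<in> sqmat (n i)"
  shows "\<exists>v\<in>V. \<forall>j\<ge>i. v j = cls (n j) (zero_pad (n i) (n j) M)"
proof (rule exists_V_above)
  fix j assume j: "i \<le> j"
  show "cls (n j) (zero_pad (n i) (n j) M) \<in> gl_mod (n j)" by (rule cls_in_gl_mod) simp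
  show "tr j (cls (n (Suc j)) (zero_pad (n i) (n (Suc j)) M)) = cls (n j) (zero_pad (n i) (n j) M)"
    unfolding tr_cls[OF zero_pad_carrier] unfolding n_Suc
    by (simp add: trans_mat_zero_pad[OF n_mono[OF j] l_pos])
qed

lemma V_surj: assumes "M \<in> sqmat (n i)" shows "\<exists>v\<in>V. v i = cls (n i) M"
proof -
  obtain v where "v \<in> V" "v i = cls (n i) (zero_pad (n i) (n i) M)" using exists_V_zero_pad[OF assms] by blast
  then show ?thesis using zero_pad_self[OF assms] by auto
qed

lemma zero_point_in_V: "(zero_point n :: nat \<Rightarrow> 'a mat set) \<in> V"
proof -
  obtain v where v: "v \<in> V" "\<And>j. v j = cls (n j) (zero_pad (n 0) (n j) (0\<^sub>m (n 0) (n 0)))"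
    using exists_V_zero_pad[of "0\<^sub>m (n 0) (n 0)" 0] by auto
  have "zero_pad (n 0) (n j) (0\<^sub>m (n 0) (n 0)) = (0\<^sub>m (n j) (n j) :: 'a mat)" for j
    by (rule eq_matI) (auto simp: zero_pad_def)
  then have "v = zero_point n" using v(2) by (intro ext) (simp add: zero_point_def)
  then show ?thesis using v(1) by simp
qed

lemma StableClosed_V: "StableClosed V"
proof (rule StableClosedI)
  show "Stable V" by (rule StableI) auto
qed (auto simp: zclosure_def)

lemma curve_line:
  fixes P Q :: "'a mat"
  assumes "P \<in> sqmat m" "Q \<in> sqmat m"
  shows "curve P (Q - P) (0\<^sub>m m m) 0 = P" "curve P (Q - P) (0\<^sub>m m m) 1 = Q"
  using assms by (auto intro!: eq_matI)

lemma Irreducible_by_lines: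
  assumes X: "X \<subseteq> V" "X \<noteq> {}"
    and line: "\<And>i P Q v w t. i0 \<le> i \<Longrightarrow> v \<in> X \<Longrightarrow> w \<in> X \<Longrightarrow> P \<in> sqmat (n i) \<Longrightarrow> Q \<in> sqmat (n i) \<Longrightarrow>
      v i = cls (n i) P \<Longrightarrow> w i = cls (n i) Q \<Longrightarrow> \<exists>x\<in>X. x i = cls (n i) (curve P (Q - P) (0\<^sub>m (n i) (n i)) t)"
  shows "Irreducible X"
proof (rule IrreducibleI[OF X, of i0])
  fix i v w assume i: "i0 \<le> i" and vw: "v \<in> X" "w \<in> X"
  obtain P where P: "P \<in> sqmat (n i)" "v i = cls (n i) P" by (rule V_rep[OF subsetD[OF X(1) vw(1)]])
  obtain Q where Q: "Q \<in> sqmat (n i)" "w i = cls (n i) Q" by (rule V_rep[OF subsetD[OF X(1) vw(2)]])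
  have "v i = cls (n i) (curve P (Q - P) (0\<^sub>m (n i) (n i)) 0)" "w i = cls (n i) (curve P (Q - P) (0\<^sub>m (n i) (n i)) 1)"
    unfolding curve_line[OF P(1) Q(1)] by (rule P(2), rule Q(2))
  moreover have "\<forall>t. \<exists>x\<in>X. x i = cls (n i) (curve P (Q - P) (0\<^sub>m (n i) (n i)) t)"
    using line[OF i vw P(1) Q(1) P(2) Q(2)] by blast
  ultimately show "curve_connected i X (v i) (w i)"
    unfolding curve_connected_def using P(1) minus_carrier_mat[OF P(1), of Q] zero_carrier_mat[of "n i" "n i"] by blast
qed

lemma Irreducible_V: "Irreducible V"
proof (rule Irreducible_by_lines)
  show "V \<noteq> {}" using zero_point_in_V by blast
  show "\<exists>x\<in>V. x i = cls (n i) (curve P (Q - P) (0\<^sub>m (n i) (n i)) t)"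
    if "P \<in> sqmat (n i)" "Q \<in> sqmat (n i)" for i P Q t
    by (rule V_surj) (use that in auto)
qed simp

lemma StableClosed_zero: "StableClosed {zero_point n}"
proof (rule StableClosedI)
  show "{zero_point n} \<subseteq> V" using zero_point_in_V by blast
  show "Stable {zero_point n}"
  proof (rule StableI)
    fix v w i and A :: "nat \<Rightarrow> 'a mat"
    assume v: "v \<in> {zero_point n}" and w: "w \<in> V"
      and A: "\<And>j. i \<le> j \<Longrightarrow> A j \<in> carrier (SL (n j)) \<and> w j = conj_act (A j) (v j)"
    have e: "w j = zero_point n j" if "i \<le> j" for j
    proof -
      have Aj: "A j \<in> carrier (SL (n j))" using A that by blast
      then have c: "A j \<in> sqmat (n j)" "mat_inv (A j) \<in> sqmat (n j)"
        using mat_inv(1)[OF Aj] by (auto simp: SL_simps)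
      have "w j = conj_act (A j) (cls (n j) (0\<^sub>m (n j) (n j)))" using A[OF that] v by (simp add: zero_point_def)
      also have "\<dots> = cls (n j) (A j * 0\<^sub>m (n j) (n j) * mat_inv (A j))" by (rule conj_act_cls[OF Aj]) simp
      also have "A j * 0\<^sub>m (n j) (n j) * mat_inv (A j) = 0\<^sub>m (n j) (n j)" using c by simp
      finally show ?thesis by (simp add: zero_point_def)
    qed
    have "w j = zero_point n j" for j
      by (rule V_down[OF w zero_point_in_V, of "max i j"]) (use e in auto)
    then show "w \<in> {zero_point n}" by auto
  qed (use zero_point_in_V in blast)
  show "zclosure {zero_point n} \<subseteq> {zero_point n}"
  proof
    fix v assume v: "v \<in> zclosure {zero_point n}"
    then have vV: "v \<in> V" by (simp add: zclosure_def)
    have "v i = zero_point n i" for i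
    proof -
      obtain P where P: "P \<in> sqmat (n i)" "v i = cls (n i) P" by (rule V_rep[OF vV])
      have "\<phi> (cls (n i) P) = 0" if "linear_fun (n i) \<phi>" for \<phi>
      proof -
        have "\<phi> (zero_point n i) = 0" using linear_fun_zero[OF that] by (simp add: zero_point_def)
        moreover have "\<forall>f \<in> poly_fun (n i). (\<forall>s\<in>{zero_point n}. f (s i) = 0) \<longrightarrow> f (v i) = 0"
          using v by (simp add: zclosure_def)
        ultimately have "\<phi> (v i) = 0" using poly_fun.linear[OF that] by blast
        then show ?thesis using P(2) by simp
      qed
      then show ?thesis using cls_eq_zero[OF P(1)] P(2) by (simp add: zero_point_def)
    qed
    then show "v \<in> {zero_point n}" by auto
  qed
qed

lemma Irreducible_singleton: "Irreducible {x}"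
  unfolding irreducible_in_lim_def by blast

section \<open>Counting the blocks of a composite embedding\<close>

text \<open>Stated for points of \<open>V\<close> and arbitrary representatives, so that steps
  compose without keeping track of the scalar ambiguity.\<close>

definition blocks :: "nat \<Rightarrow> nat \<Rightarrow> nat \<Rightarrow> (nat \<Rightarrow> nat \<Rightarrow> nat) \<Rightarrow> (nat \<Rightarrow> bool) \<Rightarrow> bool" where
  "blocks i j S E \<sigma> \<longleftrightarrow> inj_on (\<lambda>(s, a). E s a) ({..<S} \<times> {..<n i}) \<and> (\<forall>s<S. \<forall>a<n i. E s a < n j) \<and>
     (\<forall>v\<in>V. \<forall>f. v j = cls (n j) (fmat (n j) f) \<longrightarrow> v i = cls (n i) (fmat (n i) (block_sum S E \<sigma> f)))"

lemma blocks_refl: "blocks i i 1 (\<lambda>s a. a) (\<lambda>s. True)"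
  unfolding blocks_def block_sum_def by (auto simp: inj_on_def)

text \<open>Block \<open>x = k * S + s\<close> is the old block \<open>s\<close> inside the
  \<open>k\<close>-th block of the last step. Two inverse transposes cancel, so the type of
  \<open>x\<close> is \<open>A\<close> exactly if both steps have the same type.\<close>

lemma blocks_Suc:
  assumes b: "blocks i j S E \<sigma>"
  shows "blocks i (Suc j) ((l j + r j) * S) (\<lambda>x a. (x div S) * n j + E (x mod S) a) (\<lambda>x. \<sigma> (x mod S) = (x div S < l j))"
proof -
  let ?K = "l j + r j" let ?N = "n j"
  let ?E = "\<lambda>x a. (x div S) * n j + E (x mod S) a" let ?\<sigma> = "\<lambda>x. \<sigma> (x mod S) = (x div S < l j)"
  from b have inj: "inj_on (\<lambda>(s, a). E s a) ({..<S} \<times> {..<n i})" and EN: "\<And>s a. s < S \<Longrightarrow> a < n i \<Longrightarrow> E s a < ?N"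
    and im: "\<And>v f. v \<in> V \<Longrightarrow> v j = cls ?N (fmat ?N f) \<Longrightarrow> v i = cls (n i) (fmat (n i) (block_sum S E \<sigma> f))"
    unfolding blocks_def by auto
  have dm: "x div S < ?K \<and> x mod S < S" if "x < ?K * S" for x
  proof -
    have "S > 0" using that by (cases S) auto
    then show ?thesis using that by (simp add: less_mult_imp_div_less)
  qed
  have "inj_on (\<lambda>(s, a). ?E s a) ({..<?K * S} \<times> {..<n i})"
  proof (rule inj_onI, clarsimp)
    fix x a y c assume x: "x < ?K * S" "a < n i" and y: "y < ?K * S" "c < n i"
      and e: "x div S * n j + E (x mod S) a = y div S * n j + E (y mod S) c"
    have "E (x mod S) a < ?N" "E (y mod S) c < ?N" using EN dm x y by auto
    then have "x div S = y div S" "E (x mod S) a = E (y mod S) c"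
      using e div_block[of "E (x mod S) a" ?N "x div S"] div_block[of "E (y mod S) c" ?N "y div S"] by metis+
    moreover from this have "x mod S = y mod S \<and> a = c"
      using inj_onD[OF inj, of "(x mod S, a)" "(y mod S, c)"] dm x y by auto
    ultimately show "x = y \<and> a = c" by (metis div_mult_mod_eq)
  qed
  moreover have "?E x a < n (Suc j)" if "x < ?K * S" "a < n i" for x a
    unfolding n_Suc by (rule block_bound) (use dm[OF that(1)] EN that in auto)
  moreover have "v i = cls (n i) (fmat (n i) (block_sum (?K * S) ?E ?\<sigma> f))"
    if v: "v \<in> V" and f: "v (Suc j) = cls (n (Suc j)) (fmat (n (Suc j)) f)" for v f
  proof -
    define Q where "Q x y = (\<Sum>k<?K. if k < l j then f (k * ?N + x) (k * ?N + y) else - f (k * ?N + y) (k * ?N + x))" for x y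
    have "trans_mat ?N (l j) (r j) (fmat (n (Suc j)) f) = fmat ?N Q"
    proof (rule eq_matI)
      fix a c assume "a < dim_row (fmat ?N Q)" "c < dim_col (fmat ?N Q)"
      then have ac: "a < ?N" "c < ?N" by auto
      have bd: "k * ?N + x < n (Suc j)" if "k < ?K" "x < ?N" for k x unfolding n_Suc using block_bound that by blast
      have 1: "(\<Sum>k<l j. fmat (n (Suc j)) f $$ (k * ?N + a, k * ?N + c)) = (\<Sum>k<l j. f (k * ?N + a) (k * ?N + c))"
        by (intro sum.cong refl) (use bd ac in auto)
      have 2: "(\<Sum>k<r j. fmat (n (Suc j)) f $$ ((l j + k) * ?N + c, (l j + k) * ?N + a)) = (\<Sum>k<r j. f ((l j + k) * ?N + c) ((l j + k) * ?N + a))"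
        by (intro sum.cong refl) (use bd ac in auto)
      let ?h = "\<lambda>k. if k < l j then f (k * ?N + a) (k * ?N + c) else - f (k * ?N + c) (k * ?N + a)"
      have "Q a c = (\<Sum>k\<in>{0..<l j}. ?h k) + (\<Sum>k\<in>{l j..<?K}. ?h k)"
        unfolding Q_def lessThan_atLeast0 by (rule sum.atLeastLessThan_concat[symmetric]) auto
      also have "(\<Sum>k\<in>{0..<l j}. ?h k) = (\<Sum>k<l j. f (k * ?N + a) (k * ?N + c))"
        unfolding lessThan_atLeast0 by (intro sum.cong refl) auto
      also have "(\<Sum>k\<in>{l j..<?K}. ?h k) = (\<Sum>k<r j. - f ((l j + k) * ?N + c) ((l j + k) * ?N + a))"
        using sum.shift_bounds_nat_ivl[of ?h 0 "l j" "r j"] by (simp add: lessThan_atLeast0 add.commute)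
      finally show "trans_mat ?N (l j) (r j) (fmat (n (Suc j)) f) $$ (a, c) = fmat ?N Q $$ (a, c)"
        unfolding trans_mat_index[OF ac] 1 2 using ac by (simp add: sum_negf)
    qed (auto simp: trans_mat_def)
    then have "v j = cls ?N (fmat ?N Q)" using V_tr[OF v, of j] tr_cls[OF fmat_carrier, of j f] f by simp
    from im[OF v this] have "v i = cls (n i) (fmat (n i) (block_sum S E \<sigma> Q))" .
    moreover have "block_sum S E \<sigma> Q a c = block_sum (?K * S) ?E ?\<sigma> f a c" for a c
    proof -
      let ?g = "\<lambda>k s. if \<sigma> s = (k < l j) then f (k * ?N + E s a) (k * ?N + E s c) else - f (k * ?N + E s c) (k * ?N + E s a)"
      have "block_sum S E \<sigma> Q a c = (\<Sum>s<S. \<Sum>k<?K. ?g k s)"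
        unfolding block_sum_def Q_def sum_negf[symmetric] if_distrib[where f = uminus]
        by (intro sum.cong refl) (auto intro!: sum.cong)
      also have "\<dots> = (\<Sum>k<?K. \<Sum>s<S. ?g k s)" by (rule sum.swap)
      also have "\<dots> = (\<Sum>x<?K * S. ?g (x div S) (x mod S))" by (rule sum_div_mod[symmetric])
      finally show ?thesis unfolding block_sum_def .
    qed
    ultimately show ?thesis by presburger
  qed
  ultimately show ?thesis unfolding blocks_def by simp
qed

text \<open>\<open>p\<close> blocks \<open>A\<close>, \<open>q\<close> blocks that are its inverse transpose and, if \<open>w\<close> holds, an index
  outside all of them.\<close>

definition block_counts :: "nat \<Rightarrow> nat \<Rightarrow> nat \<Rightarrow> nat \<Rightarrow> bool \<Rightarrow> bool" where
  "block_counts i j p q w \<longleftrightarrow> (\<exists>S E \<sigma>. blocks i j S E \<sigma> \<and> card {s. s < S \<and> \<sigma> s} = p \<and> card {s. s < S \<and> \<not> \<sigma> s} = q \<and>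
     (w \<longrightarrow> (\<exists>\<zeta><n j. \<forall>s<S. \<forall>a<n i. E s a \<noteq> \<zeta>)))"

lemma block_counts_refl: "block_counts i i 1 0 False"
  unfolding block_counts_def
  by (intro exI[of _ 1] exI[of _ "\<lambda>s a. a"] exI[of _ "\<lambda>s. True"] conjI blocks_refl) simp_all

lemma card_filter_eq_sum: "card {s. s < (S::nat) \<and> P s} = (\<Sum>s<S. if P s then 1 else 0)"
proof -
  have "{s. s < S \<and> P s} = {s \<in> {..<S}. P s}" by auto
  then have "card {s. s < S \<and> P s} = (\<Sum>s\<in>{s \<in> {..<S}. P s}. 1)" by simp
  also have "\<dots> = (\<Sum>s<S. if P s then 1 else 0)" by (rule sum.inter_filter) simp
  finally show ?thesis .
qed

text \<open>If \<open>z j > 0\<close>, the first index after all \<open>l j + r j\<close> copies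
  lies in no block; an uncovered index of level \<open>j\<close> stays uncovered in the first
  copy.\<close>

lemma block_counts_Suc:
  assumes "block_counts i j p q w"
  shows "block_counts i (Suc j) (l j * p + r j * q) (r j * p + l j * q) (w \<or> 0 < z j)"
proof -
  from assms obtain S E \<sigma> where b: "blocks i j S E \<sigma>" and p: "card {s. s < S \<and> \<sigma> s} = p"
    and q: "card {s. s < S \<and> \<not> \<sigma> s} = q" and w: "w \<Longrightarrow> \<exists>\<zeta><n j. \<forall>s<S. \<forall>a<n i. E s a \<noteq> \<zeta>"
    unfolding block_counts_def by auto
  let ?K = "l j + r j"
  let ?E = "\<lambda>x a. (x div S) * n j + E (x mod S) a" let ?\<sigma> = "\<lambda>x. \<sigma> (x mod S) = (x div S < l j)"
  have split: "(\<Sum>k<?K. if k < l j then x else y) = l j * x + r j * y" for x y :: nat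
  proof -
    have e: "{..<?K} \<inter> {k. k < l j} = {..<l j}" "{..<?K} \<inter> - {k. k < l j} = {l j..<?K}" by auto
    show ?thesis by (simp add: sum.If_cases e)
  qed
  have "card {x. x < ?K * S \<and> ?\<sigma> x} = (\<Sum>k<?K. \<Sum>s<S. if \<sigma> s = (k < l j) then 1 else 0)"
    unfolding card_filter_eq_sum by (rule sum_div_mod)
  also have "\<dots> = (\<Sum>k<?K. if k < l j then p else q)"
    by (intro sum.cong refl) (simp add: p[symmetric] q[symmetric] card_filter_eq_sum)
  finally have 1: "card {x. x < ?K * S \<and> ?\<sigma> x} = l j * p + r j * q" unfolding split .
  have "card {x. x < ?K * S \<and> \<not> ?\<sigma> x} = (\<Sum>k<?K. \<Sum>s<S. if \<not> (\<sigma> s = (k < l j)) then 1 else 0)"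
    unfolding card_filter_eq_sum by (rule sum_div_mod)
  also have "\<dots> = (\<Sum>k<?K. if k < l j then q else p)"
    by (intro sum.cong refl) (simp add: p[symmetric] q[symmetric] card_filter_eq_sum)
  finally have 2: "card {x. x < ?K * S \<and> \<not> ?\<sigma> x} = r j * p + l j * q" unfolding split by simp
  have dm: "x div S < ?K \<and> x mod S < S" if "x < ?K * S" for x
  proof -
    have "S > 0" using that by (cases S) auto
    then show ?thesis using that by (simp add: less_mult_imp_div_less)
  qed
  have EN: "E s a < n j" if "s < S" "a < n i" for s a using b that unfolding blocks_def by blast
  have "\<exists>\<zeta><n (Suc j). \<forall>x<?K * S. \<forall>a<n i. ?E x a \<noteq> \<zeta>" if wz: "w \<or> 0 < z j"
  proof (cases "0 < z j")
    case True
    have "?E x a < ?K * n j" if "x < ?K * S" "a < n i" for x a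
      using block_bound[of "x div S" ?K "E (x mod S) a" "n j" 0] dm[OF that(1)] EN that by simp
    then have "?E x a \<noteq> ?K * n j" if "x < ?K * S" "a < n i" for x a using that by (metis less_irrefl)
    moreover have "?K * n j < n (Suc j)" using True by (simp add: n_Suc)
    ultimately show ?thesis by blast
  next
    case False
    then have "w" using wz by simp
    from w[OF this] obtain \<zeta> where \<zeta>: "\<zeta> < n j" "\<forall>s<S. \<forall>a<n i. E s a \<noteq> \<zeta>" by blast
    have "?E x a \<noteq> \<zeta>" if "x < ?K * S" "a < n i" for x a
    proof
      assume e: "?E x a = \<zeta>"
      have "E (x mod S) a < n j" using dm[OF that(1)] EN that by blast
      then have "(?E x a) mod n j = E (x mod S) a" by (rule div_block(2))
      then have "E (x mod S) a = \<zeta>" using e \<zeta>(1) by simp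
      then show False using \<zeta>(2) dm[OF that(1)] that(2) by blast
    qed
    moreover have "\<zeta> < n (Suc j)" using \<zeta>(1) n_mono[of j "Suc j"] by simp
    ultimately show ?thesis by blast
  qed
  then show ?thesis unfolding block_counts_def
    by (intro exI[of _ "?K * S"] exI[of _ ?E] exI[of _ ?\<sigma>] conjI blocks_Suc[OF b] 1 2) blast
qed

text \<open>Only lower bounds are propagated. The condition \<open>q \<le> p\<close> guarantees that
  at least half of the blocks have type \<open>A\<close>.\<close>

definition many_blocks :: "nat \<Rightarrow> nat \<Rightarrow> nat \<Rightarrow> nat \<Rightarrow> bool \<Rightarrow> bool" where
  "many_blocks i j B C w \<longleftrightarrow> (\<exists>p q w'. block_counts i j p q w' \<and> B \<le> p + q \<and> q \<le> p \<and> C \<le> q \<and> 1 \<le> p \<and> (w \<longrightarrow> w'))"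

lemma many_blocks_refl: "many_blocks i i 1 0 False"
  unfolding many_blocks_def using block_counts_refl by fastforce

lemma many_blocks_step:
  assumes "many_blocks i j B C w"
  shows "many_blocks i (Suc j) ((l j + r j) * B) (if 0 < r j then max 1 C else C) (w \<or> 0 < z j)"
proof -
  from assms obtain p q w' where c: "block_counts i j p q w'" and h: "B \<le> p + q" "q \<le> p" "C \<le> q" "1 \<le> p" "w \<longrightarrow> w'"
    unfolding many_blocks_def by blast
  have "(l j + r j) * B \<le> (l j + r j) * (p + q)" using h(1) by (rule mult_le_mono2)
  also have "\<dots> = (l j * p + r j * q) + (r j * p + l j * q)" by (simp add: algebra_simps)
  finally have 1: "(l j + r j) * B \<le> (l j * p + r j * q) + (r j * p + l j * q)" .
  have 2: "r j * p + l j * q \<le> l j * p + r j * q"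
  proof -
    \<comment> \<open>The two new counts differ by \<open>(l j - r j) * (p - q)\<close>; here the
      assumption \<open>r \<le> l\<close> enters.\<close>
    obtain d where d: "l j = r j + d" using r_le_l[of j] le_Suc_ex by blast
    have "d * q \<le> d * p" using h(2) by simp
    then show ?thesis unfolding d by (simp add: algebra_simps)
  qed
  have lq: "x \<le> l j * x" for x using mult_le_mono1[OF l_pos, of x j] by (simp only: mult_1)
  have 3: "(if 0 < r j then max 1 C else C) \<le> r j * p + l j * q"
  proof (cases "0 < r j")
    case True
    then have "1 * p \<le> r j * p" by (intro mult_le_mono1) simp
    then have "1 \<le> r j * p + l j * q" "C \<le> r j * p + l j * q" using h lq[of q] by linarith+
    then show ?thesis unfolding if_P[OF True] by (rule max.boundedI)
  next
    case False
    have "C \<le> r j * p + l j * q" using h lq[of q] by linarith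
    then show ?thesis unfolding if_not_P[OF False] .
  qed
  have 4: "1 \<le> l j * p + r j * q" using lq[of p] h by linarith
  show ?thesis unfolding many_blocks_def using block_counts_Suc[OF c] 1 2 3 4 h(5) by blast
qed

lemma many_blocks_weaken:
  "many_blocks i j B C w \<Longrightarrow> B' \<le> B \<Longrightarrow> C' \<le> C \<Longrightarrow> (w' \<longrightarrow> w) \<Longrightarrow> many_blocks i j B' C' w'"
  unfolding many_blocks_def by (meson le_trans)

lemma many_blocks_mono:
  assumes "many_blocks i j B C w" "j \<le> k"
  shows "many_blocks i k B C w"
  using assms(2)
proof (induct k rule: dec_induct)
  case (step k)
  show ?case
    by (rule many_blocks_weaken[OF many_blocks_step[OF step(3)]]) (use l_pos[of k] in auto)
qed (rule assms(1))

lemma many_blocks_grow: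
  assumes "infinite {i. 1 < l i \<or> 0 < r i}"
  shows "\<exists>j\<ge>i. many_blocks i j B 0 False"
proof (induct B)
  case 0
  then show ?case using many_blocks_weaken[OF many_blocks_refl] by blast
next
  case (Suc B)
  then obtain j where j: "i \<le> j" "many_blocks i j B 0 False" by blast
  show ?case
  proof (cases "B = 0")
    case True then show ?thesis using many_blocks_refl by auto
  next
    case False
    obtain k where k: "j \<le> k" "1 < l k \<or> 0 < r k" using assms unfolding infinite_nat_iff_unbounded_le by blast
    have "2 \<le> l k + r k" using k l_pos[of k] by auto
    then have "2 * B \<le> (l k + r k) * B" by (rule mult_le_mono1)
    then have "Suc B \<le> (l k + r k) * B" using False by linarith
    then have "many_blocks i (Suc k) (Suc B) 0 False"
      by (intro many_blocks_weaken[OF many_blocks_step[OF many_blocks_mono[OF j(2) k(1)]]]) auto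
    then show ?thesis using j k by (intro exI[of _ "Suc k"]) auto
  qed
qed

end

subsection \<open>Orbits of nonzero points\<close>

lemma mat_trace_fmat: "mat_trace (fmat m f) = (\<Sum>a<m. f a a)"
  by (simp add: mat_trace_def)

lemma mat_trace_linear:
  assumes "P \<in> sqmat m"
  shows "Q \<in> sqmat m \<Longrightarrow> mat_trace (P + Q) = mat_trace P + mat_trace Q"
    "mat_trace (c \<cdot>\<^sub>m P) = c * mat_trace P"
  using assms by (auto simp: mat_trace_def sum.distrib sum_distrib_left)

lemma mat_trace_mult_comm:
  assumes A: "A \<in> sqmat m" and B: "B \<in> sqmat m"
  shows "mat_trace (A * B) = mat_trace (B * (A :: 'a::field mat))"
proof -
  have e: "mat_trace (A * B) = (\<Sum>a<m. \<Sum>b<m. A $$ (a, b) * B $$ (b, a))"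
    if "A \<in> sqmat m" "B \<in> sqmat m" for A B :: "'a mat"
    unfolding mat_trace_def using that by (intro sum.cong) (auto simp: mult_index[of _ m m _ m] simp del: index_mult_mat(1))
  show ?thesis unfolding e[OF A B] e[OF B A] by (subst sum.swap) (simp add: mult.commute)
qed

lemma mat_trace_conj:
  assumes A: "A \<in> carrier (SL m)" and P: "P \<in> sqmat m"
  shows "mat_trace (A * P * mat_inv A) = mat_trace P"
proof -
  have c: "A \<in> sqmat m" "mat_inv A \<in> sqmat m" using A mat_inv(1)[OF A] by (auto simp: SL_simps)
  have "mat_trace (A * P * mat_inv A) = mat_trace (mat_inv A * (A * P))"
    by (rule mat_trace_mult_comm) (use c P in auto)
  also have "mat_inv A * (A * P) = mat_inv A * A * P" by (rule assoc_mult_mat[symmetric]) (use c P in auto)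
  also have "\<dots> = P" using P mat_inv(3)[OF A] by simp
  finally show ?thesis .
qed

abbreviation translated :: "nat \<Rightarrow> 'a \<Rightarrow> (nat \<Rightarrow> nat \<Rightarrow> 'a) \<Rightarrow> (nat \<Rightarrow> nat \<Rightarrow> 'a) \<Rightarrow> nat \<Rightarrow> nat \<Rightarrow> 'a::field" where
  "translated m \<epsilon> T D \<equiv> \<lambda>a b. T a b + D a b + \<epsilon> * (\<Sum>c<m. D c c) * (if a = 0 \<and> b = 0 then 1 else 0)"

context diag_sequence
begin

text \<open>The row \<^term>\<open>q0\<close> to be controlled lies in the block \<^term>\<open>sq\<close>, or outside all blocks if
  \<open>sq \<ge> S\<close>. The trace of the translation is scaled by \<open>1 + \<epsilon>\<close>, so only \<open>\<epsilon> = -1\<close>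
  preserves traces.\<close>

definition translatable :: "nat \<Rightarrow> 'a \<Rightarrow> nat \<Rightarrow> bool" where
  "translatable i \<epsilon> j \<longleftrightarrow> (\<exists>S E \<sigma> sq Q q0. blocks i j S E \<sigma> \<and> 2 * n i + 1 \<le> card {s. s < S \<and> \<sigma> s} \<and>
     Q \<subseteq> {..<n j} \<and> q0 \<in> Q \<and> card Q \<le> n i \<and> (\<forall>s<S. s \<noteq> sq \<longrightarrow> (\<forall>a<n i. E s a \<notin> Q)) \<and>
     (sq < S \<longrightarrow> (\<forall>a<n i. E sq a \<in> Q \<and> (E sq a = q0 \<longleftrightarrow> a = 0))) \<and>
     \<epsilon> = (if sq < S then if \<sigma> sq then -1 else 1 else 0))"

lemma translatable_block:
  assumes b: "blocks i j S E \<sigma>" and c: "2 * n i + 1 \<le> card {s. s < S \<and> \<sigma> s}" and sq: "sq < S"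
  shows "translatable i (if \<sigma> sq then -1 else 1) j"
proof -
  let ?Q = "E sq ` {..<n i}"
  from b have inj: "inj_on (\<lambda>(s, a). E s a) ({..<S} \<times> {..<n i})" and EN: "\<And>s a. s < S \<Longrightarrow> a < n i \<Longrightarrow> E s a < n j"
    unfolding blocks_def by auto
  have EI: "s = s' \<and> a = a'" if "E s a = E s' a'" "s < S" "s' < S" "a < n i" "a' < n i" for s s' a a'
    using inj_onD[OF inj, of "(s, a)" "(s', a')"] that by auto
  have 1: "?Q \<subseteq> {..<n j}" using EN sq by auto
  have 2: "E sq 0 \<in> ?Q" using pos[of i] by blast
  have 3: "card ?Q \<le> n i" using card_image_le[of "{..<n i}" "E sq"] by simp
  have 4: "\<forall>s<S. s \<noteq> sq \<longrightarrow> (\<forall>a<n i. E s a \<notin> ?Q)"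
  proof (intro allI impI notI)
    fix s a assume s: "s < S" "s \<noteq> sq" "a < n i" "E s a \<in> ?Q"
    then obtain a' where "a' < n i" "E s a = E sq a'" by blast
    then show False using EI[of s a sq a'] s sq by blast
  qed
  have 5: "\<forall>a<n i. E sq a \<in> ?Q \<and> (E sq a = E sq 0 \<longleftrightarrow> a = 0)"
  proof (intro allI impI conjI)
    fix a assume "a < n i"
    then show "E sq a = E sq 0 \<longleftrightarrow> a = 0" using EI[of sq a sq 0] sq pos[of i] by blast
  qed blast
  show ?thesis unfolding translatable_def
    by (intro exI[of _ S] exI[of _ E] exI[of _ \<sigma>] exI[of _ sq] exI[of _ ?Q] exI[of _ "E sq 0"] conjI b c 1 2 3 4)
      (use 5 sq in simp_all)
qed

text \<open>Half of \<open>4 * n i + 2\<close> is the required number \<open>2 * n i + 1\<close> of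
  blocks of type \<open>A\<close>. The controlled row is then placed in a block \<open>A\<close>, in
  an inverse transpose block, or at an uncovered index.\<close>

lemma translatable_of_many_blocks:
  assumes m: "many_blocks i j (4 * n i + 2) C w"
  shows "translatable i (-1) j" "1 \<le> C \<Longrightarrow> translatable i 1 j" "w \<Longrightarrow> translatable i 0 j"
proof -
  from m obtain p q w' where c: "block_counts i j p q w'" and h: "4 * n i + 2 \<le> p + q" "q \<le> p" "C \<le> q" "w \<longrightarrow> w'"
    unfolding many_blocks_def by blast
  from c obtain S E \<sigma> where b: "blocks i j S E \<sigma>" and p: "card {s. s < S \<and> \<sigma> s} = p"
    and q: "card {s. s < S \<and> \<not> \<sigma> s} = q" and w': "w' \<Longrightarrow> \<exists>\<zeta><n j. \<forall>s<S. \<forall>a<n i. E s a \<noteq> \<zeta>"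
    unfolding block_counts_def by auto
  have P: "2 * n i + 1 \<le> card {s. s < S \<and> \<sigma> s}" unfolding p using h(1,2) by linarith
  then have "{s. s < S \<and> \<sigma> s} \<noteq> {}" by (intro notI) simp
  then obtain s where "s < S" "\<sigma> s" by blast
  then show "translatable i (-1) j" using translatable_block[OF b P, of s] by simp
  show "translatable i 1 j" if "1 \<le> C"
  proof -
    have "card {s. s < S \<and> \<not> \<sigma> s} \<noteq> 0" unfolding q using that h(3) by simp
    then have "{s. s < S \<and> \<not> \<sigma> s} \<noteq> {}" by (metis card.empty)
    then obtain s where "s < S" "\<not> \<sigma> s" by blast
    then show ?thesis using translatable_block[OF b P, of s] by simp
  qed
  show "translatable i 0 j" if "w"
  proof -
    have "w'" using that h(4) by blast
    from w'[OF this] obtain \<zeta> where \<zeta>: "\<zeta> < n j" "\<forall>s<S. \<forall>a<n i. E s a \<noteq> \<zeta>" by blast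
    \<comment> \<open>Taking \<open>S\<close> for \<open>sq\<close> expresses that the row lies in
      no block, and a single row suffices for \<open>Q\<close>.\<close>
    show ?thesis unfolding translatable_def
      by (rule exI[of _ S], rule exI[of _ E], rule exI[of _ \<sigma>], rule exI[of _ S], rule exI[of _ "{\<zeta>}"], rule exI[of _ \<zeta>])
        (use b P \<zeta> pos[of i] in auto)
  qed
qed

text \<open>The base point \<open>T\<close> is the block sum after the rows have been brought under
  control. That conjugation does not depend on \<open>D\<close>, which is why one \<open>T\<close>
  serves all \<open>D\<close>.\<close>

lemma translate_orbit:
  assumes t: "translatable i \<epsilon> j" and X: "Stable X" "X \<subseteq> V" and v: "v \<in> X"
    and f: "v j = cls (n j) (fmat (n j) f)" and ns: "\<not> scalar_on {..<n j} f"
  shows "\<exists>T. \<forall>D. \<exists>w\<in>X. w i = cls (n i) (fmat (n i) (translated (n i) \<epsilon> T D))"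
proof -
  from t obtain S E \<sigma> sq Q q0 where b: "blocks i j S E \<sigma>" and c: "2 * n i + 1 \<le> card {s. s < S \<and> \<sigma> s}"
    and Q: "Q \<subseteq> {..<n j}" "q0 \<in> Q" "card Q \<le> n i" and sq: "\<And>s a. s < S \<Longrightarrow> s \<noteq> sq \<Longrightarrow> a < n i \<Longrightarrow> E s a \<notin> Q"
    and sqQ: "\<And>a. sq < S \<Longrightarrow> a < n i \<Longrightarrow> E sq a \<in> Q \<and> (E sq a = q0 \<longleftrightarrow> a = 0)"
    and e: "\<epsilon> = (if sq < S then if \<sigma> sq then -1 else 1 else 0)" unfolding translatable_def by blast
  from b have inj: "inj_on (\<lambda>(s, a). E s a) ({..<S} \<times> {..<n i})" and EN: "\<And>s a. s < S \<Longrightarrow> a < n i \<Longrightarrow> E s a < n j"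
    and im: "\<And>v f. v \<in> V \<Longrightarrow> v j = cls (n j) (fmat (n j) f) \<Longrightarrow> v i = cls (n i) (fmat (n i) (block_sum S E \<sigma> f))"
    unfolding blocks_def by auto
  have m: "1 \<le> n i" using pos[of i] by simp
  have "\<exists>p h. sim (n j) f h \<and> inj_on p {..<n i} \<and> (\<forall>b<n i. p b < S \<and> \<sigma> (p b) \<and> p b \<noteq> sq) \<and>
    (\<forall>b<n i. \<forall>a<n i. h q0 (E (p b) a) = delta a b \<and> (\<forall>q \<in> Q - {q0}. h q (E (p b) a) = 0))"
    by (rule block_sum_controlled[OF inj _ m c Q _ ns]) (use EN sq in blast)+
  then obtain p h where h: "sim (n j) f h" and p: "inj_on p {..<n i}" and p': "\<forall>b<n i. p b < S \<and> \<sigma> (p b) \<and> p b \<noteq> sq"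
    and hq: "\<forall>b<n i. \<forall>a<n i. h q0 (E (p b) a) = delta a b \<and> (\<forall>q \<in> Q - {q0}. h q (E (p b) a) = 0)"
    by (elim exE conjE) (rule that)
  have q0: "q0 < n j" using subsetD[OF Q(1,2)] by simp
  have "\<exists>w\<in>X. w i = cls (n i) (fmat (n i) (translated (n i) \<epsilon> (block_sum S E \<sigma> h) D))" for D
  proof -
    have "\<exists>g. sim (n j) h g \<and> (\<forall>a<n i. \<forall>b<n i. block_sum S E \<sigma> g a b = block_sum S E \<sigma> h a b + D a b +
       (if sq < S then if \<sigma> sq then -1 else 1 else 0) * (\<Sum>c<n i. D c c) * (if a = 0 \<and> b = 0 then 1 else 0))"
    proof (rule block_sum_translate[OF inj _ Q(2) q0 _ _ p])
      show "E s a < n j" if "s < S" "a < n i" for s a by (rule EN[OF that])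
      show "E s a \<notin> Q" if "s < S" "s \<noteq> sq" "a < n i" for s a by (rule sq[OF that])
      show "E sq a \<in> Q \<and> (E sq a = q0 \<longleftrightarrow> a = 0)" if "sq < S" "a < n i" for a by (rule sqQ[OF that])
    qed (use p' hq in auto)
    then obtain g where g: "sim (n j) h g" and g': "\<forall>a<n i. \<forall>b<n i. block_sum S E \<sigma> g a b = block_sum S E \<sigma> h a b + D a b +
       \<epsilon> * (\<Sum>c<n i. D c c) * (if a = 0 \<and> b = 0 then 1 else 0)"
      unfolding e[symmetric] by (elim exE conjE) (rule that)
    obtain w where w: "w \<in> X" "w j = cls (n j) (fmat (n j) g)"
      using Stable_sim[OF X v f sim_trans[OF h g]] by blast
    then have "w i = cls (n i) (fmat (n i) (block_sum S E \<sigma> g))" using im X(2) by blast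
    also have "fmat (n i) (block_sum S E \<sigma> g) = fmat (n i) (translated (n i) \<epsilon> (block_sum S E \<sigma> h) D)" by (rule fmat_cong) (use g' in blast)
    finally show ?thesis using w(1) by blast
  qed
  then show ?thesis by blast
qed

lemma nonzero_not_scalar:
  assumes v: "v \<in> V" "v \<noteq> zero_point n"
  shows "\<exists>j0. \<forall>j\<ge>j0. \<forall>f. v j = cls (n j) (fmat (n j) f) \<longrightarrow> \<not> scalar_on {..<n j} f"
proof -
  obtain j0 where j0: "v j0 \<noteq> zero_point n j0" using v(2) by blast
  have "\<not> scalar_on {..<n j} f" if j: "j0 \<le> j" and f: "v j = cls (n j) (fmat (n j) f)" for j f
  proof
    assume "scalar_on {..<n j} f"
    then obtain c where c: "\<forall>a\<in>{..<n j}. \<forall>b\<in>{..<n j}. f a b = (if a = b then c else 0)" unfolding scalar_on_def by blast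
    have "fmat (n j) f = 0\<^sub>m (n j) (n j) + c \<cdot>\<^sub>m 1\<^sub>m (n j)" by (rule eq_matI) (use c in auto)
    then have "fmat (n j) f \<in> cls (n j) (0\<^sub>m (n j) (n j))" unfolding cls_def by blast
    then have "v j = zero_point n j" unfolding f zero_point_def by (rule cls_memD(1)) simp
    then show False using V_down[OF v(1) zero_point_in_V _ j] j0 by blast
  qed
  then show ?thesis by blast
qed

lemma translate_nonzero:
  assumes t: "\<And>j0. \<exists>j\<ge>j0. translatable i \<epsilon> j" and X: "StableClosed X" and v: "v \<in> X" "v \<noteq> zero_point n"
  shows "\<exists>T. \<forall>D. \<exists>w\<in>X. w i = cls (n i) (fmat (n i) (translated (n i) \<epsilon> T D))"
proof -
  have XV: "X \<subseteq> V" by (rule StableClosed_sub[OF X])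
  have S: "Stable X" using X by (simp add: stable_closed_def)
  have vV: "v \<in> V" using v XV by blast
  obtain j0 where j0: "\<And>j f. j0 \<le> j \<Longrightarrow> v j = cls (n j) (fmat (n j) f) \<Longrightarrow> \<not> scalar_on {..<n j} f"
    using nonzero_not_scalar[OF vV v(2)] by blast
  obtain j where j: "j0 \<le> j" "translatable i \<epsilon> j" using t by blast
  obtain f where f: "v j = cls (n j) (fmat (n j) f)" by (rule V_rep_fun[OF vV])
  show ?thesis by (rule translate_orbit[OF j(2) S XV v(1) f j0[OF j(1) f]])
qed

lemma cls_shift: "P \<in> sqmat m \<Longrightarrow> cls m (P + c \<cdot>\<^sub>m 1\<^sub>m m) = cls m (P :: 'a mat)"
  by (rule cls_memD(1)) (auto simp: cls_def)

text \<open>The equation \<open>T + D + \<epsilon> tr(D) E = f\<close>, with \<open>E\<close> the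
  matrix unit at \<open>(0, 0)\<close>, has to be solved up to scalars. Taking traces gives
  \<open>(1 + \<epsilon>) tr(D) = t\<close>, which determines \<open>D\<close> if
  \<open>1 + \<epsilon>\<close> is nonzero. For \<open>\<epsilon> = -1\<close> a scalar matrix,
  invisible in the quotient, is added to make \<open>D\<close> traceless; this requires
  \<open>n i\<close> to be invertible in the field.\<close>

lemma full_orbit:
  assumes t: "\<And>i. i0 \<le> i \<Longrightarrow> \<exists>\<epsilon>. (\<forall>j0. \<exists>j\<ge>j0. translatable i \<epsilon> j) \<and> (1 + \<epsilon> \<noteq> 0 \<or> of_nat (n i) \<noteq> (0 :: 'a))"
    and X: "StableClosed X" and v: "v \<in> X" "v \<noteq> zero_point n"
  shows "X = V"
proof
  show "X \<subseteq> V" by (rule StableClosed_sub[OF X])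
  show "V \<subseteq> X"
  proof
    fix x assume x: "x \<in> V"
    have "\<exists>w\<in>X. w i = x i" if i: "i0 \<le> i" for i
    proof -
      obtain \<epsilon> where \<epsilon>: "\<And>j0. \<exists>j\<ge>j0. translatable i \<epsilon> j" "1 + \<epsilon> \<noteq> 0 \<or> of_nat (n i) \<noteq> (0 :: 'a)" using t[OF i] by blast
      obtain T where T: "\<And>D. \<exists>w\<in>X. w i = cls (n i) (fmat (n i) (translated (n i) \<epsilon> T D))" using translate_nonzero[OF \<epsilon>(1) X v] by blast
      obtain f where f: "x i = cls (n i) (fmat (n i) f)" by (rule V_rep_fun[OF x])
      show ?thesis
      proof (cases "1 + \<epsilon> = 0")
        case False
        define t where "t = (\<Sum>c<n i. f c c - T c c)"
        define D where "D a b = f a b - T a b - (if a = 0 \<and> b = 0 then \<epsilon> * t / (1 + \<epsilon>) else 0)" for a b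
        have "(\<Sum>c<n i. D c c) = t - (\<Sum>c<n i. if c = 0 then \<epsilon> * t / (1 + \<epsilon>) else 0)"
          unfolding D_def t_def sum_subtractf by (simp add: if_distrib cong: if_cong)
        also have "\<dots> = t - \<epsilon> * t / (1 + \<epsilon>)" using pos[of i] by simp
        also have "\<dots> = t / (1 + \<epsilon>)" using False by (simp add: field_simps)
        finally have "(\<Sum>c<n i. D c c) = t / (1 + \<epsilon>)" .
        then have "(translated (n i) \<epsilon> T D) = f"
          by (intro ext) (simp add: D_def)
        then show ?thesis using T[of D] f by simp
      next
        case True
        then have m: "\<epsilon> = -1" "of_nat (n i) \<noteq> (0 :: 'a)" using \<epsilon>(2) by (auto simp: eq_neg_iff_add_eq_0 add.commute)
        define s where "s = (\<Sum>c<n i. T c c - f c c) / of_nat (n i)"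
        define D where "D a b = f a b - T a b + s * delta a b" for a b
        have "(\<Sum>c<n i. D c c) = (\<Sum>c<n i. f c c - T c c) + of_nat (n i) * s"
          unfolding D_def sum.distrib by simp
        also have "\<dots> = 0" using m(2) by (simp add: s_def sum_subtractf)
        finally have D0: "(\<Sum>c<n i. D c c) = 0" .
        obtain w where w: "w \<in> X" "w i = cls (n i) (fmat (n i) (translated (n i) \<epsilon> T D))"
          using T[of D] by blast
        have "fmat (n i) (translated (n i) \<epsilon> T D) = fmat (n i) f + s \<cdot>\<^sub>m 1\<^sub>m (n i)"
          unfolding D0 by (rule eq_matI) (auto simp: D_def)
        then have "w i = x i" using w(2) f cls_shift[OF fmat_carrier, of "n i" f s] by simp
        then show ?thesis using w(1) by blast
      qed
    qed
    then have "\<exists>j\<ge>i. \<exists>w\<in>X. w j = x j" for i by (intro exI[of _ "max i i0"]) auto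
    then show "x \<in> X" using Closed_mem[of X x] X x by (auto simp: stable_closed_def)
  qed
qed

lemma classification_no_invariant:
  assumes t: "\<And>i. i0 \<le> i \<Longrightarrow> \<exists>\<epsilon>. (\<forall>j0. \<exists>j\<ge>j0. translatable i \<epsilon> j) \<and> (1 + \<epsilon> \<noteq> 0 \<or> of_nat (n i) \<noteq> (0 :: 'a))"
  defines "\<Lambda> \<equiv> {{zero_point n}, V}"
  shows "classifies \<Lambda>"
proof (rule classifiesI)
  show "V \<in> \<Lambda>" "finite {Z \<in> \<Lambda>. Z \<subseteq> X}" for X by (simp_all add: \<Lambda>_def)
  show "StableClosed Z \<and> Irreducible Z" if "Z \<in> \<Lambda>" for Z
    using that StableClosed_zero StableClosed_V Irreducible_V Irreducible_singleton by (auto simp: \<Lambda>_def)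
  show "\<exists>Z\<in>\<Lambda>. v \<in> Z \<and> Z \<subseteq> X" if "StableClosed X" "v \<in> X" for X v
  proof (cases "v = zero_point n")
    case True then show ?thesis using that by (intro bexI[of _ "{zero_point n}"]) (auto simp: \<Lambda>_def)
  next
    case False
    have "X = V" by (rule full_orbit[OF t that False])
    then show ?thesis using that by (intro bexI[of _ V]) (auto simp: \<Lambda>_def)
  qed
qed

end

subsection \<open>The trace\<close>

lemma mat_trace_one: "mat_trace (1\<^sub>m m) = (of_nat m :: 'a::field)"
  by (simp add: mat_trace_def)

lemma mat_trace_zero: "mat_trace (0\<^sub>m m m) = (0 :: 'a::field)"
  by (simp add: mat_trace_def)

definition class_trace :: "'a::field mat set \<Rightarrow> 'a" where
  "class_trace = induced_fun mat_trace"

lemma class_trace: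
  assumes "of_nat m = (0 :: 'a::field)"
  shows "P \<in> sqmat m \<Longrightarrow> class_trace (cls m P) = mat_trace (P :: 'a mat)"
    "linear_fun m (class_trace :: 'a mat set \<Rightarrow> 'a)"
  unfolding class_trace_def using assms
  by (auto intro!: induced_fun simp: mat_trace_linear mat_trace_one)

text \<open>With no rows outside the blocks, the trace is the sum of the traces of all diagonal
  blocks, and the signs of the transposed ones are harmless in characteristic two.\<close>

lemma mat_trace_trans_mat:
  fixes M :: "'a::field mat"
  assumes M: "M \<in> sqmat ((l + r) * m)" and s: "r = 0 \<or> (2 :: 'a) = 0"
  shows "mat_trace (trans_mat m l r M) = mat_trace M"
proof -
  have neg: "- x = x" if "(2 :: 'a) = 0" for x :: 'a
  proof -
    have "x + x = 2 * x" by simp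
    also have "\<dots> = 0" unfolding that by simp
    finally show ?thesis by (metis add_eq_0_iff)
  qed
  let ?h = "\<lambda>k a. M $$ (k * m + a, k * m + a)"
  have "mat_trace (trans_mat m l r M) = (\<Sum>a<m. (\<Sum>k<l. ?h k a) - (\<Sum>k<r. ?h (l + k) a))"
    by (simp add: mat_trace_def trans_mat_index carrier_matD[OF trans_mat_carrier])
  also have "\<dots> = (\<Sum>a<m. \<Sum>k<l + r. ?h k a)"
  proof (rule sum.cong[OF refl])
    fix a
    have "(\<Sum>k\<in>{0..<l + r}. ?h k a) = (\<Sum>k\<in>{0..<l}. ?h k a) + (\<Sum>k\<in>{l..<l + r}. ?h k a)"
      by (rule sum.atLeastLessThan_concat[symmetric]) auto
    also have "(\<Sum>k\<in>{l..<l + r}. ?h k a) = (\<Sum>k\<in>{0..<r}. ?h (l + k) a)"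
      using sum.shift_bounds_nat_ivl[of "\<lambda>k. ?h k a" 0 l r] by (simp add: add.commute)
    also have "\<dots> = - (\<Sum>k\<in>{0..<r}. ?h (l + k) a)" using s neg by auto
    finally show "(\<Sum>k<l. ?h k a) - (\<Sum>k<r. ?h (l + k) a) = (\<Sum>k<l + r. ?h k a)"
      by (simp add: lessThan_atLeast0)
  qed
  also have "\<dots> = (\<Sum>k<l + r. \<Sum>a<m. ?h k a)" by (rule sum.swap)
  also have "\<dots> = (\<Sum>x<(l + r) * m. ?h (x div m) (x mod m))" by (rule sum_div_mod[symmetric])
  also have "\<dots> = mat_trace M" using M by (simp add: mat_trace_def)
  finally show ?thesis .
qed

context diag_sequence
begin

context
  fixes i0 :: nat
  assumes char: "\<And>i. i0 \<le> i \<Longrightarrow> of_nat (n i) = (0 :: 'a)"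
    and z0: "\<And>i. i0 \<le> i \<Longrightarrow> z i = 0"
    and r2: "\<And>i. i0 \<le> i \<Longrightarrow> r i = 0 \<or> (2 :: 'a) = 0"
    and tr1: "\<And>i j0. i0 \<le> i \<Longrightarrow> \<exists>j\<ge>j0. translatable i (-1) j"
begin

lemma class_trace_const:
  assumes v: "v \<in> V" and i: "i0 \<le> i"
  shows "class_trace (v i) = class_trace (v i0)"
  using i
proof (induct i rule: dec_induct)
  case (step i)
  obtain P where P: "P \<in> sqmat (n (Suc i))" "v (Suc i) = cls (n (Suc i)) P" by (rule V_rep[OF v])
  have P': "P \<in> sqmat ((l i + r i) * n i)" using P(1) z0[OF step(1)] by (simp add: n_Suc)
  have "v i = cls (n i) (trans_mat (n i) (l i) (r i) P)" using V_tr[OF v, of i] tr_cls[OF P(1)] P(2) by simp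
  then have "class_trace (v i) = mat_trace P"
    using class_trace(1)[OF char[OF step(1)] trans_mat_carrier] mat_trace_trans_mat[OF P' r2[OF step(1)]] by simp
  also have "\<dots> = class_trace (v (Suc i))" using class_trace(1)[OF char P(1)] step(1) P(2) by simp
  finally show ?case using step(3) by simp
qed simp

text \<open>The trace is constant along the sequence from level \<open>i0\<close> on, so the
  eventual condition becomes one linear equation at that level.\<close>

lemma trace_locus_eq: "trace_locus n l r \<mu> = {v \<in> V. class_trace (v i0) = \<mu>}"
proof (intro equalityI subsetI)
  fix v assume "v \<in> trace_locus n l r \<mu>"
  then obtain P where P: "v = (\<lambda>i. cls (n i) (P i))" "\<And>i. P i \<in> sqmat (n i)" "v \<in> V"
    and "\<forall>\<^sub>F i in sequentially. mat_trace (P i) = \<mu>" unfolding trace_locus_def eventual_locus_def by auto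
  then obtain N where N: "\<And>i. N \<le> i \<Longrightarrow> mat_trace (P i) = \<mu>" unfolding eventually_sequentially by blast
  have "class_trace (v (max N i0)) = \<mu>"
    using class_trace(1)[OF char[of "max N i0"] P(2)] N[of "max N i0"] P(1) by simp
  then show "v \<in> {v \<in> V. class_trace (v i0) = \<mu>}" using class_trace_const[OF P(3), of "max N i0"] P(3) by simp
next
  fix v assume v: "v \<in> {v \<in> V. class_trace (v i0) = \<mu>}"
  then have "\<forall>i. \<exists>P. P \<in> sqmat (n i) \<and> v i = cls (n i) P" using V_rep by blast
  then obtain P where P: "\<And>i. P i \<in> sqmat (n i)" "\<And>i. v i = cls (n i) (P i)" by metis
  have e: "v = (\<lambda>i. cls (n i) (P i))" using P(2) by blast
  have "mat_trace (P i) = \<mu>" if "i0 \<le> i" for i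
    using class_trace(1)[OF char[OF that] P(1)] class_trace_const[of v i] v that P(2) by simp
  then have "\<forall>\<^sub>F i in sequentially. mat_trace (P i) = \<mu>" unfolding eventually_sequentially by blast
  then show "v \<in> trace_locus n l r \<mu>" unfolding trace_locus_def eventual_locus_def using P(1) e v by auto
qed

lemma StableClosed_trace_locus: "StableClosed (trace_locus n l r \<mu>)"
proof (rule StableClosedI)
  show s: "trace_locus n l r \<mu> \<subseteq> V" by (auto simp: trace_locus_eq)
  show "Stable (trace_locus n l r \<mu>)"
  proof (rule StableI[OF s])
    fix v w i and A :: "nat \<Rightarrow> 'a mat"
    assume v: "v \<in> trace_locus n l r \<mu>" and w: "w \<in> V"
      and A: "\<And>j. i \<le> j \<Longrightarrow> A j \<in> carrier (SL (n j)) \<and> w j = conj_act (A j) (v j)"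
    have vV: "v \<in> V" "class_trace (v i0) = \<mu>" using v by (auto simp: trace_locus_eq)
    let ?j = "max i i0"
    have Aj: "A ?j \<in> carrier (SL (n ?j))" "w ?j = conj_act (A ?j) (v ?j)" using A[of ?j] by auto
    obtain P where P: "P \<in> sqmat (n ?j)" "v ?j = cls (n ?j) P" by (rule V_rep[OF vV(1)])
    have c: "A ?j * P * mat_inv (A ?j) \<in> sqmat (n ?j)"
      using Aj(1) mat_inv(1)[OF Aj(1)] P by (auto simp: SL_simps)
    have "class_trace (w ?j) = mat_trace (A ?j * P * mat_inv (A ?j))"
      unfolding Aj(2) P(2) conj_act_cls[OF Aj(1) P(1)] by (rule class_trace(1)[OF char c]) simp
    also have "\<dots> = class_trace (v ?j)"
      unfolding mat_trace_conj[OF Aj(1) P(1)] P(2) by (rule class_trace(1)[OF char P(1), symmetric]) simp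
    finally have "class_trace (w i0) = \<mu>"
      using class_trace_const[OF w, of ?j] class_trace_const[OF vV(1), of ?j] vV(2) by simp
    then show "w \<in> trace_locus n l r \<mu>" using w by (simp add: trace_locus_eq)
  qed
  show "zclosure (trace_locus n l r \<mu>) \<subseteq> trace_locus n l r \<mu>"
  proof
    fix v assume v: "v \<in> zclosure (trace_locus n l r \<mu>)"
    have "(\<lambda>x. class_trace x + (- \<mu>)) \<in> poly_fun (n i0)"
      by (rule poly_fun.add[OF poly_fun.linear[OF class_trace(2)[OF char[OF order_refl]]] poly_fun.const])
    moreover have "\<forall>f \<in> poly_fun (n i0). (\<forall>s\<in>trace_locus n l r \<mu>. f (s i0) = 0) \<longrightarrow> f (v i0) = 0" "v \<in> V"
      using v by (simp_all add: zclosure_def)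
    ultimately have "class_trace (v i0) + (- \<mu>) = 0" by (force simp: trace_locus_eq)
    then show "v \<in> trace_locus n l r \<mu>" using \<open>v \<in> V\<close> by (simp add: trace_locus_eq)
  qed
qed

lemma trace_locus_surj:
  fixes \<mu> :: 'a
  assumes i: "i0 \<le> i" and M: "M \<in> sqmat (n i)" "mat_trace M = \<mu>"
  shows "\<exists>x \<in> trace_locus n l r \<mu>. x i = cls (n i) M"
proof -
  obtain x where x: "x \<in> V" "x i = cls (n i) M" using V_surj[OF M(1)] by blast
  then have "class_trace (x i0) = \<mu>" using class_trace_const[OF x(1) i] class_trace(1)[OF char[OF i] M(1)] M(2) by simp
  then show ?thesis using x by (intro bexI[of _ x]) (auto simp: trace_locus_eq)
qed

lemma trace_locus_rep:
  fixes \<mu> :: 'a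
  assumes "x \<in> trace_locus n l r \<mu>" "i0 \<le> i" "P \<in> sqmat (n i)" "x i = cls (n i) P"
  shows "mat_trace P = \<mu>"
  using assms class_trace_const[of x i] class_trace(1)[OF char[OF assms(2)] assms(3)] by (simp add: trace_locus_eq)

abbreviation corner_unit :: "nat \<Rightarrow> 'a mat" where
  "corner_unit i \<equiv> fmat (n i) (\<lambda>a b. if a = 0 \<and> b = 0 then 1 else 0)"

lemma mat_trace_corner_unit: "mat_trace (corner_unit i) = 1"
proof -
  have "(\<Sum>a<n i. if a = 0 \<and> a = 0 then 1 else 0 :: 'a) = (\<Sum>a<n i. if a = 0 then 1 else 0)" by simp
  also have "\<dots> = 1" using pos[of i] by simp
  finally show ?thesis by (simp add: mat_trace_fmat)
qed

lemma Irreducible_trace_locus: "Irreducible (trace_locus n l r \<mu>)"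
proof (rule Irreducible_by_lines[of _ i0])
  show "trace_locus n l r \<mu> \<subseteq> V" by (auto simp: trace_locus_eq)
  have "mat_trace (\<mu> \<cdot>\<^sub>m corner_unit i0) = \<mu>"
    using mat_trace_linear(2)[of "corner_unit i0" "n i0" \<mu>] mat_trace_corner_unit[of i0] by simp
  then show "trace_locus n l r \<mu> \<noteq> {}"
    using trace_locus_surj[of i0 "\<mu> \<cdot>\<^sub>m corner_unit i0" \<mu>] by auto
  fix i P Q v w t
  assume i: "i0 \<le> i" and vw: "v \<in> trace_locus n l r \<mu>" "w \<in> trace_locus n l r \<mu>"
    and P: "P \<in> sqmat (n i)" and Q: "Q \<in> sqmat (n i)" and e: "v i = cls (n i) P" "w i = cls (n i) Q"
  have tP: "mat_trace P = \<mu>" "mat_trace Q = \<mu>" using trace_locus_rep vw i P Q e by blast+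
  have "Q - P = Q + (- 1) \<cdot>\<^sub>m P" using P Q by (intro eq_matI) auto
  then have "mat_trace (Q - P) = 0" using P Q tP mat_trace_linear(1)[of Q "n i" "(- 1) \<cdot>\<^sub>m P"] mat_trace_linear(2)[OF P] by simp
  then have "mat_trace (curve P (Q - P) (0\<^sub>m (n i) (n i)) t) = \<mu>"
  proof -
    have QP: "Q - P \<in> sqmat (n i)" by (rule minus_carrier_mat[OF P])
    have "curve P (Q - P) (0\<^sub>m (n i) (n i)) t = P + t \<cdot>\<^sub>m (Q - P)" using P Q by (intro eq_matI) auto
    then show ?thesis
      using \<open>mat_trace (Q - P) = 0\<close> tP(1) mat_trace_linear(1)[OF P, of "t \<cdot>\<^sub>m (Q - P)"] mat_trace_linear(2)[OF QP, of t] QP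
      by simp
  qed
  then show "\<exists>x\<in>trace_locus n l r \<mu>. x i = cls (n i) (curve P (Q - P) (0\<^sub>m (n i) (n i)) t)"
    using P Q by (intro trace_locus_surj[OF i]) auto
qed

text \<open>With \<open>\<epsilon> = -1\<close> the correction term vanishes exactly for traceless
  \<open>D\<close>, so it remains to make the target differ from \<open>T\<close> by a traceless
  matrix.\<close>

lemma trace_orbit:
  assumes X: "StableClosed X" and v: "v \<in> X" "v \<noteq> zero_point n" "v \<in> trace_locus n l r \<mu>"
  shows "trace_locus n l r \<mu> \<subseteq> X"
proof
  fix x assume x: "x \<in> trace_locus n l r \<mu>"
  \<comment> \<open>Applying the orbit lemma inside the intersection forces \<open>T\<close> to have
    trace \<open>\<mu>\<close>, as the target does.\<close>
  let ?X = "X \<inter> trace_locus n l r \<mu>"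
  have X': "StableClosed ?X" by (rule StableClosed_Int[OF X StableClosed_trace_locus])
  have xV: "x \<in> V" using x by (simp add: trace_locus_eq)
  have "\<exists>w\<in>X. w i = x i" if i: "i0 \<le> i" for i
  proof -
    obtain T where T: "\<And>D. \<exists>w\<in>?X. w i = cls (n i) (fmat (n i) (translated (n i) (- 1) T D))"
      using translate_nonzero[OF tr1[OF i] X', of v] v by blast
    obtain w0 where "w0 \<in> ?X" "w0 i = cls (n i) (fmat (n i) T)" using T[of "\<lambda>a b. 0"] by auto
    then have tT: "(\<Sum>a<n i. T a a) = \<mu>" using trace_locus_rep[of w0 \<mu> i, OF _ i fmat_carrier] by (auto simp: mat_trace_fmat)
    obtain f where f: "x i = cls (n i) (fmat (n i) f)" by (rule V_rep_fun[OF xV])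
    have tf: "(\<Sum>a<n i. f a a) = \<mu>" using trace_locus_rep[OF x i fmat_carrier f] by (simp add: mat_trace_fmat)
    have "(\<Sum>a<n i. f a a - T a a) = 0" by (simp add: sum_subtractf tT tf)
    then have "\<exists>w\<in>?X. w i = cls (n i) (fmat (n i) f)" using T[of "\<lambda>a b. f a b - T a b"] by simp
    then show ?thesis using f by auto
  qed
  then have "\<exists>j\<ge>i. \<exists>w\<in>X. w j = x j" for i by (intro exI[of _ "max i i0"]) auto
  then show "x \<in> X" using Closed_mem[of X x] X xV by (auto simp: stable_closed_def)
qed

text \<open>Through any matrix at level \<open>i\<close> runs the line in direction of the corner
  unit, on which the trace takes every value once. A polynomial function vanishing on
  \<open>Y i\<close> then has infinitely many zeros on this line and vanishes on all of it.\<close>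

lemma infinitely_many_traces:
  assumes X: "StableClosed X" and inf: "infinite {\<mu>. trace_locus n l r \<mu> \<subseteq> X}"
  shows "X = V"
proof
  show "X \<subseteq> V" by (rule StableClosed_sub[OF X])
  have "Closed X" using X by (simp add: stable_closed_def)
  obtain Y where Y: "\<And>i. zariski_closed (n i) (Y i)" "\<And>i. tr i ` Y (Suc i) \<subseteq> Y i" "X = {v \<in> V. \<forall>i. v i \<in> Y i}"
    by (rule ClosedE[OF \<open>Closed X\<close>], rule that) blast+
  have full: "cls (n i) M \<in> Y i" if i: "i0 \<le> i" and M: "M \<in> sqmat (n i)" for i M
  proof (rule ccontr)
    assume MY: "cls (n i) M \<notin> Y i"
    obtain f where f: "f \<in> poly_fun (n i)" "f (cls (n i) M) \<noteq> 0" "\<And>y. y \<in> Y i \<Longrightarrow> f y = 0"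
      by (rule zariski_closed_separate[OF Y(1) cls_in_gl_mod[OF M] MY], rule that)
    let ?Z = "0\<^sub>m (n i) (n i) :: 'a mat"
    obtain q where q: "\<And>t. f (cls (n i) (curve M (corner_unit i) ?Z t)) = poly q t"
      using poly_fun_curve[OF f(1) M fmat_carrier zero_carrier_mat] by blast
    have "poly q (\<mu> - mat_trace M) = 0" if "trace_locus n l r \<mu> \<subseteq> X" for \<mu>
    proof -
      let ?C = "curve M (corner_unit i) ?Z (\<mu> - mat_trace M)"
      have C: "?C \<in> sqmat (n i)" using M by simp
      have "mat_trace ?C = \<mu>"
        using M mat_trace_corner_unit[of i] by (simp add: mat_trace_linear[of _ "n i"] mat_trace_zero)
      then obtain x where x: "x \<in> trace_locus n l r \<mu>" "x i = cls (n i) ?C" using trace_locus_surj[OF i C] by blast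
      have "x \<in> X" using that x(1) by blast
      then have "x i \<in> Y i" unfolding Y(3) by blast
      then have "cls (n i) ?C \<in> Y i" unfolding x(2) .
      then show ?thesis using f(3) q by metis
    qed
    then have "(\<lambda>\<mu>. \<mu> - mat_trace M) ` {\<mu>. trace_locus n l r \<mu> \<subseteq> X} \<subseteq> {t. poly q t = 0}" by blast
    moreover have "infinite ((\<lambda>\<mu>. \<mu> - mat_trace M) ` {\<mu>. trace_locus n l r \<mu> \<subseteq> X})"
      using inf by (subst finite_image_iff) (auto simp: inj_on_def)
    ultimately have "infinite {t. poly q t = 0}" using infinite_super by blast
    then have "q = 0" using poly_roots_finite by blast
    moreover have c0: "curve M (corner_unit i) ?Z 0 = M" using M by (intro eq_matI) auto
    have "f (cls (n i) M) = poly q 0" using q[of 0] unfolding c0 .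
    ultimately show False using f(2) by simp
  qed
  show "V \<subseteq> X"
  proof
    fix v assume v: "v \<in> V"
    have "v i \<in> Y i" for i
    proof -
      let ?j = "max i i0"
      obtain P where P: "P \<in> sqmat (n ?j)" "v ?j = cls (n ?j) P" by (rule V_rep[OF v])
      have "v ?j \<in> Y ?j" unfolding P(2) by (rule full[OF _ P(1)]) simp
      then show ?thesis by (intro closed_seq_down[of Y v ?j i, OF Y(2) v]) auto
    qed
    then show "v \<in> X" using Y(3) v by blast
  qed
qed

lemma classification_trace:
  defines "\<Lambda> \<equiv> {{zero_point n}, V} \<union> {trace_locus n l r \<mu> | \<mu>. True}"
  shows "classifies \<Lambda>"
proof (rule classifiesI)
  show "V \<in> \<Lambda>" by (simp add: \<Lambda>_def)
  show "StableClosed Z \<and> Irreducible Z" if "Z \<in> \<Lambda>" for Z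
    using that StableClosed_zero StableClosed_V Irreducible_V Irreducible_singleton
      StableClosed_trace_locus Irreducible_trace_locus by (auto simp: \<Lambda>_def)
  show "\<exists>Z\<in>\<Lambda>. v \<in> Z \<and> Z \<subseteq> X" if X: "StableClosed X" "v \<in> X" for X v
  proof (cases "v = zero_point n")
    case True then show ?thesis using that by (intro bexI[of _ "{zero_point n}"]) (auto simp: \<Lambda>_def)
  next
    case False
    have "v \<in> V" using X StableClosed_sub by blast
    then have v: "v \<in> trace_locus n l r (class_trace (v i0))" by (simp add: trace_locus_eq)
    then show ?thesis using trace_orbit[OF X False v]
      by (intro bexI[of _ "trace_locus n l r (class_trace (v i0))"]) (auto simp: \<Lambda>_def)
  qed
  show "finite {Z \<in> \<Lambda>. Z \<subseteq> X}" if "StableClosed X" "X \<noteq> V" for X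
  proof (rule finite_subset)
    show "{Z \<in> \<Lambda>. Z \<subseteq> X} \<subseteq> {{zero_point n}, V} \<union> trace_locus n l r ` {\<mu>. trace_locus n l r \<mu> \<subseteq> X}"
      by (auto simp: \<Lambda>_def)
    show "finite ({{zero_point n}, V} \<union> trace_locus n l r ` {\<mu>. trace_locus n l r \<mu> \<subseteq> X})"
      using infinitely_many_traces[OF that(1)] that(2) by blast
  qed
qed

end

end

subsection \<open>Bounded rank\<close>

lemma scalar_rank_corner:
  fixes f :: "nat \<Rightarrow> nat \<Rightarrow> 'a::field"
  assumes m: "m \<le> N"
  shows "scalar_rank m (fmat m f) \<le> scalar_rank N (fmat N f)"
proof -
  obtain a b where ab: "(a, b) \<noteq> (0, 0)" "scalar_rank N (fmat N f) = rk N (a \<cdot>\<^sub>m fmat N f + b \<cdot>\<^sub>m 1\<^sub>m N)"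
    using scalar_rank_attained by blast
  let ?Q = "a \<cdot>\<^sub>m fmat N f + b \<cdot>\<^sub>m 1\<^sub>m N"
  have Q: "?Q \<in> sqmat N" by simp
  have "mat m m (\<lambda>(i, j). if i < N \<and> j < N then ?Q $$ (i, j) else 0) = a \<cdot>\<^sub>m fmat m f + b \<cdot>\<^sub>m 1\<^sub>m m"
    by (rule eq_matI) (use m in auto)
  then have "rk m (a \<cdot>\<^sub>m fmat m f + b \<cdot>\<^sub>m 1\<^sub>m m) \<le> rk N ?Q"
    using rank_select_le[OF Q, of m m "\<lambda>i. i" "\<lambda>j. j"] by simp
  then show ?thesis using scalar_rank_le[OF ab(1), of m "fmat m f"] ab(2) by simp
qed

lemma scalar_rank_cls:
  assumes "P \<in> sqmat m" "Q \<in> sqmat m" "cls m P = cls m Q"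
  shows "scalar_rank m P \<le> scalar_rank m Q"
proof -
  have "P \<in> cls m Q" using cls_self[OF assms(1)] assms(3) by simp
  then obtain c where "P = Q + c \<cdot>\<^sub>m 1\<^sub>m m" unfolding cls_def by blast
  then show ?thesis using scalar_rank_shift[OF assms(2)] by simp
qed

lemma scalar_rank_le_plain_rank:
  assumes "P \<in> sqmat m"
  shows "scalar_rank m P \<le> rk m P"
proof -
  have "P + 0 \<cdot>\<^sub>m 1\<^sub>m m = P" using assms by (intro eq_matI) auto
  then show ?thesis using scalar_rank_le_rank[OF assms, of 0] by simp
qed

lemma curve_product:
  fixes A B Q :: "'a::field mat"
  assumes A: "A0 \<in> sqmat m" "A1 \<in> sqmat m" and B: "B0 \<in> sqmat m" "B1 \<in> sqmat m"
    and Q: "Q \<in> sqmat m"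
  shows "curve (A0 * Q * B0) (A1 * Q * B0 + A0 * Q * B1) (A1 * Q * B1) t = (A0 + t \<cdot>\<^sub>m A1) * Q * (B0 + t \<cdot>\<^sub>m B1)"
proof -
  have "(A0 + t \<cdot>\<^sub>m A1) * Q = A0 * Q + t \<cdot>\<^sub>m (A1 * Q)"
    using A Q by (subst add_mult_distrib_mat[of _ m m]) (auto simp: mult_smult_assoc_mat[of _ m m])
  moreover have "(C + t \<cdot>\<^sub>m D) * (B0 + t \<cdot>\<^sub>m B1) = C * B0 + t \<cdot>\<^sub>m (D * B0 + C * B1) + (t * t) \<cdot>\<^sub>m (D * B1)"
    if C: "C \<in> sqmat m" and D: "D \<in> sqmat m" for C D :: "'a mat"
  proof -
    have "(C + t \<cdot>\<^sub>m D) * (B0 + t \<cdot>\<^sub>m B1) = (C + t \<cdot>\<^sub>m D) * B0 + t \<cdot>\<^sub>m ((C + t \<cdot>\<^sub>m D) * B1)"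
      using B C D by (subst mult_add_distrib_mat[of _ m m _ m]) (auto simp: mult_smult_distrib[of _ m m _ m])
    also have "(C + t \<cdot>\<^sub>m D) * B0 = C * B0 + t \<cdot>\<^sub>m (D * B0)"
      using B C D by (subst add_mult_distrib_mat[of _ m m]) (auto simp: mult_smult_assoc_mat[of _ m m])
    also have "(C + t \<cdot>\<^sub>m D) * B1 = C * B1 + t \<cdot>\<^sub>m (D * B1)"
      using B C D by (subst add_mult_distrib_mat[of _ m m]) (auto simp: mult_smult_assoc_mat[of _ m m])
    also have "C * B0 + t \<cdot>\<^sub>m (D * B0) + t \<cdot>\<^sub>m (C * B1 + t \<cdot>\<^sub>m (D * B1)) =
        C * B0 + t \<cdot>\<^sub>m (D * B0 + C * B1) + (t * t) \<cdot>\<^sub>m (D * B1)"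
      using B C D by (intro eq_matI) (auto simp: algebra_simps simp del: index_mult_mat(1))
    finally show ?thesis .
  qed
  ultimately show ?thesis using A Q by simp
qed

text \<open>The \<open>(k + 1)\<close>-minor of the columns \<open>0, \<dots>, k\<close> and the rows \<open>k + 1, \<dots>, 2 k + 1\<close>
  avoids the diagonal, hence is a function on the quotient by the scalar matrices.\<close>

definition offdiag_minor :: "nat \<Rightarrow> 'a::field mat set \<Rightarrow> 'a" where
  "offdiag_minor k x = det (mat (Suc k) (Suc k) (\<lambda>(a, b). entry_fun (Suc k + a) b x))"

lemma offdiag_minor_poly:
  assumes m: "2 * k + 2 \<le> m"
  shows "(offdiag_minor k :: 'a::field mat set \<Rightarrow> 'a) \<in> poly_fun m"
proof -
  have e: "offdiag_minor k = (\<lambda>x. \<Sum>p\<in>{p. p permutes {0..<Suc k}}. signof p * (\<Prod>a = 0..<Suc k. entry_fun (Suc k + a) (p a) x :: 'a))"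
  proof
    fix x :: "'a mat set"
    let ?A = "mat (Suc k) (Suc k) (\<lambda>(a, b). entry_fun (Suc k + a) b x)"
    have "offdiag_minor k x = (\<Sum>p\<in>{p. p permutes {0..<Suc k}}. signof p * (\<Prod>a = 0..<Suc k. ?A $$ (a, p a)))"
      unfolding offdiag_minor_def by (rule det_def') simp
    also have "\<dots> = (\<Sum>p\<in>{p. p permutes {0..<Suc k}}. signof p * (\<Prod>a = 0..<Suc k. entry_fun (Suc k + a) (p a) x))"
    proof (rule sum.cong[OF refl], rule arg_cong2[of _ _ _ _ times, OF refl], rule prod.cong[OF refl])
      fix p a assume "p \<in> {p. p permutes {0..<Suc k}}" "a \<in> {0..<Suc k}"
      then show "?A $$ (a, p a) = entry_fun (Suc k + a) (p a) x"
        using permutes_in_image[of p "{0..<Suc k}" a] by simp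
    qed
    finally show "offdiag_minor k x = (\<Sum>p\<in>{p. p permutes {0..<Suc k}}. signof p * (\<Prod>a = 0..<Suc k. entry_fun (Suc k + a) (p a) x :: 'a))" .
  qed
  have "(\<lambda>x. entry_fun (Suc k + a) (p a) x :: 'a) \<in> poly_fun m" if "p permutes {0..<Suc k}" "a \<in> {0..<Suc k}" for p a
  proof (rule poly_fun.linear[OF entry_fun(2)])
    have "p a \<in> {0..<Suc k}" using permutes_in_image[OF that(1)] that(2) by blast
    then show "p a < m" using m by simp
  qed (use that m in simp)
  then show ?thesis unfolding e
    by (intro poly_fun_sum poly_fun.mult poly_fun.const poly_fun_prod finite_permutations) auto
qed

lemma offdiag_minor_cls:
  fixes P :: "'a::field mat"
  assumes "P \<in> sqmat m" "2 * k + 2 \<le> m"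
  shows "offdiag_minor k (cls m P) = det (mat (Suc k) (Suc k) (\<lambda>(i, j). P $$ (Suc k + i, j)))"
  unfolding offdiag_minor_def
  by (rule arg_cong[of _ _ det], rule eq_matI) (use assms in \<open>auto simp: entry_fun(1)[of _ m]\<close>)

context diag_sequence
begin

section \<open>Eventually a single block: the rank loci\<close>

context
  fixes i0 :: nat
  assumes l1: "\<And>i. i0 \<le> i \<Longrightarrow> l i = 1" and r0: "\<And>i. i0 \<le> i \<Longrightarrow> r i = 0"
    and zinf: "infinite {i. 0 < z i}"
begin

lemma n_unbounded: "\<exists>j\<ge>j0. B \<le> n j"
proof (induct B)
  case (Suc B)
  then obtain j where j: "j0 \<le> j" "B \<le> n j" by blast
  obtain k where k: "j \<le> k" "0 < z k" using zinf unfolding infinite_nat_iff_unbounded_le by blast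
  have "1 * n k \<le> (l k + r k) * n k" by (rule mult_le_mono1) (use l_pos[of k] in simp)
  then have "Suc B \<le> n (Suc k)" using n_mono[OF k(1)] j(2) k(2) unfolding n_Suc by linarith
  then show ?case using j k by (intro exI[of _ "Suc k"]) auto
qed auto

text \<open>With one block of type \<open>A\<close> the transition map truncates a matrix to its
  corner, so the same \<open>f\<close> represents the point at all lower levels down to
  \<open>i0\<close>.\<close>

lemma corner_component:
  assumes i: "i0 \<le> i" "i \<le> j" and v: "v \<in> V"
  shows "v j = cls (n j) (fmat (n j) f) \<Longrightarrow> v i = cls (n i) (fmat (n i) f)"
  using i(2)
proof (induct j rule: dec_induct)
  case (step j)
  have j: "i0 \<le> j" using i step by simp
  have "v j = cls (n j) (trans_mat (n j) 1 0 (fmat (n (Suc j)) f))"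
    using V_tr[OF v, of j] tr_cls[OF fmat_carrier, of j f] step(4) l1[OF j] r0[OF j] by simp
  also have "trans_mat (n j) 1 0 (fmat (n (Suc j)) f) = fmat (n j) f"
    using n_mono[of j "Suc j"] by (intro eq_matI) (auto simp: trans_mat_index trans_mat_def[THEN arg_cong[of _ _ dim_row]] trans_mat_def[THEN arg_cong[of _ _ dim_col]])
  finally show ?case by (rule step(3))
qed

definition bounded_rank :: "nat \<Rightarrow> (nat \<Rightarrow> 'a mat set) set" where
  "bounded_rank k = {v \<in> V. \<forall>i\<ge>i0. \<forall>P. P \<in> sqmat (n i) \<longrightarrow> v i = cls (n i) P \<longrightarrow> scalar_rank (n i) P \<le> k}"

text \<open>Truncation to a corner cannot raise the scalar rank, so a bound at cofinally many
  levels, for one representative each, gives it at all levels from \<open>i0\<close> on.\<close>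

lemma bounded_rankI:
  assumes v: "v \<in> V" and b: "\<And>i. \<exists>j\<ge>i. \<exists>P \<in> sqmat (n j). v j = cls (n j) P \<and> scalar_rank (n j) P \<le> k"
  shows "v \<in> bounded_rank k"
proof -
  have "scalar_rank (n i) Q \<le> k" if i: "i0 \<le> i" and Q: "Q \<in> sqmat (n i)" "v i = cls (n i) Q" for i Q
  proof -
    obtain j P where j: "i \<le> j" and P: "P \<in> sqmat (n j)" "v j = cls (n j) P" "scalar_rank (n j) P \<le> k"
      using b by blast
    let ?f = "\<lambda>a b. P $$ (a, b)"
    have "v j = cls (n j) (fmat (n j) ?f)" using P by (simp add: fmat_of_carrier)
    then have "v i = cls (n i) (fmat (n i) ?f)" by (rule corner_component[OF i j v])
    then have "scalar_rank (n i) Q \<le> scalar_rank (n i) (fmat (n i) ?f)" using scalar_rank_cls[OF Q(1) fmat_carrier] Q(2) by simp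
    also have "\<dots> \<le> scalar_rank (n j) (fmat (n j) ?f)" by (rule scalar_rank_corner[OF n_mono[OF j]])
    finally show ?thesis using P by (simp add: fmat_of_carrier)
  qed
  then show ?thesis using v by (simp add: bounded_rank_def)
qed

lemma rank_locus_eq: "rank_locus n l r k = bounded_rank k"
proof (intro equalityI subsetI)
  fix v :: "nat \<Rightarrow> 'a mat set" assume "v \<in> rank_locus n l r k"
  then obtain P where P: "v = (\<lambda>i. cls (n i) (P i))" "\<And>i. P i \<in> sqmat (n i)" "v \<in> V"
    and "\<forall>\<^sub>F i in sequentially. scalar_rank (n i) (P i) \<le> k" unfolding rank_locus_def eventual_locus_def by auto
  then obtain N where N: "\<And>i. N \<le> i \<Longrightarrow> scalar_rank (n i) (P i) \<le> k" unfolding eventually_sequentially by blast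
  show "v \<in> bounded_rank k"
  proof (rule bounded_rankI[OF P(3)])
    fix i
    show "\<exists>j\<ge>i. \<exists>P\<in>sqmat (n j). v j = cls (n j) P \<and> scalar_rank (n j) P \<le> k"
      by (rule exI[of _ "max i N"]) (use P N in auto)
  qed
next
  fix v assume v: "v \<in> bounded_rank k"
  then have vV: "v \<in> V" by (simp add: bounded_rank_def)
  then have "\<forall>i. \<exists>P. P \<in> sqmat (n i) \<and> v i = cls (n i) P" using V_rep by blast
  then obtain P where P: "\<And>i. P i \<in> sqmat (n i)" "\<And>i. v i = cls (n i) (P i)" by metis
  have e: "v = (\<lambda>i. cls (n i) (P i))" using P(2) by blast
  have "scalar_rank (n i) (P i) \<le> k" if "i0 \<le> i" for i using v P that by (simp add: bounded_rank_def)
  then have "\<forall>\<^sub>F i in sequentially. scalar_rank (n i) (P i) \<le> k" unfolding eventually_sequentially by blast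
  then show "v \<in> rank_locus n l r k" unfolding rank_locus_def eventual_locus_def using P(1) e vV by auto
qed

lemma bounded_rank_surj:
  assumes M: "M \<in> sqmat (n i)" "rk (n i) M \<le> k"
  shows "\<exists>x \<in> bounded_rank k. x i = cls (n i) M"
proof -
  obtain x where x: "x \<in> V" "\<And>j. i \<le> j \<Longrightarrow> x j = cls (n j) (zero_pad (n i) (n j) M)"
    using exists_V_zero_pad[OF M(1)] by blast
  have "x \<in> bounded_rank k"
  proof (rule bounded_rankI[OF x(1)])
    fix i'
    have "scalar_rank (n j) (zero_pad (n i) (n j) M) \<le> k" for j
      using scalar_rank_le_plain_rank[of "zero_pad (n i) (n j) M" "n j"] rank_zero_pad[OF M(1), of "n j"] M(2) by simp
    then show "\<exists>j\<ge>i'. \<exists>P\<in>sqmat (n j). x j = cls (n j) P \<and> scalar_rank (n j) P \<le> k"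
      by (intro exI[of _ "max i i'"] conjI bexI[of _ "zero_pad (n i) (n (max i i')) M"]) (use x(2) in auto)
  qed
  moreover have "x i = cls (n i) M" using x(2)[OF order_refl] zero_pad_self[OF M(1)] by simp
  ultimately show ?thesis by blast
qed

text \<open>Reaching rank \<open>k\<close> in this sense is what moves the orbit
  (\<open>orbit_corner\<close>), and failing to reach \<open>Suc k\<close> puts \<open>v\<close>
  into \<open>bounded_rank k\<close> (\<open>in_bounded_rank\<close>).\<close>

definition rank_unbounded_below :: "nat \<Rightarrow> (nat \<Rightarrow> 'a mat set) \<Rightarrow> bool" where
  "rank_unbounded_below k v \<longleftrightarrow> (\<forall>j0. \<exists>j\<ge>j0. \<exists>f. v j = cls (n j) (fmat (n j) f) \<and> k \<le> scalar_rank (n j) (fmat (n j) f))"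

lemma orbit_corner:
  assumes X: "StableClosed X" and v: "v \<in> X" and h: "rank_unbounded_below k v"
    and i: "i0 \<le> i" and M: "M \<in> sqmat (n i)" "rk (n i) M \<le> k"
  shows "\<exists>w\<in>X. w i = cls (n i) M"
proof -
  have XV: "X \<subseteq> V" "Stable X" using StableClosed_sub[OF X] X by (auto simp: stable_closed_def)
  obtain j1 where j1: "i \<le> j1" "3 * n i + 3 \<le> n j1" using n_unbounded by blast
  obtain j f where j: "j1 \<le> j" and f: "v j = cls (n j) (fmat (n j) f)" and k: "k \<le> scalar_rank (n j) (fmat (n j) f)"
    using h unfolding rank_unbounded_below_def by blast
  have N: "3 * n i + 3 \<le> n j" using j1(2) n_mono[OF j] by simp
  have "1 \<le> n i" using pos[of i] by simp
  then obtain g c where g: "sim (n j) f g" "\<forall>a<n i. \<forall>b<n i. g a b = M $$ (a, b) + c * delta a b"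
    using conj_corner[OF _ N M(1), of f] M(2) k by auto
  obtain w where w: "w \<in> X" "w j = cls (n j) (fmat (n j) g)" using Stable_sim[OF XV(2,1) v f g(1)] by blast
  have ij: "i \<le> j" using j1(1) j by simp
  have wV: "w \<in> V" using w(1) XV(1) by blast
  have "fmat (n i) g = M + c \<cdot>\<^sub>m 1\<^sub>m (n i)" by (rule eq_matI) (use g(2) M(1) in auto)
  then have "w i = cls (n i) M"
    using corner_component[OF i ij wV w(2)] cls_shift[OF M(1), of c] by simp
  then show ?thesis using w(1) by blast
qed

lemma bounded_rank_rep:
  assumes x: "x \<in> bounded_rank k" and i: "i0 \<le> i" "k < n i"
  shows "\<exists>P \<in> sqmat (n i). x i = cls (n i) P \<and> rk (n i) P \<le> k"
proof -
  have xV: "x \<in> V" using x by (simp add: bounded_rank_def)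
  obtain Q where Q: "Q \<in> sqmat (n i)" "x i = cls (n i) Q" by (rule V_rep[OF xV])
  have "scalar_rank (n i) Q \<le> k" using x i Q by (simp add: bounded_rank_def)
  then obtain c where "rk (n i) (Q + c \<cdot>\<^sub>m 1\<^sub>m (n i)) \<le> k" using exists_scalar_shift[OF Q(1) _ i(2)] by blast
  then show ?thesis using Q cls_shift[OF Q(1), of c] by (intro bexI[of _ "Q + c \<cdot>\<^sub>m 1\<^sub>m (n i)"]) auto
qed

lemma bounded_rank_subset:
  assumes X: "StableClosed X" and v: "v \<in> X" and h: "rank_unbounded_below k v"
  shows "bounded_rank k \<subseteq> X"
proof
  fix x assume x: "x \<in> bounded_rank k"
  have xV: "x \<in> V" using x by (simp add: bounded_rank_def)
  have "\<exists>j\<ge>i. \<exists>w\<in>X. w j = x j" for i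
  proof -
    obtain j where j: "max i i0 \<le> j" "Suc k \<le> n j" using n_unbounded by blast
    then have j': "i0 \<le> j" "k < n j" "i \<le> j" by auto
    obtain P where "P \<in> sqmat (n j)" "x j = cls (n j) P" "rk (n j) P \<le> k"
      using bounded_rank_rep[OF x j'(1,2)] by blast
    then show ?thesis using orbit_corner[OF X v h j'(1)] j'(3) by metis
  qed
  then show "x \<in> X" using Closed_mem[of X x] X xV by (auto simp: stable_closed_def)
qed

lemma in_bounded_rank:
  assumes v: "v \<in> V" and h: "\<not> rank_unbounded_below (Suc k) v"
  shows "v \<in> bounded_rank k"
proof (rule bounded_rankI[OF v])
  obtain j0 where j0: "\<And>j f. j0 \<le> j \<Longrightarrow> v j = cls (n j) (fmat (n j) f) \<Longrightarrow> \<not> Suc k \<le> scalar_rank (n j) (fmat (n j) f)"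
    using h unfolding rank_unbounded_below_def by blast
  fix i
  obtain f where "v (max i j0) = cls (n (max i j0)) (fmat (n (max i j0)) f)" by (rule V_rep_fun[OF v])
  then show "\<exists>j\<ge>i. \<exists>P\<in>sqmat (n j). v j = cls (n j) P \<and> scalar_rank (n j) P \<le> k"
    using j0[of "max i j0" f] by (intro exI[of _ "max i j0"] conjI bexI[of _ "fmat (n (max i j0)) f"]) auto
qed

lemma rank_unbounded_below_0: "v \<in> V \<Longrightarrow> rank_unbounded_below 0 v"
  unfolding rank_unbounded_below_def using V_rep_fun by (metis le0 order_refl)

lemma rank_orbit:
  assumes X: "StableClosed X" and v: "v \<in> X"
  shows "X = V \<or> (\<exists>k. v \<in> bounded_rank k \<and> bounded_rank k \<subseteq> X)"
proof (cases "\<forall>k. rank_unbounded_below k v")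
  case True
  have "x \<in> X" if x: "x \<in> V" for x
  proof -
    have "\<exists>w\<in>X. w i = x i" if i: "i0 \<le> i" for i
    proof -
      obtain P where P: "P \<in> sqmat (n i)" "x i = cls (n i) P" by (rule V_rep[OF x])
      then show ?thesis using orbit_corner[OF X v True[rule_format, of "rk (n i) P"] i P(1)] by simp
    qed
    then have "\<exists>j\<ge>i. \<exists>w\<in>X. w j = x j" for i by (intro exI[of _ "max i i0"]) auto
    then show ?thesis using Closed_mem[of X x] X x by (auto simp: stable_closed_def)
  qed
  then show ?thesis using StableClosed_sub[OF X] by blast
next
  case False
  have vV: "v \<in> V" using StableClosed_sub[OF X] v by blast
  \<comment> \<open>\<open>k0\<close> is positive because rank 0 is always reached; its predecessor
    is the largest rank reached at arbitrarily high levels.\<close>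
  define k0 where "k0 = (LEAST k. \<not> rank_unbounded_below k v)"
  have k0: "\<not> rank_unbounded_below k0 v" unfolding k0_def by (rule LeastI_ex) (use False in blast)
  then obtain k where k: "k0 = Suc k" using rank_unbounded_below_0[OF vV] by (cases k0) auto
  have "rank_unbounded_below k v" using not_less_Least[of k "\<lambda>k. \<not> rank_unbounded_below k v"] k unfolding k0_def by auto
  then show ?thesis using bounded_rank_subset[OF X v] in_bounded_rank[OF vV, of k] k0 k by blast
qed

lemma Stable_bounded_rank: "Stable (bounded_rank k)"
proof (rule StableI)
  show "bounded_rank k \<subseteq> V" by (auto simp: bounded_rank_def)
  fix v w i and A :: "nat \<Rightarrow> 'a mat"
  assume v: "v \<in> bounded_rank k" and w: "w \<in> V"
    and A: "\<And>j. i \<le> j \<Longrightarrow> A j \<in> carrier (SL (n j)) \<and> w j = conj_act (A j) (v j)"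
  have vV: "v \<in> V" using v by (simp add: bounded_rank_def)
  show "w \<in> bounded_rank k"
  proof (rule bounded_rankI[OF w])
    fix i'
    let ?j = "max i' (max i i0)"
    have Aj: "A ?j \<in> carrier (SL (n ?j))" "w ?j = conj_act (A ?j) (v ?j)" using A[of ?j] by auto
    obtain P where P: "P \<in> sqmat (n ?j)" "v ?j = cls (n ?j) P" by (rule V_rep[OF vV])
    have "scalar_rank (n ?j) P \<le> k" using v P by (simp add: bounded_rank_def)
    then have "scalar_rank (n ?j) (A ?j * P * mat_inv (A ?j)) \<le> k" using scalar_rank_conj[OF Aj(1) P(1)] by simp
    moreover have "A ?j * P * mat_inv (A ?j) \<in> sqmat (n ?j)"
      using Aj(1) mat_inv(1)[OF Aj(1)] P by (auto simp: SL_simps)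
    moreover have "w ?j = cls (n ?j) (A ?j * P * mat_inv (A ?j))"
      unfolding Aj(2) P(2) by (rule conj_act_cls[OF Aj(1) P(1)])
    ultimately show "\<exists>j\<ge>i'. \<exists>P\<in>sqmat (n j). w j = cls (n j) P \<and> scalar_rank (n j) P \<le> k"
      by (intro exI[of _ ?j] conjI bexI[of _ "A ?j * P * mat_inv (A ?j)"]) auto
  qed
qed

text \<open>That some shift has rank at most \<open>k\<close> is not visibly a polynomial condition.
  Instead the closure, which is stable and closed, is tested: a point in it reaching rank
  \<open>k + 1\<close> would bring every matrix of rank at most \<open>k + 1\<close> into its
  components, in particular one with off-diagonal minor 1, although this minor vanishes on the rank
  locus.\<close>

lemma StableClosed_bounded_rank: "StableClosed (bounded_rank k)"
proof (rule StableClosedI)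
  show s: "bounded_rank k \<subseteq> V" by (auto simp: bounded_rank_def)
  show "Stable (bounded_rank k)" by (rule Stable_bounded_rank)
  show "zclosure (bounded_rank k) \<subseteq> bounded_rank k"
  proof
    fix v assume v: "v \<in> zclosure (bounded_rank k)"
    then have vV: "v \<in> V" by (simp add: zclosure_def)
    show "v \<in> bounded_rank k"
    proof (rule in_bounded_rank[OF vV], rule notI)
      assume h: "rank_unbounded_below (Suc k) v"
      have X: "StableClosed (zclosure (bounded_rank k))"
        using Closed_zclosure[OF s] Stable_zclosure[OF s Stable_bounded_rank] by (simp add: stable_closed_def)
      obtain i where i: "i0 \<le> i" "2 * k + 2 \<le> n i" using n_unbounded by blast
      \<comment> \<open>\<open>M\<close> has the identity in exactly the rows and columns of the
        off-diagonal minor.\<close>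
      define M where "M = fmat (n i) (\<lambda>a b. if b < Suc k \<and> a = Suc k + b then 1 else 0 :: 'a)"
      have M: "M \<in> sqmat (n i)" by (simp add: M_def)
      have "rk (n i) M \<le> Suc k"
      proof -
        let ?A = "mat (n i) (Suc k) (\<lambda>(a, b). if a = Suc k + b then 1 else 0 :: 'a)"
        let ?B = "mat (Suc k) (n i) (\<lambda>(a, b). if a = b then 1 else 0 :: 'a)"
        have A: "?A \<in> carrier_mat (n i) (Suc k)" and B: "?B \<in> carrier_mat (Suc k) (n i)" by auto
        have "M = ?A * ?B"
        proof (rule eq_matI)
          fix a b assume "a < dim_row (?A * ?B)" "b < dim_col (?A * ?B)"
          then have ab: "a < n i" "b < n i" by auto
          have "(?A * ?B) $$ (a, b) = (\<Sum>c<Suc k. ?A $$ (a, c) * ?B $$ (c, b))" by (rule mult_index[OF A B ab])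
          also have "\<dots> = (\<Sum>c<Suc k. if c = b then if a = Suc k + b then 1 else 0 else 0)"
            by (intro sum.cong refl) (use ab in auto)
          also have "\<dots> = M $$ (a, b)" using ab by (simp add: M_def)
          finally show "M $$ (a, b) = (?A * ?B) $$ (a, b)" by simp
        qed (auto simp: M_def)
        then show ?thesis using rank_mult_le[OF A B] by simp
      qed
      from orbit_corner[OF X v h i(1) M this] obtain w where w: "w \<in> zclosure (bounded_rank k)" "w i = cls (n i) M" by blast
      have "offdiag_minor k (s i) = 0" if s: "s \<in> bounded_rank k" for s
      proof -
        have sV: "s \<in> V" using s by (simp add: bounded_rank_def)
        obtain P where P: "P \<in> sqmat (n i)" "s i = cls (n i) P" by (rule V_rep[OF sV])
        have "scalar_rank (n i) P \<le> k" using s P i(1) by (simp add: bounded_rank_def)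
        then show ?thesis unfolding P(2) offdiag_minor_cls[OF P(1) i(2)] by (rule det_zero_of_scalar_rank[OF P(1) _ i(2)])
      qed
      moreover have "\<forall>f \<in> poly_fun (n i). (\<forall>s\<in>bounded_rank k. f (s i) = 0) \<longrightarrow> f (w i) = 0"
        using w(1) by (simp add: zclosure_def)
      ultimately have "offdiag_minor k (w i) = 0" using offdiag_minor_poly[OF i(2)] by blast
      moreover have "mat (Suc k) (Suc k) (\<lambda>(a, b). M $$ (Suc k + a, b)) = 1\<^sub>m (Suc k)"
        by (rule eq_matI) (use i(2) in \<open>auto simp: M_def\<close>)
      ultimately show False unfolding w(2) offdiag_minor_cls[OF M i(2)] by simp
    qed
  qed
qed

text \<open>If \<open>P = X * Q * Y\<close>, moving \<open>X\<close> and \<open>Y\<close> along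
  lines to the identity leads from \<open>P\<close> to \<open>Q\<close>, and the rank never exceeds
  that of \<open>Q\<close>.\<close>

lemma bounded_rank_curve:
  assumes P: "P \<in> sqmat (n i)" and Q: "Q \<in> sqmat (n i)"
    and r: "rk (n i) P \<le> rk (n i) Q" "rk (n i) Q \<le> k"
  shows "\<exists>X \<in> sqmat (n i). \<exists>Y \<in> sqmat (n i). P = X * Q * Y \<and>
    (\<forall>s. \<exists>x \<in> bounded_rank k. x i = cls (n i) ((X + s \<cdot>\<^sub>m (1\<^sub>m (n i) - X)) * Q * (Y + s \<cdot>\<^sub>m (1\<^sub>m (n i) - Y))))"
proof -
  obtain X Y where X: "X \<in> sqmat (n i)" and Y: "Y \<in> sqmat (n i)" and e: "P = X * Q * Y"
    using rank_le_imp_factor[OF P Q r(1)] by blast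
  have "\<exists>x \<in> bounded_rank k. x i = cls (n i) (A * Q * B)" if "A \<in> sqmat (n i)" "B \<in> sqmat (n i)" for A B
    by (rule bounded_rank_surj) (use rank_mult_mult_le[OF that(1) Q that(2)] r(2) that Q in auto)
  moreover have "Z + s \<cdot>\<^sub>m (1\<^sub>m (n i) - Z) \<in> sqmat (n i)" if "Z \<in> sqmat (n i)" for s and Z :: "'a mat"
    using minus_carrier_mat[OF that, of "1\<^sub>m (n i)"] by simp
  ultimately show ?thesis using X Y e by blast
qed

lemma Irreducible_bounded_rank: "Irreducible (bounded_rank k)"
proof -
  \<comment> \<open>From \<open>i1\<close> on the bound \<open>k\<close> is smaller than the size,
    so that classes in the locus have representatives of plain rank at most
    \<open>k\<close>.\<close>
  obtain i1 where i1: "i0 \<le> i1" "Suc k \<le> n i1" using n_unbounded by blast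
  show ?thesis
  proof (rule IrreducibleI[of _ i1])
    show "bounded_rank k \<subseteq> V" by (auto simp: bounded_rank_def)
    have "rk (n i0) (0\<^sub>m (n i0) (n i0) :: 'a mat) \<le> k" by (simp add: vec_space.rank_0I)
    then show "bounded_rank k \<noteq> {}" using bounded_rank_surj[of "0\<^sub>m (n i0) (n i0)" i0 k] by auto
    fix i v w assume i: "i1 \<le> i" and vw: "v \<in> bounded_rank k" "w \<in> bounded_rank k"
    have i': "i0 \<le> i" "k < n i" using i i1 n_mono[OF i] by auto
    obtain P where P: "P \<in> sqmat (n i)" "v i = cls (n i) P" "rk (n i) P \<le> k"
      using bounded_rank_rep[OF vw(1) i'] by blast
    obtain Q where Q: "Q \<in> sqmat (n i)" "w i = cls (n i) Q" "rk (n i) Q \<le> k"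
      using bounded_rank_rep[OF vw(2) i'] by blast
    let ?G = "\<lambda>X Y R s. (X + s \<cdot>\<^sub>m (1\<^sub>m (n i) - X)) * R * (Y + s \<cdot>\<^sub>m (1\<^sub>m (n i) - Y)) :: 'a mat"
    have G0: "?G X Y R 0 = X * R * Y" and G1: "?G X Y R 1 = R"
      if "X \<in> sqmat (n i)" "Y \<in> sqmat (n i)" "R \<in> sqmat (n i)" for X Y R
    proof -
      have "Z + 0 \<cdot>\<^sub>m (1\<^sub>m (n i) - Z) = Z" "Z + 1 \<cdot>\<^sub>m (1\<^sub>m (n i) - Z) = 1\<^sub>m (n i)" if "Z \<in> sqmat (n i)" for Z :: "'a mat"
        using that by (auto intro!: eq_matI)
      then show "?G X Y R 0 = X * R * Y" "?G X Y R 1 = R" using that by auto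
    qed
    have quad: "\<exists>P0\<in>sqmat (n i). \<exists>P1\<in>sqmat (n i). \<exists>P2\<in>sqmat (n i).
       \<forall>t. curve P0 P1 P2 t = (A0 + t \<cdot>\<^sub>m A1) * R * (B0 + t \<cdot>\<^sub>m B1)"
      if "A0 \<in> sqmat (n i)" "A1 \<in> sqmat (n i)" "B0 \<in> sqmat (n i)" "B1 \<in> sqmat (n i)"
        "R \<in> sqmat (n i)" for A0 A1 B0 B1 R :: "'a mat"
      using curve_product[OF that]
      by (intro bexI[of _ "A0 * R * B0"] bexI[of _ "A1 * R * B0 + A0 * R * B1"] bexI[of _ "A1 * R * B1"]) (use that in auto)
    have m: "1\<^sub>m (n i) - Z \<in> sqmat (n i)" "Z - 1\<^sub>m (n i) \<in> sqmat (n i)" if "Z \<in> sqmat (n i)" for Z :: "'a mat"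
      using that by (auto intro: minus_carrier_mat)
    show "curve_connected i (bounded_rank k) (v i) (w i)"
    proof (cases "rk (n i) P \<le> rk (n i) Q")
      case True
      obtain X Y where X: "X \<in> sqmat (n i)" and Y: "Y \<in> sqmat (n i)" and e: "P = X * Q * Y"
        and b: "\<And>s. \<exists>x \<in> bounded_rank k. x i = cls (n i) (?G X Y Q s)"
        using bounded_rank_curve[OF P(1) Q(1) True Q(3)] by blast
      obtain P0 P1 P2 where p: "P0 \<in> sqmat (n i)" "P1 \<in> sqmat (n i)" "P2 \<in> sqmat (n i)"
        and c: "\<And>t. curve P0 P1 P2 t = ?G X Y Q t" using quad[OF X m(1)[OF X] Y m(1)[OF Y] Q(1)] by blast
      have "v i = cls (n i) (curve P0 P1 P2 0)" "w i = cls (n i) (curve P0 P1 P2 1)"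
        unfolding c G0[OF X Y Q(1)] G1[OF X Y Q(1)] using P(2) Q(2) e by simp_all
      moreover have "\<forall>t. \<exists>x\<in>bounded_rank k. x i = cls (n i) (curve P0 P1 P2 t)" unfolding c using b by blast
      ultimately show ?thesis unfolding curve_connected_def using p by blast
    next
      case False
      then have le: "rk (n i) Q \<le> rk (n i) P" by simp
      obtain X Y where X: "X \<in> sqmat (n i)" and Y: "Y \<in> sqmat (n i)" and e: "Q = X * P * Y"
        and b: "\<And>s. \<exists>x \<in> bounded_rank k. x i = cls (n i) (?G X Y P s)"
        using bounded_rank_curve[OF Q(1) P(1) le P(3)] by blast
      obtain P0 P1 P2 where p: "P0 \<in> sqmat (n i)" "P1 \<in> sqmat (n i)" "P2 \<in> sqmat (n i)"
        and c: "\<And>t. curve P0 P1 P2 t = (1\<^sub>m (n i) + t \<cdot>\<^sub>m (X - 1\<^sub>m (n i))) * P * (1\<^sub>m (n i) + t \<cdot>\<^sub>m (Y - 1\<^sub>m (n i)))"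
        using quad[OF one_carrier_mat m(2)[OF X] one_carrier_mat m(2)[OF Y] P(1)] by blast
      \<comment> \<open>The curve of \<open>bounded_rank_curve\<close> runs from \<open>Q\<close> to
        \<open>P\<close> here; replacing \<open>t\<close> by \<open>1 - t\<close> reverses
        it.\<close>
      have rev: "1\<^sub>m (n i) + t \<cdot>\<^sub>m (Z - 1\<^sub>m (n i)) = Z + (1 - t) \<cdot>\<^sub>m (1\<^sub>m (n i) - Z)" if "Z \<in> sqmat (n i)" for Z :: "'a mat" and t
        using that by (intro eq_matI) (auto simp: algebra_simps)
      have c': "curve P0 P1 P2 t = ?G X Y P (1 - t)" for t unfolding c rev[OF X] rev[OF Y] ..
      have "v i = cls (n i) (curve P0 P1 P2 0)" unfolding c' using G1[OF X Y P(1)] P(2) by simp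
      moreover have "w i = cls (n i) (curve P0 P1 P2 1)" unfolding c' using G0[OF X Y P(1)] Q(2) e by simp
      moreover have "\<forall>t. \<exists>x\<in>bounded_rank k. x i = cls (n i) (curve P0 P1 P2 t)" unfolding c' using b by blast
      ultimately show ?thesis unfolding curve_connected_def using p by blast
    qed
  qed
qed

text \<open>This makes \<open>{0}\<close> the member \<open>k = 0\<close> of the family of rank
  loci.\<close>

lemma bounded_rank_0: "bounded_rank 0 = {zero_point n}"
proof -
  have "v = zero_point n" if v: "v \<in> bounded_rank 0" for v
  proof -
    have vV: "v \<in> V" using v by (simp add: bounded_rank_def)
    have "v i = zero_point n i" for i
    proof (rule V_down[OF vV zero_point_in_V])
      let ?j = "max i i0"
      obtain P where P: "P \<in> sqmat (n ?j)" "v ?j = cls (n ?j) P" "rk (n ?j) P \<le> 0"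
        using bounded_rank_rep[OF v, of ?j] pos by auto
      have "\<exists>B C. B \<in> carrier_mat (n ?j) 0 \<and> C \<in> carrier_mat 0 (n ?j) \<and> P = B * C"
        using rank_factorization[OF P(1)] P(3) by auto
      then obtain B C where B: "B \<in> carrier_mat (n ?j) 0" "C \<in> carrier_mat 0 (n ?j)" "P = B * C" by blast
      have "P = 0\<^sub>m (n ?j) (n ?j)" unfolding B(3) by (rule eq_matI) (use B(1,2) in \<open>auto simp: scalar_prod_def\<close>)
      then show "v ?j = zero_point n ?j" using P(2) by (simp add: zero_point_def)
    qed simp
    then show ?thesis by blast
  qed
  moreover have "zero_point n \<in> bounded_rank 0"
  proof -
    have "rk (n 0) (0\<^sub>m (n 0) (n 0) :: 'a mat) \<le> 0" by (simp add: vec_space.rank_0I)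
    then have "bounded_rank 0 \<noteq> {}" using bounded_rank_surj[of "0\<^sub>m (n 0) (n 0)" 0 0] by auto
    with calculation show ?thesis by blast
  qed
  ultimately show ?thesis by blast
qed

text \<open>Every matrix at a fixed level has finite rank, hence its class is the component of a
  point of some \<open>bounded_rank k\<close> contained in \<open>X\<close>.\<close>

lemma unbounded_ranks:
  assumes X: "StableClosed X" and inf: "infinite {k. bounded_rank k \<subseteq> X}"
  shows "X = V"
proof
  show "X \<subseteq> V" by (rule StableClosed_sub[OF X])
  show "V \<subseteq> X"
  proof
    fix x assume x: "x \<in> V"
    have "\<exists>w\<in>X. w i = x i" for i
    proof -
      obtain P where P: "P \<in> sqmat (n i)" "x i = cls (n i) P" by (rule V_rep[OF x])
      obtain k where k: "rk (n i) P \<le> k" "bounded_rank k \<subseteq> X"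
        using inf unfolding infinite_nat_iff_unbounded_le by blast
      then show ?thesis using bounded_rank_surj[OF P(1) k(1)] P(2) by auto
    qed
    then have "\<exists>j\<ge>i. \<exists>w\<in>X. w j = x j" for i by blast
    then show "x \<in> X" using Closed_mem[of X x] X x by (auto simp: stable_closed_def)
  qed
qed

lemma classification_rank:
  defines "\<Lambda> \<equiv> {{zero_point n}, V} \<union> {rank_locus n l r k | k. 1 \<le> k}"
  shows "classifies \<Lambda>"
proof -
  have L: "\<Lambda> = insert V (range bounded_rank)"
  proof -
    have "range bounded_rank = {bounded_rank 0} \<union> {bounded_rank k | k. 1 \<le> k}"
    proof (intro equalityI subsetI)
      fix Z assume "Z \<in> range bounded_rank"
      then obtain k where "Z = bounded_rank k" by blast
      then show "Z \<in> {bounded_rank 0} \<union> {bounded_rank k | k. 1 \<le> k}" by (cases k) auto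
    qed auto
    then show ?thesis unfolding \<Lambda>_def rank_locus_eq bounded_rank_0 by auto
  qed
  show ?thesis
  proof (rule classifiesI)
  show "V \<in> \<Lambda>" by (simp add: L)
  show "StableClosed Z \<and> Irreducible Z" if "Z \<in> \<Lambda>" for Z
    using that StableClosed_V Irreducible_V StableClosed_bounded_rank Irreducible_bounded_rank by (auto simp: L)
  show "\<exists>Z\<in>\<Lambda>. v \<in> Z \<and> Z \<subseteq> X" if "StableClosed X" "v \<in> X" for X v
    using rank_orbit[OF that] that(2) unfolding L by blast
  show "finite {Z \<in> \<Lambda>. Z \<subseteq> X}" if "StableClosed X" "X \<noteq> V" for X
  proof (rule finite_subset)
    show "{Z \<in> \<Lambda>. Z \<subseteq> X} \<subseteq> {V} \<union> bounded_rank ` {k. bounded_rank k \<subseteq> X}" unfolding L by auto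
    show "finite ({V} \<union> bounded_rank ` {k. bounded_rank k \<subseteq> X})"
      using unbounded_ranks[OF that(1)] that(2) by blast
  qed
  qed
qed

end

end

subsection \<open>The classification\<close>

lemma finite_eventually:
  assumes "finite {i::nat. P i}"
  shows "\<exists>i0. \<forall>i\<ge>i0. \<not> P i"
  using assms unfolding finite_nat_iff_bounded by (metis lessThan_iff mem_Collect_eq not_less subsetD)

lemma infinite_nat_obtain:
  assumes "infinite {i::nat. P i}"
  obtains k where "m \<le> k" "P k"
proof -
  have "\<exists>k\<ge>m. k \<in> {i. P i}" using assms[unfolded infinite_nat_iff_unbounded_le] by (rule spec)
  then show ?thesis using that by blast
qed

context diag_sequence
begin

text \<open>Once there are enough blocks above level \<open>i\<close>, there are enough at every
  later level. A later step with \<open>r k > 0\<close> then supplies an inverse transpose block,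
  and one with \<open>z k > 0\<close> an uncovered index.\<close>

lemma infinitely_translatable:
  assumes lr: "infinite {i. 1 < l i \<or> 0 < r i}"
  shows "\<exists>j\<ge>j0. translatable i (-1) j"
    "infinite {i. 0 < r i} \<Longrightarrow> \<exists>j\<ge>j0. translatable i 1 j"
    "infinite {i. 0 < z i} \<Longrightarrow> \<exists>j\<ge>j0. translatable i 0 j"
proof -
  let ?B = "4 * n i + 2"
  obtain j where "i \<le> j" "many_blocks i j ?B 0 False" using many_blocks_grow[OF lr] by blast
  then have m: "many_blocks i k ?B 0 False" if "max j j0 \<le> k" for k
    using many_blocks_mono that by auto
  show "\<exists>j\<ge>j0. translatable i (-1) j"
    using translatable_of_many_blocks(1)[OF m[OF order_refl]] max.cobounded2[of j0 j] by blast
  have step: "many_blocks i (Suc k) ?B (if 0 < r k then 1 else 0) (0 < z k)" if "max j j0 \<le> k" for k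
  proof (rule many_blocks_weaken[OF many_blocks_step[OF m[OF that]]])
    have "1 * ?B \<le> (l k + r k) * ?B" by (rule mult_le_mono1) (use l_pos[of k] in simp)
    then show "?B \<le> (l k + r k) * ?B" by (simp only: mult_1)
  qed auto
  show "\<exists>j\<ge>j0. translatable i 1 j" if rinf: "infinite {i. 0 < r i}"
  proof -
    obtain k where k: "max j j0 \<le> k" "0 < r k" by (rule infinite_nat_obtain[OF rinf])
    then have "translatable i 1 (Suc k)" 
      using translatable_of_many_blocks(2)[OF step[OF k(1)]] unfolding if_P[OF k(2)] by simp
    then show ?thesis using k(1) by (intro exI[of _ "Suc k"]) auto
  qed
  show "\<exists>j\<ge>j0. translatable i 0 j" if zinf: "infinite {i. 0 < z i}"
  proof -
    obtain k where k: "max j j0 \<le> k" "0 < z k" by (rule infinite_nat_obtain[OF zinf])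
    then have "translatable i 0 (Suc k)" 
      using translatable_of_many_blocks(3)[OF step[OF k(1)]] k(2) by blast
    then show ?thesis using k(1) by (intro exI[of _ "Suc k"]) auto
  qed
qed

text \<open>When \<open>z\<close> has vanished, \<open>n i\<close> divides \<open>n (Suc i)\<close>,
  so divisibility by \<open>d\<close> persists. Without this dichotomy the six cases would not be
  exhaustive.\<close>

lemma eventually_dvd:
  assumes "finite {i. 0 < z i}"
  shows "(\<forall>\<^sub>F i in sequentially. d dvd n i) \<or> (\<forall>\<^sub>F i in sequentially. \<not> d dvd n i)"
proof -
  obtain i0 where i0: "\<And>i. i0 \<le> i \<Longrightarrow> z i = 0" using finite_eventually[OF assms] by auto
  show ?thesis
  proof (cases "\<exists>i\<ge>i0. d dvd n i")
    case True
    then obtain i where i: "i0 \<le> i" "d dvd n i" by blast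
    have "d dvd n j" if "i \<le> j" for j
      using that
    proof (induct j rule: dec_induct)
      case (step j)
      then show ?case using i0[of j] i(1) by (simp add: n_Suc)
    qed (rule i(2))
    then show ?thesis unfolding eventually_sequentially by blast
  next
    case False
    then show ?thesis unfolding eventually_sequentially by blast
  qed
qed

end

lemma ecard_infinity: "ecard S = \<infinity> \<longleftrightarrow> infinite S"
  by (simp add: ecard_def)

theorem theorem13:
  fixes n l r z :: "nat \<Rightarrow> nat" and \<alpha> \<beta> \<gamma> :: enat
  assumes "infinite (UNIV :: 'a::field set)"
    and "0 < n 0"
    and "\<And>i. n (Suc i) = (l i + r i) * n i + z i"
    and "\<And>i. 1 \<le> l i"
    and "\<And>i. r i \<le> l i"
    and "\<alpha> = ecard {i. 1 < l i}"
    and "\<beta> = ecard {i. 0 < r i}"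
    and "\<gamma> = ecard {i. 0 < z i}"
    and "\<alpha> + \<beta> + \<gamma> = \<infinity>"
  shows "(\<exists>!c. in_case CHAR('a) n \<alpha> \<beta> \<gamma> c)
    \<and> (\<forall>X :: nat \<Rightarrow> (nat \<Rightarrow> 'a mat set) set.
         (\<forall>j. stable_closed n l r z (X j)) \<longrightarrow> (\<forall>j. X (Suc j) \<subseteq> X j) \<longrightarrow>
         (\<exists>N. \<forall>j\<ge>N. X j = X N))
    \<and> (\<forall>X :: (nat \<Rightarrow> 'a mat set) set. stable_closed n l r z X \<longrightarrow>
         (\<exists>\<F>. finite \<F> \<and> (\<forall>Y\<in>\<F>. stable_closed n l r z Y \<and> irreducible_in_lim n l r Y) \<and> X = \<Union>\<F>))
    \<and> {X :: (nat \<Rightarrow> 'a mat set) set. stable_closed n l r z X \<and> irreducible_in_lim n l r X} =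
        {{zero_point n}, inv_lim n l r}
        \<union> (if in_case CHAR('a) n \<alpha> \<beta> \<gamma> C1 then {rank_locus n l r k | k. 1 \<le> k} else {})
        \<union> (if in_case CHAR('a) n \<alpha> \<beta> \<gamma> C3b \<or> in_case CHAR('a) n \<alpha> \<beta> \<gamma> C4b
           then {trace_locus n l r \<mu> | \<mu>. True} else {})"
proof -
  interpret diag_sequence n l r z "TYPE('a)" by unfold_locales (use assms(1-5) in auto)
  let ?p = "CHAR('a)" let ?A = "infinite {i. 1 < l i}" let ?B = "infinite {i. 0 < r i}" let ?C = "infinite {i. 0 < z i}"
  let ?ev = "\<lambda>d. \<forall>\<^sub>F i in sequentially. d dvd n i" let ?nev = "\<lambda>d. \<forall>\<^sub>F i in sequentially. \<not> d dvd n i"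
  have inf: "\<alpha> = \<infinity> \<longleftrightarrow> ?A" "\<beta> = \<infinity> \<longleftrightarrow> ?B" "\<gamma> = \<infinity> \<longleftrightarrow> ?C" unfolding assms(6-8) ecard_infinity by auto
  have lt: "x < \<infinity> \<longleftrightarrow> x \<noteq> \<infinity>" for x :: enat by auto
  have total: "?A \<or> ?B \<or> ?C" using assms(9) inf by (auto simp: plus_eq_infty_iff_enat)
  have cs: "in_case ?p n \<alpha> \<beta> \<gamma> C1 \<longleftrightarrow> \<not> ?A \<and> \<not> ?B"
    "in_case ?p n \<alpha> \<beta> \<gamma> C2 \<longleftrightarrow> (?A \<or> ?B) \<and> ?C"
    "in_case ?p n \<alpha> \<beta> \<gamma> C3a \<longleftrightarrow> ?B \<and> \<not> ?C \<and> (?p \<noteq> 2 \<or> ?nev 2)"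
    "in_case ?p n \<alpha> \<beta> \<gamma> C3b \<longleftrightarrow> ?B \<and> \<not> ?C \<and> ?p = 2 \<and> ?ev 2"
    "in_case ?p n \<alpha> \<beta> \<gamma> C4a \<longleftrightarrow> \<not> ?B \<and> \<not> ?C \<and> ?nev ?p"
    "in_case ?p n \<alpha> \<beta> \<gamma> C4b \<longleftrightarrow> \<not> ?B \<and> \<not> ?C \<and> ?ev ?p"
    unfolding in_case.simps lt plus_eq_infty_iff_enat inf by auto
  have dich: "?ev d \<or> ?nev d" if "\<not> ?C" for d using eventually_dvd that by blast
  have excl: "\<not> (?ev d \<and> ?nev d)" for d
  proof
    assume "?ev d \<and> ?nev d"
    then obtain N M where "\<And>i. N \<le> i \<Longrightarrow> d dvd n i" "\<And>i. M \<le> i \<Longrightarrow> \<not> d dvd n i"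
      unfolding eventually_sequentially by blast
    from this[of "max N M"] show False by simp
  qed
  have one: "\<exists>!c. in_case ?p n \<alpha> \<beta> \<gamma> c"
  proof (rule ex_ex1I)
    show "\<exists>c. in_case ?p n \<alpha> \<beta> \<gamma> c"
      using total dich[of 2] dich[of ?p] cs by blast
    have "in_case ?p n \<alpha> \<beta> \<gamma> c \<longrightarrow> in_case ?p n \<alpha> \<beta> \<gamma> c' \<longrightarrow> c = c'" for c c'
      by (induct c; induct c'; simp only: cs; use total excl[of 2] excl[of ?p] in blast)
    then show "c = c'" if "in_case ?p n \<alpha> \<beta> \<gamma> c" "in_case ?p n \<alpha> \<beta> \<gamma> c'" for c c' using that by blast
  qed
  let ?L = "{{zero_point n}, V}
        \<union> (if in_case ?p n \<alpha> \<beta> \<gamma> C1 then {rank_locus n l r k | k. 1 \<le> k} else {})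
        \<union> (if in_case ?p n \<alpha> \<beta> \<gamma> C3b \<or> in_case ?p n \<alpha> \<beta> \<gamma> C4b then {trace_locus n l r \<mu> | \<mu>. True} else {})"
  have AB: "infinite {i. 1 < l i \<or> 0 < r i}" if "?A \<or> ?B"
  proof -
    have "{i. 1 < l i \<or> 0 < r i} = {i. 1 < l i} \<union> {i. 0 < r i}" by auto
    then show ?thesis using that by simp
  qed
  have char: "of_nat m = (0 :: 'a) \<longleftrightarrow> ?p dvd m" for m by (rule of_nat_eq_0_iff_char_dvd)
  have two: "(2 :: 'a) = 0" if "?p = 2" using char[of 2] that by simp
  have "classifies ?L"
  proof (cases "?A \<or> ?B")
    case False
    then obtain i0 where i0: "\<forall>i\<ge>i0. \<not> (1 < l i \<or> 0 < r i)"
      using finite_eventually[of "\<lambda>i. 1 < l i \<or> 0 < r i"] by (auto simp: Collect_disj_eq)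
    then have lr: "l i = 1" "r i = 0" if "i0 \<le> i" for i using that l_pos[of i] by (auto simp: le_antisym)
    have "?C" using False total by blast
    then have "classifies ({{zero_point n}, V} \<union> {rank_locus n l r k | k. 1 \<le> k})"
      by (intro classification_rank[of i0]) (use lr in auto)
    moreover have "in_case ?p n \<alpha> \<beta> \<gamma> C1" "\<not> (in_case ?p n \<alpha> \<beta> \<gamma> C3b \<or> in_case ?p n \<alpha> \<beta> \<gamma> C4b)"
      using cs(1,4,6) False \<open>?C\<close> by blast+
    ultimately show ?thesis by (simp only: if_False if_True Un_empty_right)
  next
    case True
    note tr = infinitely_translatable[OF AB[OF True]]
    show ?thesis
    proof (cases "in_case ?p n \<alpha> \<beta> \<gamma> C3b \<or> in_case ?p n \<alpha> \<beta> \<gamma> C4b")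
      case False
      \<comment> \<open>The choice of \<open>\<epsilon>\<close>: 0 if uncovered indices keep
        appearing, 1 if inverse transpose blocks do and 2 is invertible, and otherwise -1, where the
        remaining cases leave \<open>n i\<close> invertible for large \<open>i\<close>.\<close>
      have "\<exists>i0. \<forall>i\<ge>i0. \<exists>\<epsilon>. (\<forall>j0. \<exists>j\<ge>j0. translatable i \<epsilon> j) \<and> (1 + \<epsilon> \<noteq> 0 \<or> of_nat (n i) \<noteq> (0 :: 'a))"
      proof (cases ?C)
        case C: True
        have "\<forall>j0. \<exists>j\<ge>j0. translatable i 0 j" for i using tr(3)[OF C] by blast
        then show ?thesis by (intro exI[of _ 0] allI impI exI[of _ "0 :: 'a"]) simp
      next
        case C: False
        show ?thesis
        proof (cases "?B \<and> ?p \<noteq> 2")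
          case True
          then have "\<forall>j0. \<exists>j\<ge>j0. translatable i 1 j" for i using tr(2) by blast
          moreover have "1 + 1 \<noteq> (0 :: 'a)"
          proof
            assume "1 + 1 = (0 :: 'a)"
            then have "?p dvd 2" using char[of 2] by simp
            then have "?p \<in> {1, 2}" using dvd_imp_le[of ?p 2] by (auto simp: le_Suc_eq numeral_2_eq_2)
            moreover have "?p \<noteq> 1" using char[of 1] by auto
            ultimately show False using True by blast
          qed
          ultimately show ?thesis by (intro exI[of _ 0] allI impI exI[of _ "1 :: 'a"]) simp
        next
          case F: False
          have "\<not> ?ev ?p"
          proof (cases ?B)
            case True
            then have "?p = 2" using F by blast
            then show ?thesis using False C True cs(4) by metis
          next
            case B: False
            then show ?thesis using False C cs(6) by blast
          qed
          then have "?nev ?p" using dich[OF C] by blast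
          then obtain i0 where i0: "\<And>i. i0 \<le> i \<Longrightarrow> \<not> ?p dvd n i" unfolding eventually_sequentially by blast
          have "of_nat (n i) \<noteq> (0 :: 'a)" if "i0 \<le> i" for i using char[of "n i"] i0[OF that] by simp
          moreover have "\<forall>j0. \<exists>j\<ge>j0. translatable i (-1) j" for i using tr(1) by blast
          ultimately show ?thesis by (intro exI[of _ i0] allI impI exI[of _ "-1 :: 'a"]) simp
        qed
      qed
      then obtain i0 where i0: "\<forall>i\<ge>i0. \<exists>\<epsilon>. (\<forall>j0. \<exists>j\<ge>j0. translatable i \<epsilon> j) \<and> (1 + \<epsilon> \<noteq> 0 \<or> of_nat (n i) \<noteq> (0 :: 'a))" ..
      have "classifies {{zero_point n}, V}" by (rule classification_no_invariant[OF i0[rule_format]])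
      moreover have "\<not> in_case ?p n \<alpha> \<beta> \<gamma> C1" using cs(1) True by blast
      ultimately show ?thesis using False by (simp only: if_False Un_empty_right)
    next
      case trace: True
      then have C: "\<not> ?C" using cs by blast
      have ev: "?ev ?p" using trace cs(4,6) by metis
      obtain i1 where i1: "\<And>i. i1 \<le> i \<Longrightarrow> ?p dvd n i" using ev unfolding eventually_sequentially by blast
      obtain i2 where i2: "\<And>i. i2 \<le> i \<Longrightarrow> z i = 0" using finite_eventually[of "\<lambda>i. 0 < z i"] C by auto
      \<comment> \<open>The trace is compatible with transposed blocks either because the
        characteristic is two or because such blocks eventually cease to occur.\<close>
      have "\<exists>i3. \<forall>i\<ge>i3. r i = 0 \<or> (2 :: 'a) = 0"
      proof (cases ?B)
        case True
        then have "?p = 2" using trace cs by blast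
        then show ?thesis using two by blast
      next
        case False
        then show ?thesis using finite_eventually[of "\<lambda>i. 0 < r i"] by auto
      qed
      then obtain i3 where i3: "\<And>i. i3 \<le> i \<Longrightarrow> r i = 0 \<or> (2 :: 'a) = 0" by blast
      have "classifies ({{zero_point n}, V} \<union> {trace_locus n l r \<mu> | \<mu>. True})"
        by (rule classification_trace[of "max i1 (max i2 i3)"]) (use i1 i2 i3 char tr(1) in auto)
      moreover have "\<not> in_case ?p n \<alpha> \<beta> \<gamma> C1" using cs(1) True by blast
      ultimately show ?thesis using trace by (simp only: if_False if_True Un_empty_right)
    qed
  qed
  note c = classification[OF this]
  show ?thesis using one c(1) c(2) c(3) by blast
qed

end
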